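(* Let $V$ be the ground model, let $\mathbb{P}\in V$ be a notion of forcing adding an unsplit real over $V$, and let $\mathcal{A}\in V$ be an infinite Boolean algebra. Then for every $\mathbb{P}$-generic filter $G$ over $V$, the Stone space $St(\mathcal{A})$ as computed in $V[G]$ contains a non-trivial convergent sequence.
   Context: An (infinite) set $U\in\wp(\omega)\cap V[G]$ is unsplit over $V$ if for every $A\in\wp(\omega)\cap V$, either $U\cap A$ is finite or $U\setminus A$ is finite. A sequence $(x_n)$ is non-trivial if its terms are pairwise distinct and, if it converges, no term equals its limit. *)

theory Defs
  imports Main
begin

section \<open>The surrounding universe of sets\<close>

text \<open>
  Transitive models and their generic extensions live in a well-founded universe of sets.
  The axiom \<open>replacement\<close> is second-order: \<open>P\<close> and \<open>f\<close> are arbitrary, so it also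
  yields the empty set, every subset of a set, and the values of names under
  an arbitrary filter. Power set and infinity are not demanded, so that the hereditarily
  countable sets, in which every countable transitive model lies, are an instance.
\<close>

class set_universe =
  fixes mem :: "'a \<Rightarrow> 'a \<Rightarrow> bool" (infix "\<epsilon>" 50)
  assumes extensionality: "(\<And>z. z \<epsilon> x \<longleftrightarrow> z \<epsilon> y) \<Longrightarrow> x = y"
    and foundation: "wf {(x, y). x \<epsilon> y}"
    and pairing: "\<exists>z. \<forall>w. w \<epsilon> z \<longleftrightarrow> w = x \<or> w = y"
    and union: "\<exists>y. \<forall>z. z \<epsilon> y \<longleftrightarrow> (\<exists>w. w \<epsilon> x \<and> z \<epsilon> w)"
    and replacement: "\<exists>y. \<forall>z. z \<epsilon> y \<longleftrightarrow> (\<exists>w. w \<epsilon> x \<and> P w \<and> z = f w)"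

definition elts :: "'v::set_universe \<Rightarrow> 'v set" where
  "elts x = {z. z \<epsilon> x}"

definition set_of :: "'v::set_universe set \<Rightarrow> 'v" where
  "set_of S = (THE x. elts x = S)"

definition opair :: "'v::set_universe \<Rightarrow> 'v \<Rightarrow> 'v" where
  "opair x y = set_of {set_of {x}, set_of {x, y}}"

text \<open>The von Neumann numerals; the set of natural numbers is the range of \<open>num\<close>.\<close>

primrec num :: "nat \<Rightarrow> 'v::set_universe" where
  "num 0 = set_of {}"
| "num (Suc n) = set_of (insert (num n) (elts (num n)))"

definition function_on :: "'v::set_universe \<Rightarrow> 'v set \<Rightarrow> 'v set \<Rightarrow> bool" where
  "function_on f D C \<longleftrightarrow>
     elts f \<subseteq> {opair x y | x y. x \<in> D \<and> y \<in> C} \<and> (\<forall>x\<in>D. \<exists>!y. opair x y \<epsilon> f)"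

definition app :: "'v::set_universe \<Rightarrow> 'v \<Rightarrow> 'v" where
  "app f x = (THE y. opair x y \<epsilon> f)"


section \<open>Transitive models of ZFC\<close>

datatype fm = Mem nat nat | Eq nat nat | Neg fm | Conj fm fm | All nat fm

primrec sat :: "'v::set_universe set \<Rightarrow> (nat \<Rightarrow> 'v) \<Rightarrow> fm \<Rightarrow> bool" where
  "sat M \<rho> (Mem i j) \<longleftrightarrow> \<rho> i \<epsilon> \<rho> j"
| "sat M \<rho> (Eq i j) \<longleftrightarrow> \<rho> i = \<rho> j"
| "sat M \<rho> (Neg \<phi>) \<longleftrightarrow> \<not> sat M \<rho> \<phi>"
| "sat M \<rho> (Conj \<phi> \<psi>) \<longleftrightarrow> sat M \<rho> \<phi> \<and> sat M \<rho> \<psi>"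
| "sat M \<rho> (All i \<phi>) \<longleftrightarrow> (\<forall>x\<in>M. sat M (\<rho>(i := x)) \<phi>)"

definition transitive_class :: "'v::set_universe set \<Rightarrow> bool" where
  "transitive_class M \<longleftrightarrow> (\<forall>x\<in>M. elts x \<subseteq> M)"

text \<open>
  All quantifiers are relativised to \<open>M\<close>. In the two schemes the assignment \<open>\<rho>\<close> supplies
  the parameters, and variables 0 and 1 are the argument places of the formula. Choice is
  the existence of transversals for families of nonempty pairwise disjoint sets.
\<close>

locale ZFC_model =
  fixes M :: "'v::set_universe set"
  assumes nonempty: "M \<noteq> {}"
    and extensionality: "\<forall>x\<in>M. \<forall>y\<in>M. (\<forall>z\<in>M. z \<epsilon> x \<longleftrightarrow> z \<epsilon> y) \<longrightarrow> x = y"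
    and foundation: "\<forall>x\<in>M. (\<exists>y\<in>M. y \<epsilon> x) \<longrightarrow>
      (\<exists>y\<in>M. y \<epsilon> x \<and> \<not> (\<exists>z\<in>M. z \<epsilon> x \<and> z \<epsilon> y))"
    and pairing: "\<forall>x\<in>M. \<forall>y\<in>M. \<exists>z\<in>M. \<forall>w\<in>M. w \<epsilon> z \<longleftrightarrow> w = x \<or> w = y"
    and union: "\<forall>x\<in>M. \<exists>y\<in>M. \<forall>z\<in>M. z \<epsilon> y \<longleftrightarrow> (\<exists>w\<in>M. w \<epsilon> x \<and> z \<epsilon> w)"
    and power_set: "\<forall>x\<in>M. \<exists>y\<in>M. \<forall>z\<in>M. z \<epsilon> y \<longleftrightarrow> (\<forall>w\<in>M. w \<epsilon> z \<longrightarrow> w \<epsilon> x)"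
    and infinity: "\<exists>w\<in>M. (\<exists>e\<in>M. e \<epsilon> w \<and> (\<forall>z\<in>M. \<not> z \<epsilon> e)) \<and>
      (\<forall>x\<in>M. x \<epsilon> w \<longrightarrow> (\<exists>y\<in>M. y \<epsilon> w \<and> (\<forall>z\<in>M. z \<epsilon> y \<longleftrightarrow> z \<epsilon> x \<or> z = x)))"
    and separation: "\<forall>\<phi> \<rho>. range \<rho> \<subseteq> M \<longrightarrow>
      (\<forall>a\<in>M. \<exists>b\<in>M. \<forall>z\<in>M. z \<epsilon> b \<longleftrightarrow> z \<epsilon> a \<and> sat M (\<rho>(0 := z)) \<phi>)"
    and replacement: "\<forall>\<phi> \<rho>. range \<rho> \<subseteq> M \<longrightarrow>
      (\<forall>a\<in>M. (\<forall>x\<in>M. x \<epsilon> a \<longrightarrow> (\<exists>!y. y \<in> M \<and> sat M (\<rho>(0 := x, 1 := y)) \<phi>)) \<longrightarrow>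
        (\<exists>b\<in>M. \<forall>y\<in>M. y \<epsilon> b \<longleftrightarrow> (\<exists>x\<in>M. x \<epsilon> a \<and> sat M (\<rho>(0 := x, 1 := y)) \<phi>)))"
    and choice: "\<forall>F\<in>M. (\<forall>x\<in>M. x \<epsilon> F \<longrightarrow> (\<exists>z\<in>M. z \<epsilon> x)) \<longrightarrow>
      (\<forall>x\<in>M. \<forall>y\<in>M. x \<epsilon> F \<and> y \<epsilon> F \<and> x \<noteq> y \<longrightarrow> \<not> (\<exists>z\<in>M. z \<epsilon> x \<and> z \<epsilon> y)) \<longrightarrow>
      (\<exists>C\<in>M. \<forall>x\<in>M. x \<epsilon> F \<longrightarrow> (\<exists>!z. z \<in> M \<and> z \<epsilon> C \<and> z \<epsilon> x))"

definition ground_model :: "'v::set_universe set \<Rightarrow> bool" where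
  "ground_model M \<longleftrightarrow> transitive_class M \<and> ZFC_model M"


section \<open>Forcing\<close>

text \<open>A greatest condition and antisymmetry are not demanded.\<close>

definition forcing_notion :: "'v::set_universe \<Rightarrow> 'v \<Rightarrow> bool" where
  "forcing_notion P leq \<longleftrightarrow>
     elts P \<noteq> {} \<and> preorder_on (elts P) {(p, q). opair p q \<epsilon> leq}"

definition filter_on :: "'v::set_universe \<Rightarrow> 'v \<Rightarrow> 'v set \<Rightarrow> bool" where
  "filter_on P leq G \<longleftrightarrow>
     G \<subseteq> elts P \<and> G \<noteq> {} \<and>
     (\<forall>p\<in>G. \<forall>q\<in>elts P. opair p q \<epsilon> leq \<longrightarrow> q \<in> G) \<and>
     (\<forall>p\<in>G. \<forall>q\<in>G. \<exists>r\<in>G. opair r p \<epsilon> leq \<and> opair r q \<epsilon> leq)"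

definition dense_in :: "'v::set_universe \<Rightarrow> 'v \<Rightarrow> 'v set \<Rightarrow> bool" where
  "dense_in P leq D \<longleftrightarrow> D \<subseteq> elts P \<and> (\<forall>p\<in>elts P. \<exists>d\<in>D. opair d p \<epsilon> leq)"

definition generic_filter :: "'v::set_universe set \<Rightarrow> 'v \<Rightarrow> 'v \<Rightarrow> 'v set \<Rightarrow> bool" where
  "generic_filter M P leq G \<longleftrightarrow>
     filter_on P leq G \<and> (\<forall>D\<in>M. dense_in P leq (elts D) \<longrightarrow> G \<inter> elts D \<noteq> {})"

inductive is_name :: "'v::set_universe \<Rightarrow> 'v \<Rightarrow> bool" for P where
  "(\<And>z. z \<epsilon> \<tau> \<Longrightarrow> \<exists>\<sigma> p. z = opair \<sigma> p \<and> is_name P \<sigma> \<and> p \<epsilon> P) \<Longrightarrow> is_name P \<tau>"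

text \<open>The usual recursion for the value of a name is \<open>val_unfold\<close> below.\<close>

definition val :: "'v::set_universe set \<Rightarrow> 'v \<Rightarrow> 'v" where
  "val G = wfrec ({(x, y). x \<epsilon> y}\<^sup>+)
     (\<lambda>v \<tau>. set_of {v \<sigma> | \<sigma>. \<exists>p\<in>G. opair \<sigma> p \<epsilon> \<tau>})"

definition generic_extension :: "'v::set_universe set \<Rightarrow> 'v \<Rightarrow> 'v set \<Rightarrow> 'v set" where
  "generic_extension M P G = {val G \<tau> | \<tau>. \<tau> \<in> M \<and> is_name P \<tau>}"

definition unsplit_over :: "'v::set_universe set \<Rightarrow> 'v \<Rightarrow> bool" where
  "unsplit_over M U \<longleftrightarrow>
     elts U \<subseteq> range num \<and> infinite (elts U) \<and>
     (\<forall>A\<in>M. elts A \<subseteq> range num \<longrightarrow> finite (elts U \<inter> elts A) \<or> finite (elts U - elts A))"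

definition adds_unsplit_real :: "'v::set_universe set \<Rightarrow> 'v \<Rightarrow> 'v \<Rightarrow> bool" where
  "adds_unsplit_real M P leq \<longleftrightarrow>
     (\<forall>G. generic_filter M P leq G \<longrightarrow> (\<exists>U\<in>generic_extension M P G. unsplit_over M U))"


section \<open>Boolean algebras and their Stone spaces\<close>

record 'v bool_alg =
  univ :: 'v
  join :: 'v
  meet :: 'v
  compl :: 'v
  bottom :: 'v
  top_elt :: 'v

definition join_op :: "'v::set_universe bool_alg \<Rightarrow> 'v \<Rightarrow> 'v \<Rightarrow> 'v" where
  "join_op A a b = app (join A) (opair a b)"

definition meet_op :: "'v::set_universe bool_alg \<Rightarrow> 'v \<Rightarrow> 'v \<Rightarrow> 'v" where
  "meet_op A a b = app (meet A) (opair a b)"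

definition compl_op :: "'v::set_universe bool_alg \<Rightarrow> 'v \<Rightarrow> 'v" where
  "compl_op A a = app (compl A) a"

definition is_boolean_algebra :: "'v::set_universe bool_alg \<Rightarrow> bool" where
  "is_boolean_algebra A \<longleftrightarrow>
     (let B = elts (univ A); BB = {opair a b | a b. a \<in> B \<and> b \<in> B};
          j = join_op A; m = meet_op A; c = compl_op A
      in function_on (join A) BB B \<and> function_on (meet A) BB B \<and> function_on (compl A) B B \<and>
         bottom A \<in> B \<and> top_elt A \<in> B \<and>
         (\<forall>x\<in>B. \<forall>y\<in>B. \<forall>z\<in>B.
            j x (j y z) = j (j x y) z \<and> m x (m y z) = m (m x y) z \<and>
            j x y = j y x \<and> m x y = m y x \<and>
            j x (m x y) = x \<and> m x (j x y) = x \<and>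
            m x (j y z) = j (m x y) (m x z) \<and> j x (m y z) = m (j x y) (j x z) \<and>
            j x (c x) = top_elt A \<and> m x (c x) = bottom A))"

text \<open>For a model \<open>M\<close> this amounts to the 6-tuple belonging to \<open>M\<close>.\<close>

definition bool_alg_in :: "'v bool_alg \<Rightarrow> 'v set \<Rightarrow> bool" where
  "bool_alg_in A M \<longleftrightarrow>
     univ A \<in> M \<and> join A \<in> M \<and> meet A \<in> M \<and> compl A \<in> M \<and> bottom A \<in> M \<and> top_elt A \<in> M"

definition is_ultrafilter :: "'v::set_universe bool_alg \<Rightarrow> 'v \<Rightarrow> bool" where
  "is_ultrafilter A u \<longleftrightarrow>
     elts u \<subseteq> elts (univ A) \<and> top_elt A \<epsilon> u \<and> \<not> bottom A \<epsilon> u \<and>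
     (\<forall>a b. a \<epsilon> u \<and> b \<epsilon> u \<longrightarrow> meet_op A a b \<epsilon> u) \<and>
     (\<forall>a b. a \<epsilon> u \<and> b \<epsilon> univ A \<and> meet_op A a b = a \<longrightarrow> b \<epsilon> u) \<and>
     (\<forall>a. a \<epsilon> univ A \<longrightarrow> a \<epsilon> u \<or> compl_op A a \<epsilon> u)"

text \<open>
  The Stone space as computed in a model \<open>N\<close>: its points are the ultrafilters in \<open>N\<close>, its
  open sets are those sets in \<open>N\<close> that are unions of basic sets \<open>stone_basic N A a\<close>, and its
  sequences are those whose graph is in \<open>N\<close>.
\<close>

definition stone_space :: "'v::set_universe set \<Rightarrow> 'v bool_alg \<Rightarrow> 'v set" where
  "stone_space N A = {u \<in> N. is_ultrafilter A u}"

definition stone_basic :: "'v::set_universe set \<Rightarrow> 'v bool_alg \<Rightarrow> 'v \<Rightarrow> 'v set" where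
  "stone_basic N A a = {u \<in> stone_space N A. a \<epsilon> u}"

definition stone_open :: "'v::set_universe set \<Rightarrow> 'v bool_alg \<Rightarrow> 'v \<Rightarrow> bool" where
  "stone_open N A W \<longleftrightarrow>
     W \<in> N \<and> elts W \<subseteq> stone_space N A \<and>
     (\<forall>u\<in>elts W. \<exists>a\<in>elts (univ A). u \<in> stone_basic N A a \<and> stone_basic N A a \<subseteq> elts W)"

definition stone_sequence :: "'v::set_universe set \<Rightarrow> 'v bool_alg \<Rightarrow> (nat \<Rightarrow> 'v) \<Rightarrow> bool" where
  "stone_sequence N A x \<longleftrightarrow>
     range x \<subseteq> stone_space N A \<and> (\<exists>s\<in>N. elts s = range (\<lambda>n. opair (num n) (x n)))"

definition stone_converges :: "'v::set_universe set \<Rightarrow> 'v bool_alg \<Rightarrow> (nat \<Rightarrow> 'v) \<Rightarrow> 'v \<Rightarrow> bool" where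
  "stone_converges N A x l \<longleftrightarrow>
     l \<in> stone_space N A \<and>
     (\<forall>W. stone_open N A W \<and> l \<epsilon> W \<longrightarrow> (\<exists>k. \<forall>n\<ge>k. x n \<epsilon> W))"

definition nontrivial_sequence :: "'v::set_universe set \<Rightarrow> 'v bool_alg \<Rightarrow> (nat \<Rightarrow> 'v) \<Rightarrow> bool" where
  "nontrivial_sequence N A x \<longleftrightarrow>
     inj x \<and> (\<forall>l. stone_converges N A x l \<longrightarrow> (\<forall>n. x n \<noteq> l))"


section \<open>Basic facts\<close>

lemma elts_inject: "elts x = elts y \<Longrightarrow> x = y"
  unfolding elts_def by (rule extensionality) blast

lemma elts_set_of: "elts x = S \<Longrightarrow> elts (set_of S) = S"
  unfolding set_of_def by (rule theI2[of _ x]) (auto intro: elts_inject)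

lemma elts_set_of_upair [simp]: "elts (set_of {x, y}) = {x, y}"
proof -
  obtain z where "\<forall>w. w \<epsilon> z \<longleftrightarrow> w = x \<or> w = y" using pairing by blast
  then have "elts z = {x, y}" by (auto simp: elts_def)
  then show ?thesis by (rule elts_set_of)
qed

lemma elts_set_of_singleton [simp]: "elts (set_of {x}) = {x}"
  using elts_set_of_upair[of x x] by simp

lemma elts_set_of_image:
  fixes f :: "'v::set_universe \<Rightarrow> 'v"
  shows "elts (set_of {f w | w. w \<epsilon> x \<and> P w}) = {f w | w. w \<epsilon> x \<and> P w}"
proof -
  obtain y where "\<forall>z. z \<epsilon> y \<longleftrightarrow> (\<exists>w. w \<epsilon> x \<and> P w \<and> z = f w)" using replacement[of x P f] by blast
  then have "elts y = {f w | w. w \<epsilon> x \<and> P w}" by (auto simp: elts_def)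
  then show ?thesis by (rule elts_set_of)
qed

lemma elts_num_0 [simp]: "elts (num 0) = {}"
  using elts_set_of_image[where P = "\<lambda>_. False"] by simp

lemma elts_num_Suc [simp]:
  "elts (num (Suc n) :: 'v::set_universe) = insert (num n) (elts (num n))"
proof -
  let ?x = "num n :: 'v"
  let ?p = "set_of {?x, set_of {?x}}"
  obtain y where "\<forall>z. z \<epsilon> y \<longleftrightarrow> (\<exists>w. w \<epsilon> ?p \<and> z \<epsilon> w)" using union by blast
  then have "elts y = \<Union> (elts ` elts ?p)" by (auto simp: elts_def)
  then have "elts y = insert ?x (elts ?x)" by simp
  then show ?thesis by (simp add: elts_set_of)
qed

lemma opair_inject [simp]: "opair x y = opair x' y' \<longleftrightarrow> x = x' \<and> y = y'"
proof
  have e: "elts ` elts (opair a b) = {{a}, {a, b}}" for a b :: 'a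
    unfolding opair_def by simp
  assume "opair x y = opair x' y'"
  then have "{{x}, {x, y}} = {{x'}, {x', y'}}"
    unfolding e[symmetric] by (rule arg_cong)
  then show "x = x' \<and> y = y'" by (auto simp: doubleton_eq_iff)
qed simp

lemma opair_rel: "opair \<sigma> p \<epsilon> \<tau> \<Longrightarrow> (\<sigma>, \<tau>) \<in> {(x, y). x \<epsilon> y}\<^sup>+"
proof -
  assume *: "opair \<sigma> p \<epsilon> \<tau>"
  have "\<sigma> \<in> elts (set_of {\<sigma>})" "set_of {\<sigma>} \<in> elts (opair \<sigma> p)"
    unfolding opair_def by simp_all
  then have 1: "(\<sigma>, set_of {\<sigma>}) \<in> {(x, y). x \<epsilon> y}"
    and 2: "(set_of {\<sigma>}, opair \<sigma> p) \<in> {(x, y). x \<epsilon> y}" by (simp_all add: elts_def)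
  have 3: "(opair \<sigma> p, \<tau>) \<in> {(x, y). x \<epsilon> y}" using * by simp
  show ?thesis by (rule trancl_into_trancl[OF trancl_into_trancl[OF r_into_trancl[OF 1] 2] 3])
qed

lemma val_unfold: "val G \<tau> = set_of {val G \<sigma> | \<sigma>. \<exists>p\<in>G. opair \<sigma> p \<epsilon> \<tau>}"
proof -
  let ?R = "{(x, y :: 'a). x \<epsilon> y}\<^sup>+"
  let ?F = "\<lambda>v \<tau>. set_of {v \<sigma> | \<sigma>. \<exists>p\<in>G. opair \<sigma> p \<epsilon> \<tau>}"
  have "wf ?R" by (rule wf_trancl[OF foundation])
  then have *: "val G \<tau> = ?F (cut (val G) ?R \<tau>) \<tau>"
    by (rule def_wfrec[OF val_def[THEN eq_reflection]])
  have c: "cut (val G) ?R \<tau> \<sigma> = val G \<sigma>" if "opair \<sigma> p \<epsilon> \<tau>" for \<sigma> p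
    using opair_rel[OF that] by (rule cut_apply)
  have "{cut (val G) ?R \<tau> \<sigma> | \<sigma>. \<exists>p\<in>G. opair \<sigma> p \<epsilon> \<tau>} =
      {val G \<sigma> | \<sigma>. \<exists>p\<in>G. opair \<sigma> p \<epsilon> \<tau>}"
    by (intro Collect_cong ex_cong1) (use c in force)
  with * show ?thesis by (rule trans[OF _ arg_cong])
qed

lemma elts_val: "elts (val G \<tau>) = {val G \<sigma> | \<sigma>. \<exists>p\<in>G. opair \<sigma> p \<epsilon> \<tau>}"
proof -
  define f where "f z = val G (SOME \<sigma>. \<exists>p. z = opair \<sigma> p)" for z
  have f: "f (opair \<sigma> p) = val G \<sigma>" for \<sigma> p
    unfolding f_def by simp
  have *: "{val G \<sigma> | \<sigma>. \<exists>p\<in>G. opair \<sigma> p \<epsilon> \<tau>} =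
      {f z | z. z \<epsilon> \<tau> \<and> (\<exists>\<sigma>. \<exists>p\<in>G. z = opair \<sigma> p)}"
    (is "?L = ?R")
  proof
    show "?L \<subseteq> ?R"
    proof
      fix y assume "y \<in> ?L"
      then obtain \<sigma> p where "y = val G \<sigma>" "p \<in> G" "opair \<sigma> p \<epsilon> \<tau>" by blast
      then show "y \<in> ?R" using f[of \<sigma> p, symmetric] by auto
    qed
    show "?R \<subseteq> ?L" using f by auto
  qed
  show ?thesis
    unfolding val_unfold[of G \<tau>] * by (rule elts_set_of_image)
qed

end

theory Submission
  imports Defs "HOL-Library.Infinite_Set"
begin

text \<open>
  Let \<open>U\<close> be unsplit over \<open>M\<close> and let \<open>x\<^sub>n\<close> be distinct ultrafilters on \<open>A\<close>, the sequence lying in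
  \<open>M\<close>.  For \<open>a \<in> A\<close> the set \<open>{n. a \<in> x\<^sub>n}\<close> belongs to \<open>M\<close>, so \<open>U\<close> is almost contained in it or
  almost disjoint from it; hence the \<open>a\<close> for which almost all \<open>n \<in> U\<close> satisfy \<open>a \<in> x\<^sub>n\<close> form an
  ultrafilter \<open>l\<close>, and \<open>x\<^sub>n\<close> converges to \<open>l\<close> along \<open>U\<close>.

  Everything needed from \<open>M[G]\<close> is definable over the structure \<open>(M, \<epsilon>, G)\<close>, whose quantifiers
  range over the ground model.  For this structure the forcing theorem is a direct induction on
  formulas; the only recursion on names is the one that decides \<open>val G \<sigma> = x\<close> for \<open>x \<in> M\<close>, and it
  can be carried out on \<open>x\<close>.
\<close>

section \<open>Set operations\<close>

text \<open>The extension is never shown to satisfy ZFC, and no forcing theorem for formulas about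
  values of names is proved. Every set claimed to lie in it is given by an explicit name, built from
  a definable forcing predicate inside \<open>M\<close> (\<open>family_in_N\<close>), and this
  decides what has to be named. The points \<open>x (num n)\<close> come from \<open>M\<close>,
  where choice yields infinitely many ultrafilters; they stay ultrafilters because that notion does
  not depend on the model. The limit \<open>l\<close> is a subset of \<open>univ A\<close> definable
  from \<open>U\<close>. The subsequence enumerates \<open>U\<close>, so its graph needs a name as
  well, and one index is dropped in case some term equals \<open>l\<close>. Finally,
  \<open>nontrivial_sequence\<close> speaks of all limits, while convergence is tested only with
  open sets belonging to the extension. Uniqueness of limits thus depends on the basic sets being
  elements of it. A basic set collects ultrafilters whose names need not form a set of
  \<open>M\<close>; nice names, subsets of \<open>univ A\<close> times \<open>P\<close>, cut them
  down to a set.\<close>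

lemma mem_iff: "x \<epsilon> y \<longleftrightarrow> x \<in> elts y"
  by (simp add: elts_def)

text \<open>Second-order replacement makes these operations total for arbitrary \<open>Q\<close> and
  \<open>f\<close>. Whether a result lies in the model is a separate matter and depends on
  definability (\<open>dfnt_sepS\<close>, \<open>dfnt_replS\<close>,
  \<open>dfnt_UnS\<close>).\<close>

definition sepS :: "'v::set_universe \<Rightarrow> ('v \<Rightarrow> bool) \<Rightarrow> 'v" where
  "sepS X Q = set_of {z \<in> elts X. Q z}"

definition replS :: "'v::set_universe \<Rightarrow> ('v \<Rightarrow> 'v) \<Rightarrow> 'v" where
  "replS X f = set_of (f ` elts X)"

definition UnS :: "'v::set_universe \<Rightarrow> 'v" where
  "UnS X = set_of (\<Union> (elts ` elts X))"

lemma elts_sepS [simp]: "elts (sepS X Q) = {z \<in> elts X. Q z}"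
  using elts_set_of_image[where f = "\<lambda>z. z" and x = X and P = Q]
  by (simp add: sepS_def mem_iff)

lemma elts_replS [simp]: "elts (replS X f) = f ` elts X"
proof -
  have "{f w | w. w \<epsilon> X \<and> True} = f ` elts X" by (auto simp: mem_iff)
  then show ?thesis
    using elts_set_of_image[where f = f and x = X and P = "\<lambda>_. True"] by (simp add: replS_def)
qed

lemma elts_UnS [simp]: "elts (UnS X) = \<Union> (elts ` elts X)"
proof -
  obtain y where "\<forall>z. z \<epsilon> y \<longleftrightarrow> (\<exists>w. w \<epsilon> X \<and> z \<epsilon> w)" using union by blast
  then have "elts y = \<Union> (elts ` elts X)" by (auto simp: mem_iff)
  then show ?thesis unfolding UnS_def by (rule elts_set_of)
qed

lemma set_of_elts [simp]: "set_of (elts x) = x"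
  by (rule elts_inject) (rule elts_set_of[OF refl])

lemma mem_induct [case_names step]:
  fixes x :: "'v::set_universe"
  assumes "\<And>x. (\<And>y. y \<in> elts x \<Longrightarrow> Q y) \<Longrightarrow> Q x"
  shows "Q x"
  using set_universe_class.foundation
proof (induction x rule: wf_induct_rule)
  case (less x)
  show ?case by (rule assms) (simp add: less mem_iff)
qed

lemma mem_irrefl: "x \<notin> elts (x :: 'v::set_universe)"
  by (induction x rule: mem_induct) blast

text \<open>\<open>H\<close> sees only the set of the earlier values, not the function that produces
  them. This keeps \<open>H\<close> a binary operation on sets, so that its definability is a
  statement about two indices.\<close>

definition recS :: "('v::set_universe \<Rightarrow> 'v \<Rightarrow> 'v) \<Rightarrow> 'v \<Rightarrow> 'v" where
  "recS H = wfrec {(x, y). x \<epsilon> y} (\<lambda>F x. H x (replS x F))"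

lemma recS_unfold: "recS H x = H x (replS x (recS H))"
proof -
  let ?R = "{(x, y :: 'a). x \<epsilon> y}"
  have "recS H x = H x (replS x (cut (recS H) ?R x))"
    by (rule def_wfrec[OF recS_def[THEN eq_reflection] set_universe_class.foundation])
  also have "replS x (cut (recS H) ?R x) = replS x (recS H)"
    by (rule elts_inject) (auto simp: cut_def mem_iff image_def)
  finally show ?thesis .
qed

declare num.simps [simp del]

lemma elts_num: "elts (num n :: 'v::set_universe) = num ` {..<n}"
  by (induction n) (auto simp: lessThan_Suc)

lemma inj_num: "inj (num :: nat \<Rightarrow> 'v::set_universe)"
proof (rule linorder_injI)
  fix m n :: nat assume "m < n"
  then have "(num m :: 'v) \<in> elts (num n)" by (auto simp: elts_num)
  then show "(num m :: 'v) \<noteq> num n" using mem_irrefl by metis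
qed

lemma num_eq_iff [simp]: "num m = (num n :: 'v::set_universe) \<longleftrightarrow> m = n"
  using inj_num by (auto dest: injD)

lemma num_mem_iff [simp]: "num m \<in> elts (num n :: 'v::set_universe) \<longleftrightarrow> m < n"
  by (auto simp: elts_num)


section \<open>Definability over a transitive model\<close>

text \<open>Bound variables are counted too: an upper bound for the free variables serves the choice
  of fresh ones.\<close>

primrec vars :: "fm \<Rightarrow> nat set" where
  "vars (Mem i j) = {i, j}"
| "vars (Eq i j) = {i, j}"
| "vars (Neg \<phi>) = vars \<phi>"
| "vars (Conj \<phi> \<psi>) = vars \<phi> \<union> vars \<psi>"
| "vars (All i \<phi>) = insert i (vars \<phi>)"

lemma finite_vars: "finite (vars \<phi>)"
  by (induction \<phi>) auto

lemma sat_cong: "(\<And>i. i \<in> vars \<phi> \<Longrightarrow> \<rho> i = \<rho>' i) \<Longrightarrow> sat M \<rho> \<phi> = sat M \<rho>' \<phi>"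
proof (induction \<phi> arbitrary: \<rho> \<rho>')
  case (Conj \<phi> \<psi>)
  then show ?case by (metis UnI1 UnI2 sat.simps(4) vars.simps(4))
next
  case (All i \<phi>)
  have "sat M (\<rho>(i := x)) \<phi> = sat M (\<rho>'(i := x)) \<phi>" for x
    by (rule All.IH) (use All.prems in auto)
  then show ?case by simp
next
  case (Neg \<phi>)
  then have "sat M \<rho> \<phi> = sat M \<rho>' \<phi>" by (metis vars.simps(3))
  then show ?case by simp
qed simp_all

text \<open>\<open>f\<close> may identify variables, since only capture is at stake: the bound
  variable is moved to an index \<open>k\<close> outside the image of \<open>vars \<phi>\<close>
  under \<open>f\<close>.\<close>

lemma sat_rename: "\<exists>\<phi>'. \<forall>\<rho>. sat M \<rho> \<phi>' \<longleftrightarrow> sat M (\<lambda>i. \<rho> (f i)) \<phi>"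
proof (induction \<phi> arbitrary: f)
  case (Mem i j)
  show ?case by (rule exI[of _ "Mem (f i) (f j)"]) simp
next
  case (Eq i j)
  show ?case by (rule exI[of _ "Eq (f i) (f j)"]) simp
next
  case (Neg \<phi>)
  then show ?case by (metis sat.simps(3))
next
  case (Conj \<phi> \<psi>)
  then show ?case by (metis sat.simps(4))
next
  case (All i \<phi>)
  obtain k where k: "k \<notin> f ` vars \<phi>"
    using ex_new_if_finite[OF infinite_UNIV_nat] finite_vars by blast
  obtain \<phi>' where \<phi>': "\<And>\<rho>. sat M \<rho> \<phi>' \<longleftrightarrow> sat M (\<lambda>j. \<rho> ((f(i := k)) j)) \<phi>"
    using All by blast
  have "sat M (\<rho>(k := x)) \<phi>' \<longleftrightarrow> sat M ((\<lambda>j. \<rho> (f j))(i := x)) \<phi>" for \<rho> x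
    unfolding \<phi>' by (rule sat_cong) (use k in auto)
  then show ?case by (intro exI[of _ "All k \<phi>'"]) simp
qed

text \<open>A variable of a formula is read either from the assignment or as a fixed parameter, so
  parameters occupy no index of the assignment and survive all shifts.\<close>

primrec atom_val :: "(nat \<Rightarrow> 'v) \<Rightarrow> nat + 'v \<Rightarrow> 'v" where
  "atom_val \<rho> (Inl n) = \<rho> n"
| "atom_val \<rho> (Inr c) = c"

locale transitive_model = ZFC_model M for M :: "'v::set_universe set" +
  assumes transitive: "transitive_class M"
begin

lemma M_trans: "x \<in> M \<Longrightarrow> y \<in> elts x \<Longrightarrow> y \<in> M"
  using transitive by (auto simp: transitive_class_def)

text \<open>
  Definability with parameters from \<open>M\<close>, for predicates \<open>dfn\<close> and functions \<open>dfnt\<close> of an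
  assignment of elements of \<open>M\<close> to de Bruijn indices.  The intended use is backward: a
  quantifier binds index 0 and shifts the rest of the assignment, so that
  definability of a concrete predicate is proved by following its syntax.
\<close>

definition env :: "(nat \<Rightarrow> 'v) \<Rightarrow> bool" where
  "env \<rho> \<longleftrightarrow> (\<forall>i. \<rho> i \<in> M)"

definition dfn :: "((nat \<Rightarrow> 'v) \<Rightarrow> bool) \<Rightarrow> bool" where
  "dfn Q \<longleftrightarrow> (\<exists>\<phi> t. (\<forall>i c. t i = Inr c \<longrightarrow> c \<in> M) \<and>
     (\<forall>\<rho>. env \<rho> \<longrightarrow> (sat M (\<lambda>i. atom_val \<rho> (t i)) \<phi> \<longleftrightarrow> Q \<rho>)))"

definition dfnt :: "((nat \<Rightarrow> 'v) \<Rightarrow> 'v) \<Rightarrow> bool" where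
  "dfnt f \<longleftrightarrow> (\<forall>\<rho>. env \<rho> \<longrightarrow> f \<rho> \<in> M) \<and> dfn (\<lambda>\<rho>. \<rho> 0 = f (\<lambda>i. \<rho> (Suc i)))"

lemma env_case_nat: "x \<in> M \<Longrightarrow> env \<rho> \<Longrightarrow> env (case_nat x \<rho>)"
  by (auto simp: env_def split: nat.split)

lemma env_Suc: "env \<rho> \<Longrightarrow> env (\<lambda>i. \<rho> (Suc i))"
  by (simp add: env_def)

lemma env_in_M: "env \<rho> \<Longrightarrow> \<rho> i \<in> M"
  by (simp add: env_def)

lemma dfn_cong: "(\<And>\<rho>. env \<rho> \<Longrightarrow> Q \<rho> \<longleftrightarrow> Q' \<rho>) \<Longrightarrow> dfn Q \<Longrightarrow> dfn Q'"
  unfolding dfn_def by metis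

lemma dfn_subst_atoms:
  assumes "dfn Q" and s: "\<And>i c. s i = Inr c \<Longrightarrow> c \<in> M"
  shows "dfn (\<lambda>\<rho>. Q (\<lambda>i. atom_val \<rho> (s i)))"
proof -
  obtain \<phi> t where t: "\<And>i c. t i = Inr c \<Longrightarrow> c \<in> M"
    and \<phi>: "\<And>\<rho>. env \<rho> \<Longrightarrow> sat M (\<lambda>i. atom_val \<rho> (t i)) \<phi> \<longleftrightarrow> Q \<rho>"
    using assms(1) unfolding dfn_def by blast
  define t' where "t' i = (case t i of Inl n \<Rightarrow> s n | Inr c \<Rightarrow> Inr c)" for i
  have "sat M (\<lambda>i. atom_val \<rho> (t' i)) \<phi> \<longleftrightarrow> Q (\<lambda>i. atom_val \<rho> (s i))" if "env \<rho>" for \<rho>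
  proof -
    let ?\<sigma> = "\<lambda>i. atom_val \<rho> (s i)"
    have "env ?\<sigma>" unfolding env_def
    proof
      fix i show "?\<sigma> i \<in> M"
        using s[of i] that by (cases "s i") (auto simp: env_def)
    qed
    moreover have "(\<lambda>i. atom_val \<rho> (t' i)) = (\<lambda>i. atom_val ?\<sigma> (t i))"
      by (auto simp: t'_def split: sum.split)
    ultimately show ?thesis using \<phi> by simp
  qed
  moreover have "c \<in> M" if "t' i = Inr c" for i c
    using that t[of i] s by (cases "t i") (auto simp: t'_def)
  ultimately show ?thesis unfolding dfn_def by blast
qed

lemma dfn_rename: "dfn Q \<Longrightarrow> dfn (\<lambda>\<rho>. Q (\<lambda>i. \<rho> (f i)))"
  using dfn_subst_atoms[of Q "\<lambda>i. Inl (f i)"] by simp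

lemma dfn_weaken: "dfn Q \<Longrightarrow> dfn (\<lambda>\<rho>. Q (\<lambda>i. \<rho> (Suc i)))"
  by (rule dfn_rename)

lemma dfn_neg: "dfn Q \<Longrightarrow> dfn (\<lambda>\<rho>. \<not> Q \<rho>)"
  unfolding dfn_def by (metis sat.simps(3))

lemma dfn_conj:
  assumes "dfn Q" "dfn R"
  shows "dfn (\<lambda>\<rho>. Q \<rho> \<and> R \<rho>)"
proof -
  obtain \<phi> t where t: "\<And>i c. t i = Inr c \<Longrightarrow> c \<in> M"
    and \<phi>: "\<And>\<rho>. env \<rho> \<Longrightarrow> sat M (\<lambda>i. atom_val \<rho> (t i)) \<phi> \<longleftrightarrow> Q \<rho>"
    using assms(1) unfolding dfn_def by blast
  obtain \<psi> u where u: "\<And>i c. u i = Inr c \<Longrightarrow> c \<in> M"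
    and \<psi>: "\<And>\<rho>. env \<rho> \<Longrightarrow> sat M (\<lambda>i. atom_val \<rho> (u i)) \<psi> \<longleftrightarrow> R \<rho>"
    using assms(2) unfolding dfn_def by blast
  obtain \<phi>' where \<phi>': "\<And>\<rho>. sat M \<rho> \<phi>' \<longleftrightarrow> sat M (\<lambda>i. \<rho> (2 * i)) \<phi>"
    using sat_rename[of M "\<lambda>i. 2 * i"] by blast
  obtain \<psi>' where \<psi>': "\<And>\<rho>. sat M \<rho> \<psi>' \<longleftrightarrow> sat M (\<lambda>i. \<rho> (Suc (2 * i))) \<psi>"
    using sat_rename[of M "\<lambda>i. Suc (2 * i)"] by blast
  \<comment> \<open>Each formula comes with its own reading of variables; sending one to the even
    and the other to the odd variables lets a single reading serve both.\<close>
  define v where "v i = (if even i then t (i div 2) else u (i div 2))" for i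
  have [simp]: "v (2 * i) = t i" "v (Suc (2 * i)) = u i" for i
    by (auto simp: v_def)
  have "sat M (\<lambda>i. atom_val \<rho> (v i)) (Conj \<phi>' \<psi>') \<longleftrightarrow> Q \<rho> \<and> R \<rho>" if "env \<rho>" for \<rho>
    using \<phi>[OF that] \<psi>[OF that] by (simp add: \<phi>' \<psi>')
  moreover have "c \<in> M" if "v i = Inr c" for i c
    using that t u by (auto simp: v_def split: if_splits)
  ultimately show ?thesis unfolding dfn_def by blast
qed

lemma dfn_allM:
  assumes "dfn (\<lambda>\<rho>. Q (\<rho> 0) (\<lambda>i. \<rho> (Suc i)))"
  shows "dfn (\<lambda>\<rho>. \<forall>x\<in>M. Q x \<rho>)"
proof -
  obtain \<phi> t where t: "\<And>i c. t i = Inr c \<Longrightarrow> c \<in> M"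
    and \<phi>: "\<And>\<rho>. env \<rho> \<Longrightarrow> sat M (\<lambda>i. atom_val \<rho> (t i)) \<phi> \<longleftrightarrow> Q (\<rho> 0) (\<lambda>i. \<rho> (Suc i))"
    using assms unfolding dfn_def by blast
  \<comment> \<open>Several variables may be read as index 0; all of them are merged into variable
    0, which is then bound, and the others move up by one to avoid capture. The value of
    \<open>u\<close> at 0 is a dummy, overwritten by the quantifier.\<close>
  let ?f = "\<lambda>i. if t i = Inl 0 then 0 else Suc i"
  obtain \<phi>' where \<phi>': "\<And>\<rho>. sat M \<rho> \<phi>' \<longleftrightarrow> sat M (\<lambda>i. \<rho> (?f i)) \<phi>"
    using sat_rename[of M ?f] by blast
  define u where
    "u = case_nat (Inl 0) (\<lambda>i. case t i of Inl n \<Rightarrow> Inl (n - 1) | Inr c \<Rightarrow> Inr c)"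
  have "sat M ((\<lambda>i. atom_val \<rho> (u i))(0 := x)) \<phi>' \<longleftrightarrow> Q x \<rho>" if "env \<rho>" "x \<in> M" for \<rho> x
  proof -
    have "((\<lambda>i. atom_val \<rho> (u i))(0 := x)) (?f i) = atom_val (case_nat x \<rho>) (t i)" for i
      by (cases "t i") (auto simp: u_def split: nat.split)
    then have "sat M ((\<lambda>i. atom_val \<rho> (u i))(0 := x)) \<phi>' \<longleftrightarrow>
        sat M (\<lambda>i. atom_val (case_nat x \<rho>) (t i)) \<phi>"
      unfolding \<phi>' by presburger
    then show ?thesis using \<phi>[OF env_case_nat[OF that(2,1)]] by simp
  qed
  then have "sat M (\<lambda>i. atom_val \<rho> (u i)) (All 0 \<phi>') \<longleftrightarrow> (\<forall>x\<in>M. Q x \<rho>)" if "env \<rho>" for \<rho>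
    using that by simp
  moreover have "c \<in> M" if "u i = Inr c" for i c
    using that t by (auto simp: u_def split: nat.splits sum.splits)
  ultimately show ?thesis unfolding dfn_def by blast
qed

lemma dfn_disj: "dfn Q \<Longrightarrow> dfn R \<Longrightarrow> dfn (\<lambda>\<rho>. Q \<rho> \<or> R \<rho>)"
  using dfn_neg[OF dfn_conj[OF dfn_neg dfn_neg], of Q R] by simp

lemma dfn_imp: "dfn Q \<Longrightarrow> dfn R \<Longrightarrow> dfn (\<lambda>\<rho>. Q \<rho> \<longrightarrow> R \<rho>)"
  unfolding imp_conv_disj by (intro dfn_disj dfn_neg)

lemma dfn_iff: "dfn Q \<Longrightarrow> dfn R \<Longrightarrow> dfn (\<lambda>\<rho>. Q \<rho> \<longleftrightarrow> R \<rho>)"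
  unfolding iff_conv_conj_imp by (intro dfn_conj dfn_imp)

lemma dfn_exM:
  assumes "dfn (\<lambda>\<rho>. Q (\<rho> 0) (\<lambda>i. \<rho> (Suc i)))"
  shows "dfn (\<lambda>\<rho>. \<exists>x\<in>M. Q x \<rho>)"
  using dfn_neg[OF dfn_allM[OF dfn_neg[OF assms]]] by simp

lemma dfn_eq_atoms:
  assumes "\<And>c. a = Inr c \<Longrightarrow> c \<in> M" "\<And>c. b = Inr c \<Longrightarrow> c \<in> M"
  shows "dfn (\<lambda>\<rho>. atom_val \<rho> a = atom_val \<rho> b)"
  unfolding dfn_def
  by (rule exI[of _ "Eq 0 1"], rule exI[of _ "\<lambda>i. if i = 0 then a else b"]) (use assms in auto)

lemma dfn_mem_vars: "dfn (\<lambda>\<rho>. \<rho> m \<in> elts (\<rho> n))"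
  unfolding dfn_def
  by (rule exI[of _ "Mem 0 1"], rule exI[of _ "\<lambda>i. if i = 0 then Inl m else Inl n"])
    (auto simp: mem_iff)

lemma dfnt_var: "dfnt (\<lambda>\<rho>. \<rho> n)"
  unfolding dfnt_def using dfn_eq_atoms[of "Inl 0" "Inl (Suc n)"] by (auto simp: env_def)

lemma dfnt_const: "c \<in> M \<Longrightarrow> dfnt (\<lambda>\<rho>. c)"
  unfolding dfnt_def using dfn_eq_atoms[of "Inl 0" "Inr c"] by auto

lemma dfnt_in_M: "dfnt f \<Longrightarrow> env \<rho> \<Longrightarrow> f \<rho> \<in> M"
  by (simp add: dfnt_def)

lemma dfnt_const_in_M: "dfnt (\<lambda>\<rho>. c) \<Longrightarrow> c \<in> M"
  using dfnt_in_M[of "\<lambda>\<rho>. c"] nonempty by (fastforce simp: env_def)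

lemma dfnt_weaken: "dfnt f \<Longrightarrow> dfnt (\<lambda>\<rho>. f (\<lambda>i. \<rho> (Suc i)))"
  unfolding dfnt_def
proof (intro conjI allI impI; elim conjE)
  fix \<rho> assume "\<forall>\<rho>. env \<rho> \<longrightarrow> f \<rho> \<in> M" "env \<rho>"
  then show "f (\<lambda>i. \<rho> (Suc i)) \<in> M" using env_Suc by blast
next
  assume "dfn (\<lambda>\<rho>. \<rho> 0 = f (\<lambda>i. \<rho> (Suc i)))"
  from dfn_rename[OF this, of "case_nat 0 (\<lambda>i. Suc (Suc i))"]
  show "dfn (\<lambda>\<rho>. \<rho> 0 = f (\<lambda>i. \<rho> (Suc (Suc i))))" by simp
qed

text \<open>The language has no function terms, so a substituted function is expressed by
  quantifying over its value, which lies in \<open>M\<close>.\<close>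

lemma dfn_subst:
  assumes "dfn (\<lambda>\<rho>. R (\<rho> 0) (\<lambda>i. \<rho> (Suc i)))" "dfnt f"
  shows "dfn (\<lambda>\<rho>. R (f \<rho>) \<rho>)"
proof (rule dfn_cong)
  show "dfn (\<lambda>\<rho>. \<exists>x\<in>M. x = f \<rho> \<and> R x \<rho>)"
    by (rule dfn_exM, rule dfn_conj) (use assms in \<open>auto simp: dfnt_def\<close>)
qed (use assms(2) in \<open>auto simp: dfnt_def\<close>)

lemma dfn_comp2:
  assumes "dfn (\<lambda>\<rho>. R (\<rho> 0) (\<rho> (Suc 0)))" "dfnt f" "dfnt g"
  shows "dfn (\<lambda>\<rho>. R (f \<rho>) (g \<rho>))"
proof (rule dfn_subst[OF _ assms(2), of "\<lambda>x \<rho>. R x (g \<rho>)"])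
  show "dfn (\<lambda>\<rho>. R (\<rho> 0) (g (\<lambda>i. \<rho> (Suc i))))"
  proof (rule dfn_subst[OF _ dfnt_weaken[OF assms(3)], of "\<lambda>x \<rho>. R (\<rho> 0) x"])
    show "dfn (\<lambda>\<rho>. R (\<rho> (Suc 0)) (\<rho> 0))"
      using dfn_rename[OF assms(1), of "case_nat (Suc 0) (\<lambda>_. 0)"] by simp
  qed
qed

lemma dfn_comp3:
  assumes "dfn (\<lambda>\<rho>. R (\<rho> 0) (\<rho> (Suc 0)) (\<rho> (Suc (Suc 0))))" "dfnt f" "dfnt g" "dfnt h"
  shows "dfn (\<lambda>\<rho>. R (f \<rho>) (g \<rho>) (h \<rho>))"
proof (rule dfn_subst[OF _ assms(2), of "\<lambda>x \<rho>. R x (g \<rho>) (h \<rho>)"])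
  show "dfn (\<lambda>\<rho>. R (\<rho> 0) (g (\<lambda>i. \<rho> (Suc i))) (h (\<lambda>i. \<rho> (Suc i))))"
  proof (rule dfn_subst[OF _ dfnt_weaken[OF assms(3)],
        of "\<lambda>x \<rho>. R (\<rho> 0) x (h (\<lambda>i. \<rho> (Suc i)))"])
    show "dfn (\<lambda>\<rho>. R (\<rho> (Suc 0)) (\<rho> 0) (h (\<lambda>i. \<rho> (Suc (Suc i)))))"
    proof (rule dfn_subst[OF _ dfnt_weaken[OF dfnt_weaken[OF assms(4)]],
          of "\<lambda>x \<rho>. R (\<rho> (Suc 0)) (\<rho> 0) x"])
      show "dfn (\<lambda>\<rho>. R (\<rho> (Suc (Suc 0))) (\<rho> (Suc 0)) (\<rho> 0))"
        using dfn_rename[OF assms(1),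
            of "case_nat (Suc (Suc 0)) (case_nat (Suc 0) (\<lambda>_. 0))"] by simp
    qed
  qed
qed

lemma dfnt_comp1:
  assumes "dfnt (\<lambda>\<rho>. F (\<rho> 0))" "dfnt f"
  shows "dfnt (\<lambda>\<rho>. F (f \<rho>))"
proof -
  have "F x \<in> M" if "x \<in> M" for x
    using dfnt_in_M[OF assms(1), of "\<lambda>_. x"] that by (simp add: env_def)
  moreover have "dfn (\<lambda>\<rho>. \<rho> 0 = F (f (\<lambda>i. \<rho> (Suc i))))"
    by (rule dfn_comp2[of "\<lambda>y x. y = F x", OF _ dfnt_var dfnt_weaken[OF assms(2)]])
      (use assms(1) in \<open>simp add: dfnt_def\<close>)
  ultimately show ?thesis using assms(2) by (simp add: dfnt_def)
qed

lemma dfnt_comp2: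
  assumes "dfnt (\<lambda>\<rho>. F (\<rho> 0) (\<rho> (Suc 0)))" "dfnt f" "dfnt g"
  shows "dfnt (\<lambda>\<rho>. F (f \<rho>) (g \<rho>))"
proof -
  have "F x y \<in> M" if "x \<in> M" "y \<in> M" for x y
    using dfnt_in_M[OF assms(1), of "case_nat x (\<lambda>_. y)"] that
    by (simp add: env_def split: nat.split)
  moreover have "dfn (\<lambda>\<rho>. \<rho> 0 = F (f (\<lambda>i. \<rho> (Suc i))) (g (\<lambda>i. \<rho> (Suc i))))"
    by (rule dfn_comp3[of "\<lambda>y x z. y = F x z",
          OF _ dfnt_var dfnt_weaken[OF assms(2)] dfnt_weaken[OF assms(3)]])
      (use assms(1) in \<open>simp add: dfnt_def\<close>)
  ultimately show ?thesis using assms(2,3) by (simp add: dfnt_def)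
qed

lemma dfn_eq: "dfnt f \<Longrightarrow> dfnt g \<Longrightarrow> dfn (\<lambda>\<rho>. f \<rho> = g \<rho>)"
  using dfn_comp2[of "\<lambda>x y. x = y"] dfn_eq_atoms[of "Inl 0" "Inl (Suc 0)"] by simp

lemma dfn_mem: "dfnt f \<Longrightarrow> dfnt g \<Longrightarrow> dfn (\<lambda>\<rho>. f \<rho> \<in> elts (g \<rho>))"
  using dfn_comp2[of "\<lambda>x y. x \<in> elts y", OF dfn_mem_vars] by simp

lemma dfn_ball:
  assumes "dfnt X" "dfn (\<lambda>\<rho>. Q (\<rho> 0) (\<lambda>i. \<rho> (Suc i)))"
  shows "dfn (\<lambda>\<rho>. \<forall>x\<in>elts (X \<rho>). Q x \<rho>)"
proof (rule dfn_cong)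
  show "dfn (\<lambda>\<rho>. \<forall>x\<in>M. x \<in> elts (X \<rho>) \<longrightarrow> Q x \<rho>)"
    by (intro dfn_allM dfn_imp dfn_mem dfnt_var dfnt_weaken assms)
qed (use assms(1) M_trans in \<open>auto simp: dfnt_def\<close>)

lemma dfn_bex:
  assumes "dfnt X" "dfn (\<lambda>\<rho>. Q (\<rho> 0) (\<lambda>i. \<rho> (Suc i)))"
  shows "dfn (\<lambda>\<rho>. \<exists>x\<in>elts (X \<rho>). Q x \<rho>)"
  using dfn_neg[OF dfn_ball[OF assms(1) dfn_neg[OF assms(2)]]] by simp

lemma dfn_subset: "dfnt f \<Longrightarrow> dfnt g \<Longrightarrow> dfn (\<lambda>\<rho>. elts (f \<rho>) \<subseteq> elts (g \<rho>))"
  unfolding subset_eq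
  by (intro dfn_ball dfn_mem dfnt_var dfnt_weaken)

text \<open>Equality is reduced to extensionality; since both sides lie in the transitive
  \<open>M\<close>, quantifying over \<open>z\<close> in \<open>M\<close> reaches all of their
  elements.\<close>

lemma dfnt_by_elts:
  assumes M: "\<And>\<rho>. env \<rho> \<Longrightarrow> t \<rho> \<in> M"
    and *: "dfn (\<lambda>\<rho>. \<rho> 0 \<in> elts (t (\<lambda>i. \<rho> (Suc i))))"
  shows "dfnt t"
  unfolding dfnt_def
proof (intro conjI allI impI M)
  show "dfn (\<lambda>\<rho>. \<rho> 0 = t (\<lambda>i. \<rho> (Suc i)))"
  proof (rule dfn_cong)
    show "dfn (\<lambda>\<rho>. \<forall>z\<in>M. z \<in> elts (\<rho> 0) \<longleftrightarrow> z \<in> elts (t (\<lambda>i. \<rho> (Suc i))))"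
    proof (rule dfn_allM, rule dfn_iff)
      show "dfn (\<lambda>\<rho>. \<rho> 0 \<in> elts (\<rho> (Suc 0)))" by (intro dfn_mem dfnt_var)
      show "dfn (\<lambda>\<rho>. \<rho> 0 \<in> elts (t (\<lambda>i. \<rho> (Suc (Suc i)))))"
        using dfn_rename[OF *, of "case_nat 0 (\<lambda>i. Suc (Suc i))"] by simp
    qed
  next
    fix \<rho> assume "env \<rho>"
    then have "\<rho> 0 \<in> M" "t (\<lambda>i. \<rho> (Suc i)) \<in> M" using M env_Suc by (auto simp: env_def)
    then show "(\<forall>z\<in>M. z \<in> elts (\<rho> 0) \<longleftrightarrow> z \<in> elts (t (\<lambda>i. \<rho> (Suc i)))) \<longleftrightarrow>
        \<rho> 0 = t (\<lambda>i. \<rho> (Suc i))"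
      using M_trans by (metis elts_inject subsetI subset_antisym)
  qed
qed

section \<open>Separation, replacement and set operations inside the model\<close>

lemma sat_of_dfn:
  assumes "dfn (\<lambda>\<rho>. R (\<rho> 0) (\<rho> (Suc 0)) (\<lambda>i. \<rho> (Suc (Suc i))))" "env \<rho>"
  obtains \<phi> \<pi> where "range \<pi> \<subseteq> M"
    "\<And>x y. x \<in> M \<Longrightarrow> y \<in> M \<Longrightarrow> sat M (\<pi>(0 := x, 1 := y)) \<phi> \<longleftrightarrow> R x y \<rho>"
proof -
  obtain \<phi> t where t: "\<And>i c. t i = Inr c \<Longrightarrow> c \<in> M"
    and \<phi>: "\<And>\<rho>. env \<rho> \<Longrightarrow> sat M (\<lambda>i. atom_val \<rho> (t i)) \<phi> \<longleftrightarrow>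
        R (\<rho> 0) (\<rho> (Suc 0)) (\<lambda>i. \<rho> (Suc (Suc i)))"
    using assms(1) unfolding dfn_def by blast
  \<comment> \<open>The schemes reserve variables 0 and 1 for the arguments. Every other variable
    moves up by two and is read from \<open>\<pi>\<close>, where \<open>i - 2\<close> recovers the
    original variable and \<open>n - 2\<close> skips the two arguments among the de Bruijn
    indices.\<close>
  let ?f = "\<lambda>i. if t i = Inl 0 then 0 else if t i = Inl 1 then 1 else Suc (Suc i)"
  obtain \<phi>' where \<phi>': "\<And>\<rho>. sat M \<rho> \<phi>' \<longleftrightarrow> sat M (\<lambda>i. \<rho> (?f i)) \<phi>"
    using sat_rename[of M ?f] by blast
  define \<pi> where "\<pi> i = (case t (i - 2) of Inl n \<Rightarrow> \<rho> (n - 2) | Inr c \<Rightarrow> c)" for i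
  have "range \<pi> \<subseteq> M"
    using t assms(2) by (auto simp: \<pi>_def env_def split: sum.split)
  moreover have "sat M (\<pi>(0 := x, 1 := y)) \<phi>' \<longleftrightarrow> R x y \<rho>" if "x \<in> M" "y \<in> M" for x y
  proof -
    have "(\<pi>(0 := x, 1 := y)) (?f i) = atom_val (case_nat x (case_nat y \<rho>)) (t i)" for i
      by (cases "t i") (auto simp: \<pi>_def numeral_2_eq_2 split: nat.split)
    then have "sat M (\<pi>(0 := x, 1 := y)) \<phi>' \<longleftrightarrow>
        sat M (\<lambda>i. atom_val (case_nat x (case_nat y \<rho>)) (t i)) \<phi>"
      unfolding \<phi>' by presburger
    then show ?thesis
      using \<phi>[OF env_case_nat[OF that(1) env_case_nat[OF that(2) assms(2)]]] by simp
  qed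
  ultimately show thesis by (rule that)
qed

lemma sepS_in_M_env:
  assumes "dfn (\<lambda>\<rho>. Q (\<rho> 0) (\<lambda>i. \<rho> (Suc i)))" "env \<rho>" "X \<in> M"
  shows "sepS X (\<lambda>x. Q x \<rho>) \<in> M"
proof -
  have "dfn (\<lambda>\<rho>. Q (\<rho> 0) (\<lambda>i. \<rho> (Suc (Suc i))))"
    using dfn_rename[OF assms(1), of "case_nat 0 (\<lambda>i. Suc (Suc i))"] by simp
  then obtain \<phi> \<pi> where \<pi>: "range \<pi> \<subseteq> M" and
    \<phi>: "\<And>x y. x \<in> M \<Longrightarrow> y \<in> M \<Longrightarrow> sat M (\<pi>(0 := x, 1 := y)) \<phi> \<longleftrightarrow> Q x \<rho>"
    by (rule sat_of_dfn[of "\<lambda>x y. Q x"]) (use assms(2) in auto)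
  have "sat M (\<pi>(0 := x)) \<phi> \<longleftrightarrow> Q x \<rho>" if "x \<in> M" for x
  proof -
    have "\<pi>(0 := x) = \<pi>(0 := x, 1 := \<pi> 1)" by auto
    then show ?thesis using \<phi>[OF that, of "\<pi> 1"] \<pi> by auto
  qed
  moreover obtain b where "b \<in> M" "\<forall>z\<in>M. z \<epsilon> b \<longleftrightarrow> z \<epsilon> X \<and> sat M (\<pi>(0 := z)) \<phi>"
    using separation \<pi> assms(3) by blast
  ultimately have "elts b = elts (sepS X (\<lambda>x. Q x \<rho>))"
    using M_trans[OF \<open>b \<in> M\<close>] M_trans[OF assms(3)] by (auto simp: mem_iff)
  then show ?thesis using \<open>b \<in> M\<close> elts_inject by blast
qed

text \<open>Only the graph of \<open>F\<close> on \<open>X\<close> has to be definable. This admits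
  functions obtained by an external choice of uniquely determined values, such as \<open>L\<close>
  in \<open>approx_exists\<close>.\<close>

lemma replacement_M:
  assumes "dfn (\<lambda>\<rho>. R (\<rho> 0) (\<rho> (Suc 0)) (\<lambda>i. \<rho> (Suc (Suc i))))" "env \<rho>" "X \<in> M"
    and F: "\<And>x. x \<in> elts X \<Longrightarrow> F x \<in> M"
      "\<And>x y. x \<in> elts X \<Longrightarrow> y \<in> M \<Longrightarrow> R x y \<rho> \<longleftrightarrow> y = F x"
  shows "replS X F \<in> M"
proof -
  obtain \<phi> \<pi> where \<pi>: "range \<pi> \<subseteq> M" and
    \<phi>: "\<And>x y. x \<in> M \<Longrightarrow> y \<in> M \<Longrightarrow> sat M (\<pi>(0 := x, 1 := y)) \<phi> \<longleftrightarrow> R x y \<rho>"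
    by (rule sat_of_dfn[OF assms(1,2)]) blast
  have X: "x \<in> M" if "x \<in> elts X" for x using M_trans[OF assms(3)] that .
  have "\<forall>x\<in>M. x \<epsilon> X \<longrightarrow> (\<exists>!y. y \<in> M \<and> sat M (\<pi>(0 := x, 1 := y)) \<phi>)"
    by (intro ballI impI, rule_tac a = "F x" in ex1I) (use \<phi> F in \<open>auto simp: mem_iff\<close>)
  then obtain b where b: "b \<in> M"
    "\<forall>y\<in>M. y \<epsilon> b \<longleftrightarrow> (\<exists>x\<in>M. x \<epsilon> X \<and> sat M (\<pi>(0 := x, 1 := y)) \<phi>)"
    using replacement[THEN spec, THEN spec, THEN mp, OF \<pi>, THEN bspec, OF assms(3), THEN mp]
    by blast
  then have "y \<in> elts b \<longleftrightarrow> (\<exists>x\<in>elts X. R x y \<rho>)" if "y \<in> M" for y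
    using \<phi> that X by (auto simp: mem_iff)
  then have "elts b = elts (replS X F)"
    using M_trans[OF b(1)] F by (fastforce simp: image_iff)
  then show ?thesis using b(1) elts_inject by blast
qed

lemma dfnt_sepS:
  assumes "dfnt X" "dfn (\<lambda>\<rho>. Q (\<rho> 0) (\<lambda>i. \<rho> (Suc i)))"
  shows "dfnt (\<lambda>\<rho>. sepS (X \<rho>) (\<lambda>x. Q x \<rho>))"
proof (rule dfnt_by_elts)
  show "sepS (X \<rho>) (\<lambda>x. Q x \<rho>) \<in> M" if "env \<rho>" for \<rho>
    using sepS_in_M_env[OF assms(2) that dfnt_in_M[OF assms(1) that]] .
  show "dfn (\<lambda>\<rho>. \<rho> 0 \<in> elts (sepS (X (\<lambda>i. \<rho> (Suc i))) (\<lambda>x. Q x (\<lambda>i. \<rho> (Suc i)))))"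
    unfolding elts_sepS mem_Collect_eq
    by (intro dfn_conj dfn_mem dfnt_var dfnt_weaken assms)
qed

lemma dfnt_replS:
  assumes "dfnt X" "dfnt (\<lambda>\<rho>. f (\<rho> 0) (\<lambda>i. \<rho> (Suc i)))"
  shows "dfnt (\<lambda>\<rho>. replS (X \<rho>) (\<lambda>x. f x \<rho>))"
proof (rule dfnt_by_elts)
  show "replS (X \<rho>) (\<lambda>x. f x \<rho>) \<in> M" if "env \<rho>" for \<rho>
  proof (rule replacement_M[of "\<lambda>x y \<rho>. y = f x \<rho>", OF _ that dfnt_in_M[OF assms(1) that]])
    show "dfn (\<lambda>\<rho>. \<rho> (Suc 0) = f (\<rho> 0) (\<lambda>i. \<rho> (Suc (Suc i))))"
      using assms(2)
        dfn_rename[of "\<lambda>\<rho>. \<rho> 0 = f (\<rho> (Suc 0)) (\<lambda>i. \<rho> (Suc (Suc i)))"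
          "case_nat (Suc 0) (case_nat 0 (\<lambda>i. Suc (Suc i)))"]
      by (simp add: dfnt_def)
    show "f x \<rho> \<in> M" if "x \<in> elts (X \<rho>)" for x
      using dfnt_in_M[OF assms(2) env_case_nat[OF M_trans[OF dfnt_in_M[OF assms(1) \<open>env \<rho>\<close>] that]
        \<open>env \<rho>\<close>]] by simp
  qed auto
  show "dfn (\<lambda>\<rho>. \<rho> 0 \<in> elts (replS (X (\<lambda>i. \<rho> (Suc i))) (\<lambda>x. f x (\<lambda>i. \<rho> (Suc i)))))"
    unfolding elts_replS image_iff
  proof (intro dfn_bex dfn_eq dfnt_var dfnt_weaken assms)
    show "dfnt (\<lambda>\<rho>. f (\<rho> 0) (\<lambda>i. \<rho> (Suc (Suc i))))"
    proof -
      have 1: "dfn (\<lambda>\<rho>. \<rho> 0 = f (\<rho> (Suc 0)) (\<lambda>i. \<rho> (Suc (Suc (Suc i)))))"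
        using assms(2)
          dfn_rename[of "\<lambda>\<rho>. \<rho> 0 = f (\<rho> (Suc 0)) (\<lambda>i. \<rho> (Suc (Suc i)))"
            "case_nat 0 (case_nat (Suc 0) (\<lambda>i. Suc (Suc (Suc i))))"]
        by (simp add: dfnt_def)
      have "f (\<rho> 0) (\<lambda>i. \<rho> (Suc (Suc i))) \<in> M" if "env \<rho>" for \<rho>
        using dfnt_in_M[OF assms(2), of "case_nat (\<rho> 0) (\<lambda>i. \<rho> (Suc (Suc i)))"] that
        by (simp add: env_def split: nat.split)
      then show ?thesis using 1 by (simp add: dfnt_def)
    qed
  qed
qed

lemma dfnt_UnS:
  assumes "dfnt X"
  shows "dfnt (\<lambda>\<rho>. UnS (X \<rho>))"
proof (rule dfnt_by_elts)
  fix \<rho> assume "env \<rho>"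
  then have X: "X \<rho> \<in> M" using assms dfnt_in_M by blast
  then obtain b where b: "b \<in> M" "\<forall>z\<in>M. z \<epsilon> b \<longleftrightarrow> (\<exists>w\<in>M. w \<epsilon> X \<rho> \<and> z \<epsilon> w)"
    using union by blast
  have "z \<in> elts b \<longleftrightarrow> (\<exists>w\<in>elts (X \<rho>). z \<in> elts w)" for z
    using b X M_trans unfolding mem_iff by meson
  then have "elts b = elts (UnS (X \<rho>))" by auto
  then show "UnS (X \<rho>) \<in> M" using b(1) elts_inject by blast
next
  show "dfn (\<lambda>\<rho>. \<rho> 0 \<in> elts (UnS (X (\<lambda>i. \<rho> (Suc i)))))"
    unfolding elts_UnS UN_iff by (intro dfn_bex dfn_mem dfnt_var dfnt_weaken assms)
qed

lemma dfnt_upair: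
  assumes "dfnt f" "dfnt g"
  shows "dfnt (\<lambda>\<rho>. set_of {f \<rho>, g \<rho>})"
proof (rule dfnt_by_elts)
  fix \<rho> assume "env \<rho>"
  then have fg: "f \<rho> \<in> M" "g \<rho> \<in> M" using assms dfnt_in_M by blast+
  then obtain b where b: "b \<in> M" "\<forall>w\<in>M. w \<epsilon> b \<longleftrightarrow> w = f \<rho> \<or> w = g \<rho>"
    using pairing by metis
  then have "elts b = elts (set_of {f \<rho>, g \<rho>})"
    using M_trans[OF b(1)] fg by (auto simp: mem_iff)
  then show "set_of {f \<rho>, g \<rho>} \<in> M" using b(1) elts_inject by blast
next
  show "dfn (\<lambda>\<rho>. \<rho> 0 \<in> elts (set_of {f (\<lambda>i. \<rho> (Suc i)), g (\<lambda>i. \<rho> (Suc i))}))"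
    unfolding elts_set_of_upair insert_iff empty_iff simp_thms
    by (intro dfn_disj dfn_eq dfnt_var dfnt_weaken assms)
qed

lemma dfnt_singleton: "dfnt f \<Longrightarrow> dfnt (\<lambda>\<rho>. set_of {f \<rho>})"
  using dfnt_upair[of f f] by simp

lemma dfnt_opair: "dfnt f \<Longrightarrow> dfnt g \<Longrightarrow> dfnt (\<lambda>\<rho>. opair (f \<rho>) (g \<rho>))"
  unfolding opair_def by (intro dfnt_upair dfnt_singleton)

lemma dfnt_if:
  assumes "dfn Q" "dfnt f" "dfnt g"
  shows "dfnt (\<lambda>\<rho>. if Q \<rho> then f \<rho> else g \<rho>)"
proof (rule dfnt_by_elts)
  show "(if Q \<rho> then f \<rho> else g \<rho>) \<in> M" if "env \<rho>" for \<rho>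
    using assms(2,3) that dfnt_in_M by simp
  show "dfn (\<lambda>\<rho>. \<rho> 0 \<in> elts (if Q (\<lambda>i. \<rho> (Suc i))
      then f (\<lambda>i. \<rho> (Suc i)) else g (\<lambda>i. \<rho> (Suc i))))"
    unfolding if_distrib[of elts] if_distrib[of "\<lambda>X. _ \<in> X"] if_bool_eq_conj
    by (intro dfn_conj dfn_imp dfn_neg dfn_mem dfnt_var dfnt_weaken dfn_weaken[OF assms(1)] assms)
qed

definition powM :: "'v \<Rightarrow> 'v" where
  "powM X = set_of {z \<in> M. elts z \<subseteq> elts X}"

lemma powM: "X \<in> M \<Longrightarrow> powM X \<in> M" "X \<in> M \<Longrightarrow> elts (powM X) = {z \<in> M. elts z \<subseteq> elts X}"
proof -
  assume X: "X \<in> M"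
  then obtain b where b: "b \<in> M" "\<forall>z\<in>M. z \<epsilon> b \<longleftrightarrow> (\<forall>w\<in>M. w \<epsilon> z \<longrightarrow> w \<epsilon> X)"
    using power_set by blast
  have "z \<in> elts b \<longleftrightarrow> z \<in> M \<and> elts z \<subseteq> elts X" for z
    using b M_trans unfolding mem_iff subset_iff by meson
  then have *: "elts b = {z \<in> M. elts z \<subseteq> elts X}" by auto
  then have "powM X = b" unfolding powM_def by (metis set_of_elts)
  then show "powM X \<in> M" "elts (powM X) = {z \<in> M. elts z \<subseteq> elts X}" using b(1) * by auto
qed

definition prodS :: "'v \<Rightarrow> 'v \<Rightarrow> 'v" where
  "prodS X Y = UnS (replS X (\<lambda>x. replS Y (\<lambda>y. opair x y)))"

lemma elts_prodS [simp]: "elts (prodS X Y) = {opair x y | x y. x \<in> elts X \<and> y \<in> elts Y}"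
  by (auto simp: prodS_def)

lemma dfnt_prodS: "dfnt X \<Longrightarrow> dfnt Y \<Longrightarrow> dfnt (\<lambda>\<rho>. prodS (X \<rho>) (Y \<rho>))"
  unfolding prodS_def by (intro dfnt_UnS dfnt_replS dfnt_opair dfnt_var dfnt_weaken)

lemmas dfn_intros = dfn_neg dfn_conj dfn_disj dfn_imp dfn_iff dfn_allM dfn_exM dfn_eq dfn_mem
  dfn_subset dfn_ball dfn_bex dfnt_sepS dfnt_replS dfnt_UnS dfnt_upair dfnt_singleton dfnt_opair
  dfnt_if dfnt_prodS dfnt_var

lemma sepS_in_M: "X \<in> M \<Longrightarrow> dfn (\<lambda>\<rho>. Q (\<rho> 0)) \<Longrightarrow> sepS X Q \<in> M"
  by (rule dfnt_const_in_M) (intro dfnt_sepS dfnt_const)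

lemma replS_in_M: "X \<in> M \<Longrightarrow> dfnt (\<lambda>\<rho>. f (\<rho> 0)) \<Longrightarrow> replS X f \<in> M"
  by (rule dfnt_const_in_M) (intro dfnt_replS dfnt_const)

lemma UnS_in_M: "X \<in> M \<Longrightarrow> UnS X \<in> M"
  by (rule dfnt_const_in_M) (intro dfnt_UnS dfnt_const)

lemma upair_in_M: "x \<in> M \<Longrightarrow> y \<in> M \<Longrightarrow> set_of {x, y} \<in> M"
  by (rule dfnt_const_in_M) (intro dfnt_upair dfnt_const)

lemma opair_in_M: "x \<in> M \<Longrightarrow> y \<in> M \<Longrightarrow> opair x y \<in> M"
  by (rule dfnt_const_in_M) (intro dfnt_opair dfnt_const)

lemma opair_in_M_iff [simp]: "opair x y \<in> M \<longleftrightarrow> x \<in> M \<and> y \<in> M"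
proof
  assume "opair x y \<in> M"
  then have "set_of {x, y} \<in> M" by (rule M_trans) (simp add: opair_def)
  then show "x \<in> M \<and> y \<in> M" using M_trans[of "set_of {x, y}"] by auto
qed (simp add: opair_in_M)

lemma prodS_in_M: "X \<in> M \<Longrightarrow> Y \<in> M \<Longrightarrow> prodS X Y \<in> M"
  by (rule dfnt_const_in_M) (intro dfnt_prodS dfnt_const)


section \<open>Recursion, the natural numbers and choice in the model\<close>

text \<open>Each pair of \<open>f\<close> is justified by a set \<open>g\<close> of values taken at
  the elements of its first component. Functionality and a transitive domain are not built in:
  \<open>approx_dest\<close> derives both by \<in>-induction, and the condition survives
  unions.\<close>

definition approx :: "('v \<Rightarrow> 'v \<Rightarrow> 'v) \<Rightarrow> 'v \<Rightarrow> bool" where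
  "approx H f \<longleftrightarrow> (\<forall>z\<in>M. \<forall>v\<in>M. opair z v \<in> elts f \<longrightarrow>
     (\<exists>g\<in>M. v = H z g \<and> (\<forall>w\<in>elts z. \<exists>v'\<in>elts g. opair w v' \<in> elts f) \<and>
        (\<forall>v'\<in>elts g. \<exists>w\<in>elts z. opair w v' \<in> elts f)))"

lemma approx_dest:
  assumes "approx H f" "f \<in> M" "opair z v \<in> elts f"
  shows "v = recS H z \<and> replS z (recS H) \<in> M \<and>
    (\<forall>w\<in>elts z. opair w (recS H w) \<in> elts f)"
  using assms(3)
proof (induction z arbitrary: v rule: mem_induct)
  case (step z)
  have zv: "z \<in> M" "v \<in> M" using M_trans[OF assms(2) step.prems] by auto
  obtain g where g: "g \<in> M" "v = H z g"
    "\<And>w. w \<in> elts z \<Longrightarrow> \<exists>v'\<in>elts g. opair w v' \<in> elts f"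
    "\<And>v'. v' \<in> elts g \<Longrightarrow> \<exists>w\<in>elts z. opair w v' \<in> elts f"
    using assms(1)[unfolded approx_def, THEN bspec, OF zv(1), THEN bspec, OF zv(2), THEN mp,
        OF step.prems] by blast
  have eq: "v' = recS H w" if "w \<in> elts z" "opair w v' \<in> elts f" for w v'
    using step.IH that by blast
  have "elts g = elts (replS z (recS H))"
  proof (intro subset_antisym subsetI)
    show "v' \<in> elts (replS z (recS H))" if "v' \<in> elts g" for v'
      using g(4)[OF that] eq by auto
    show "v' \<in> elts g" if "v' \<in> elts (replS z (recS H))" for v'
      using that g(3) eq by fastforce
  qed
  then have "g = replS z (recS H)" by (rule elts_inject)
  moreover have "opair w (recS H w) \<in> elts f" if "w \<in> elts z" for w
    using g(3)[OF that] eq[OF that] by blast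
  ultimately show ?case using g(1,2) recS_unfold[of H z] by simp
qed

lemma approx_intro:
  assumes "\<And>z v. opair z v \<in> elts f \<Longrightarrow> v = recS H z \<and> replS z (recS H) \<in> M \<and>
    (\<forall>w\<in>elts z. opair w (recS H w) \<in> elts f)"
  shows "approx H f"
  unfolding approx_def
proof (intro ballI impI)
  fix z v assume "opair z v \<in> elts f"
  then have *: "v = recS H z" "replS z (recS H) \<in> M" "\<forall>w\<in>elts z. opair w (recS H w) \<in> elts f"
    using assms by auto
  show "\<exists>g\<in>M. v = H z g \<and> (\<forall>w\<in>elts z. \<exists>v'\<in>elts g. opair w v' \<in> elts f) \<and>
      (\<forall>v'\<in>elts g. \<exists>w\<in>elts z. opair w v' \<in> elts f)"
    by (rule bexI[OF _ *(2)]) (use * recS_unfold[of H z] in auto)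
qed

context
  fixes H :: "'v \<Rightarrow> 'v \<Rightarrow> 'v"
  assumes H: "dfnt (\<lambda>\<rho>. H (\<rho> 0) (\<rho> (Suc 0)))"
begin

lemma dfn_approx: "dfn (\<lambda>\<rho>. approx H (\<rho> n))"
  unfolding approx_def by (intro dfn_intros dfnt_comp2[OF H])

text \<open>
  Replacement needs a uniquely determined approximation for every argument; the least
  one containing the argument in its domain serves.
\<close>

definition least_approx :: "'v \<Rightarrow> 'v \<Rightarrow> bool" where
  "least_approx y f \<longleftrightarrow> approx H f \<and> (\<exists>v\<in>M. opair y v \<in> elts f) \<and>
     (\<forall>f'\<in>M. approx H f' \<and> (\<exists>v\<in>M. opair y v \<in> elts f') \<longrightarrow> elts f \<subseteq> elts f')"

lemma dfn_least_approx: "dfn (\<lambda>\<rho>. least_approx (\<rho> m) (\<rho> n))"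
  unfolding least_approx_def by (intro dfn_intros dfn_approx)

text \<open>The pairs of \<open>f\<close> shared by all approximations at \<open>y\<close> still
  form an approximation: by \<open>approx_dest\<close>, whatever approximation contains a pair also
  contains the pairs for all elements of its first component, with the same values.\<close>

lemma least_approx_exists:
  assumes "f \<in> M" "approx H f" "opair y v \<in> elts f"
  shows "\<exists>f\<in>M. least_approx y f"
proof -
  define Q where "Q e \<longleftrightarrow> (\<forall>f'\<in>M. approx H f' \<and> (\<exists>v\<in>M. opair y v \<in> elts f') \<longrightarrow> e \<in> elts f')" for e
  have yv: "y \<in> M" "v \<in> M" using M_trans[OF assms(1,3)] by auto
  have M: "sepS f Q \<in> M"
    unfolding Q_def by (intro sepS_in_M assms dfn_intros dfn_approx dfnt_const yv)
  have yQ: "Q (opair y v)"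
    unfolding Q_def using approx_dest[OF assms(2,1,3)] approx_dest by blast
  have "approx H (sepS f Q)"
  proof (rule approx_intro)
    fix z v assume "opair z v \<in> elts (sepS f Q)"
    then have *: "opair z v \<in> elts f" "Q (opair z v)" by auto
    have "Q (opair w (recS H w))" if "w \<in> elts z" for w
      unfolding Q_def
    proof (intro ballI impI)
      fix f' assume f': "f' \<in> M" "approx H f' \<and> (\<exists>v\<in>M. opair y v \<in> elts f')"
      then have "opair z v \<in> elts f'" using *(2) unfolding Q_def by blast
      from approx_dest[OF _ f'(1) this] f'(2) that show "opair w (recS H w) \<in> elts f'" by blast
    qed
    then have "opair w (recS H w) \<in> elts (sepS f Q)" if "w \<in> elts z" for w
      using approx_dest[OF assms(2,1) *(1)] that by simp
    then show "v = recS H z \<and> replS z (recS H) \<in> M \<and>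
        (\<forall>w\<in>elts z. opair w (recS H w) \<in> elts (sepS f Q))"
      using approx_dest[OF assms(2,1) *(1)] by blast
  qed
  then have "least_approx y (sepS f Q)"
    unfolding least_approx_def using yv assms(3) yQ by (auto simp: Q_def)
  then show ?thesis using M by blast
qed

text \<open>The least approximations at the elements of \<open>x\<close> are gathered by replacement
  and united, and the pair for \<open>x\<close> is added; a second replacement puts the set of
  earlier values into \<open>M\<close>.\<close>

lemma approx_exists: "x \<in> M \<Longrightarrow> \<exists>f\<in>M. approx H f \<and> opair x (recS H x) \<in> elts f"
proof (induction x rule: mem_induct)
  case (step x)
  have IH: "\<exists>f\<in>M. approx H f \<and> opair y (recS H y) \<in> elts f" if "y \<in> elts x" for y
    using step M_trans that by blast
  have "\<exists>f\<in>M. least_approx y f" if "y \<in> elts x" for y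
    using IH[OF that] least_approx_exists by blast
  then obtain L where L: "\<And>y. y \<in> elts x \<Longrightarrow> L y \<in> M \<and> least_approx y (L y)"
    by metis
  have L_unique: "f = L y" if "y \<in> elts x" "f \<in> M" "least_approx y f" for y f
    using L[OF that(1)] that(2,3) elts_inject unfolding least_approx_def
    by (metis subset_antisym)
  have \<rho>: "env (\<lambda>_. x)" using step.prems by (simp add: env_def)
  have LM: "replS x L \<in> M"
  proof (rule replacement_M[of "\<lambda>x y \<rho>. least_approx x y", OF _ \<rho> step.prems])
    show "dfn (\<lambda>\<rho>. least_approx (\<rho> 0) (\<rho> (Suc 0)))" by (rule dfn_least_approx)
  qed (use L L_unique in auto)
  have RM: "replS x (recS H) \<in> M"
  proof (rule replacement_M[of "\<lambda>x y \<rho>. \<exists>f\<in>M. approx H f \<and> opair x y \<in> elts f",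
        OF _ \<rho> step.prems])
    show "dfn (\<lambda>\<rho>. \<exists>f\<in>M. approx H f \<and> opair (\<rho> 0) (\<rho> (Suc 0)) \<in> elts f)"
      by (intro dfn_intros dfn_approx)
    fix y assume y: "y \<in> elts x"
    then obtain f where f: "f \<in> M" "approx H f" "opair y (recS H y) \<in> elts f"
      using IH by blast
    then show "recS H y \<in> M" using M_trans by fastforce
    show "(\<exists>f\<in>M. approx H f \<and> opair y v \<in> elts f) \<longleftrightarrow> v = recS H y" for v
      using f approx_dest by blast
  qed
  have xM: "recS H x \<in> M"
    using dfnt_in_M[OF H, of "case_nat x (\<lambda>_. replS x (recS H))"] step.prems RM
    by (subst recS_unfold) (auto simp: env_def split: nat.split)
  define f where "f = UnS (set_of {UnS (replS x L), set_of {opair x (recS H x)}})"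
  have f: "elts f = (\<Union>y\<in>elts x. elts (L y)) \<union> {opair x (recS H x)}"
    unfolding f_def by auto
  have "f \<in> M"
    unfolding f_def using upair_in_M[of "opair x (recS H x)" "opair x (recS H x)"] LM xM step.prems
    by (auto intro!: UnS_in_M upair_in_M)
  moreover have "approx H f"
  proof (rule approx_intro)
    fix z v assume "opair z v \<in> elts f"
    then consider (old) y where "y \<in> elts x" "opair z v \<in> elts (L y)"
      | (new) "z = x" "v = recS H x" by (auto simp: f)
    then show "v = recS H z \<and> replS z (recS H) \<in> M \<and> (\<forall>w\<in>elts z. opair w (recS H w) \<in> elts f)"
    proof cases
      case old
      then have "approx H (L y)" "L y \<in> M" using L by (auto simp: least_approx_def)
      from approx_dest[OF this old(2)] old(1) show ?thesis by (auto simp: f)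
    next
      case new
      have "opair w (recS H w) \<in> elts (L w)" if "w \<in> elts x" for w
        using L[OF that] approx_dest unfolding least_approx_def by metis
      then show ?thesis using new RM by (auto simp: f)
    qed
  qed
  ultimately show ?case by (intro bexI[of _ f]) (auto simp: f)
qed

lemma dfnt_recS:
  assumes "dfnt f"
  shows "dfnt (\<lambda>\<rho>. recS H (f \<rho>))"
proof (rule dfnt_comp1[OF _ assms])
  have "recS H x \<in> M" if "x \<in> M" for x
    using approx_exists[OF that] M_trans by fastforce
  moreover have "dfn (\<lambda>\<rho>. \<rho> 0 = recS H (\<rho> (Suc 0)))"
  proof (rule dfn_cong)
    show "dfn (\<lambda>\<rho>. \<exists>f\<in>M. approx H f \<and> opair (\<rho> (Suc 0)) (\<rho> 0) \<in> elts f)"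
      by (intro dfn_intros dfn_approx)
    fix \<rho> assume "env \<rho>"
    then have "\<rho> (Suc 0) \<in> M" by (rule env_in_M)
    then show "(\<exists>f\<in>M. approx H f \<and> opair (\<rho> (Suc 0)) (\<rho> 0) \<in> elts f) \<longleftrightarrow>
        \<rho> 0 = recS H (\<rho> (Suc 0))"
      using approx_exists approx_dest by metis
  qed
  ultimately show "dfnt (\<lambda>\<rho>. recS H (\<rho> 0))" by (simp add: dfnt_def env_def)
qed

end

section \<open>The natural numbers of the model\<close>

lemma empty_in_M: "num 0 \<in> M"
proof -
  obtain x where x: "x \<in> M" using nonempty by blast
  have "sepS x (\<lambda>y. \<not> y = y) \<in> M" by (intro sepS_in_M x dfn_intros)
  moreover have "sepS x (\<lambda>y. \<not> y = y) = num 0" by (rule elts_inject) simp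
  ultimately show ?thesis by simp
qed

definition omega :: 'v where
  "omega = set_of (range num)"

text \<open>The successor is described by a quantifier over \<open>M\<close>, a form covered by
  \<open>dfn_intros\<close>; \<open>succ_closed_iff\<close> restores the usual reading.\<close>

definition succ_closed :: "'v \<Rightarrow> bool" where
  "succ_closed I \<longleftrightarrow> num 0 \<in> elts I \<and>
     (\<forall>x\<in>elts I. \<exists>y\<in>elts I. \<forall>z\<in>M. z \<in> elts y \<longleftrightarrow> z \<in> elts x \<or> z = x)"

lemma succ_closed_iff:
  assumes "I \<in> M"
  shows "succ_closed I \<longleftrightarrow> num 0 \<in> elts I \<and> (\<forall>x\<in>elts I. \<exists>y\<in>elts I. elts y = insert x (elts x))"
proof -
  have "(\<forall>z\<in>M. z \<in> elts y \<longleftrightarrow> z \<in> elts x \<or> z = x) \<longleftrightarrow> elts y = insert x (elts x)"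
    if "x \<in> elts I" "y \<in> elts I" for x y
  proof -
    have "x \<in> M" "y \<in> M" using M_trans[OF assms] that by auto
    then show ?thesis using M_trans by blast
  qed
  then show ?thesis unfolding succ_closed_def by (simp cong: ball_cong bex_cong)
qed

lemma num_in_succ_closed:
  assumes "I \<in> M" "succ_closed I"
  shows "num n \<in> elts I"
proof (induction n)
  case 0
  then show ?case using assms by (simp add: succ_closed_def)
next
  case (Suc n)
  then obtain y where "y \<in> elts I" "elts y = elts (num (Suc n))"
    using assms by (auto simp: succ_closed_iff)
  then show ?case using elts_inject by blast
qed

text \<open>Infinity provides only some inductive set. \<open>W\<close> is the least one, and
  well-foundedness of the surrounding universe excludes non-standard elements: for an \<in>-minimal
  non-numeral \<open>n\<close>, removing \<open>n\<close> from \<open>W\<close> would leave an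
  inductive set.\<close>

lemma omega_exists: "\<exists>w\<in>M. elts w = range num"
proof -
  obtain w where w: "w \<in> M" and w1: "\<exists>e\<in>M. e \<epsilon> w \<and> (\<forall>z\<in>M. \<not> z \<epsilon> e)"
    and w2: "\<forall>x\<in>M. x \<epsilon> w \<longrightarrow> (\<exists>y\<in>M. y \<epsilon> w \<and> (\<forall>z\<in>M. z \<epsilon> y \<longleftrightarrow> z \<epsilon> x \<or> z = x))"
    using infinity by blast
  obtain e where e: "e \<in> M" "e \<in> elts w" "\<And>z. z \<in> M \<Longrightarrow> z \<notin> elts e"
    using w1 by (auto simp: mem_iff)
  then have "elts e = elts (num 0)" using M_trans[OF e(1)] by auto
  then have "e = num 0" by (rule elts_inject)
  moreover have "\<exists>y\<in>elts w. \<forall>z\<in>M. z \<in> elts y \<longleftrightarrow> z \<in> elts x \<or> z = x" if "x \<in> elts w" for x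
    using w2 that M_trans[OF w that] unfolding mem_iff by blast
  ultimately have ind: "succ_closed w" using e(2) by (auto simp: succ_closed_def)
  define W where "W = sepS w (\<lambda>n. \<forall>I\<in>M. succ_closed I \<longrightarrow> n \<in> elts I)"
  have WM: "W \<in> M"
    unfolding W_def succ_closed_def by (intro sepS_in_M w dfn_intros dfnt_const empty_in_M)
  have Wnum: "num n \<in> elts W" for n
    unfolding W_def using ind w num_in_succ_closed by auto
  have "n \<in> range num" if "n \<in> elts W" for n
    using that
  proof (induction n rule: mem_induct)
    case (step n)
    show ?case
    proof (rule ccontr)
      assume not_num: "n \<notin> range num"
      define I where "I = sepS W (\<lambda>x. \<not> x = n)"
      have IM: "I \<in> M"
        unfolding I_def by (intro sepS_in_M WM dfn_intros dfnt_const M_trans[OF WM step.prems])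
      have "\<exists>y\<in>elts I. elts y = insert x (elts x)" if "x \<in> elts I" for x
      proof -
        have x: "x \<in> elts W" using that by (simp add: I_def)
        have "x \<in> M" using M_trans[OF WM x] .
        then have yM: "UnS (set_of {x, set_of {x, x}}) \<in> M" by (intro UnS_in_M upair_in_M)
        define y where "y = UnS (set_of {x, set_of {x, x}})"
        have y: "elts y = insert x (elts x)" unfolding y_def by simp
        have "y \<in> elts J" if "J \<in> M" "succ_closed J" for J
        proof -
          have "x \<in> elts J" using x that by (simp add: W_def)
          then show ?thesis using that y elts_inject by (metis succ_closed_iff)
        qed
        then have yW: "y \<in> elts W" using w ind by (simp add: W_def)
        moreover have "y \<noteq> n"
        proof
          assume "y = n"
          then have "x \<in> range num" using step.IH[of x] x y by simp
          then obtain k where "elts y = elts (num (Suc k))" using y by auto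
          then show False using \<open>y = n\<close> not_num elts_inject by blast
        qed
        ultimately show ?thesis using y by (auto simp: I_def)
      qed
      then have "succ_closed I"
        using succ_closed_iff[OF IM] Wnum not_num by (auto simp: I_def)
      then have "n \<in> elts I" using step.prems IM by (simp add: W_def)
      then show False by (simp add: I_def)
    qed
  qed
  then show ?thesis using WM Wnum by blast
qed

lemma omega_in_M: "omega \<in> M"
  unfolding omega_def by (metis omega_exists set_of_elts)

lemma elts_omega [simp]: "elts omega = range num"
  unfolding omega_def by (metis omega_exists set_of_elts)

lemma num_in_M: "num n \<in> M"
  using M_trans[OF omega_in_M] by simp

lemma finite_set_in_M:
  assumes "finite F" "F \<subseteq> M"
  shows "\<exists>s\<in>M. elts s = F"
  using assms
proof (induction F rule: finite_induct)
  case empty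
  then show ?case using empty_in_M by (intro bexI[of _ "num 0"]) auto
next
  case (insert x F)
  then obtain s where s: "s \<in> M" "elts s = F" by auto
  then have "UnS (set_of {s, set_of {x, x}}) \<in> M" using insert by (intro UnS_in_M upair_in_M) auto
  moreover have "elts (UnS (set_of {s, set_of {x, x}})) = insert x F" using s by auto
  ultimately show ?case by blast
qed

section \<open>Choice functions and injective sequences in the model\<close>

lemma UnS_singleton: "elts x = {y} \<Longrightarrow> UnS x = y"
  by (rule elts_inject) simp

lemma choice_function:
  assumes "X \<in> M"
  obtains ch where "dfnt (\<lambda>\<rho>. ch (\<rho> 0))"
    "\<And>s. s \<in> M \<Longrightarrow> elts s \<subseteq> elts X \<Longrightarrow> elts s \<noteq> {} \<Longrightarrow> ch s \<in> elts s"
proof -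
  \<comment> \<open>The axiom of choice is about disjoint families, so each nonempty subset
    \<open>s\<close> of \<open>X\<close> is replaced by the product of its singleton with
    \<open>s\<close>.\<close>
  define F where "F = replS (sepS (powM X) (\<lambda>s. \<exists>y\<in>elts s. y = y)) (\<lambda>s. prodS (set_of {s}) s)"
  have FM: "F \<in> M"
    unfolding F_def by (intro replS_in_M sepS_in_M powM assms dfn_intros)
  have F: "x \<in> elts F \<longleftrightarrow> (\<exists>s\<in>M. elts s \<subseteq> elts X \<and> elts s \<noteq> {} \<and> x = prodS (set_of {s}) s)" for x
    unfolding F_def by (auto simp: powM assms)
  have 1: "\<forall>x\<in>M. x \<epsilon> F \<longrightarrow> (\<exists>z\<in>M. z \<epsilon> x)"
  proof (intro ballI impI)
    fix x assume "x \<in> M" "x \<epsilon> F"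
    then have "elts x \<noteq> {}" by (auto simp: mem_iff F)
    then show "\<exists>z\<in>M. z \<epsilon> x" using M_trans[OF \<open>x \<in> M\<close>] by (auto simp: mem_iff)
  qed
  have 2: "\<forall>x\<in>M. \<forall>y\<in>M. x \<epsilon> F \<and> y \<epsilon> F \<and> x \<noteq> y \<longrightarrow> \<not> (\<exists>z\<in>M. z \<epsilon> x \<and> z \<epsilon> y)"
    by (auto simp: mem_iff F)
  obtain C where C: "C \<in> M" "\<forall>x\<in>M. x \<epsilon> F \<longrightarrow> (\<exists>!z. z \<in> M \<and> z \<epsilon> C \<and> z \<epsilon> x)"
    using choice[THEN bspec, OF FM, THEN mp, OF 1, THEN mp, OF 2] by blast
  \<comment> \<open>The union of a singleton is its element: this replaces a definite description by
    a definable total operation.\<close>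
  define ch where "ch s = UnS (sepS s (\<lambda>y. opair s y \<in> elts C))" for s
  have "dfnt (\<lambda>\<rho>. ch (\<rho> 0))"
    unfolding ch_def by (intro dfn_intros dfnt_const C(1))
  moreover have "ch s \<in> elts s" if s: "s \<in> M" "elts s \<subseteq> elts X" "elts s \<noteq> {}" for s
  proof -
    have "prodS (set_of {s}) s \<in> elts F" using s F by blast
    moreover from this have "prodS (set_of {s}) s \<in> M" using M_trans FM by blast
    ultimately have "\<exists>!z. z \<in> M \<and> z \<in> elts C \<and> z \<in> elts (prodS (set_of {s}) s)"
      using C(2) unfolding mem_iff by blast
    then obtain z where z: "z \<in> elts C" "z \<in> elts (prodS (set_of {s}) s)"
      and u': "\<And>z'. z' \<in> M \<and> z' \<in> elts C \<and> z' \<in> elts (prodS (set_of {s}) s) \<Longrightarrow> z' = z"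
      by (elim ex1E) blast
    then obtain y where y: "y \<in> elts s" "opair s y \<in> elts C" "z = opair s y" by auto
    have u: "y' = y" if "opair s y' \<in> elts C" "y' \<in> elts s" for y'
      using u'[of "opair s y'"] that y(3) M_trans[OF s(1) that(2)] s(1) by simp
    have "elts (sepS s (\<lambda>y. opair s y \<in> elts C)) = {y}"
      unfolding elts_sepS using y(1,2) u by blast
    from UnS_singleton[OF this] show ?thesis unfolding ch_def using y(1) by simp
  qed
  ultimately show thesis by (rule that)
qed

lemma infinite_set_sequence:
  assumes "S \<in> M" "infinite (elts S)"
  obtains x where "dfnt (\<lambda>\<rho>. x (\<rho> 0))" "inj (\<lambda>n. x (num n))" "\<And>n. x (num n) \<in> elts S"
proof -
  obtain ch where ch: "dfnt (\<lambda>\<rho>. ch (\<rho> 0))"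
    "\<And>s. s \<in> M \<Longrightarrow> elts s \<subseteq> elts S \<Longrightarrow> elts s \<noteq> {} \<Longrightarrow> ch s \<in> elts s"
    by (rule choice_function[OF assms(1)]) blast
  \<comment> \<open>The recursion runs over all sets, but at \<open>num n\<close> its earlier values
    are those at the smaller numerals, so the next value is a new element of \<open>S\<close>.
    Infinity of \<open>S\<close> keeps the set to choose from nonempty.\<close>
  define H where "H = (\<lambda>(x :: 'v) g. ch (sepS S (\<lambda>y. \<not> y \<in> elts g)))"
  have "dfnt (\<lambda>\<rho>. H (\<rho> 0) (\<rho> (Suc 0)))"
    unfolding H_def by (intro dfnt_comp1[OF ch(1)] dfn_intros dfnt_const assms)
  note dfn_x = dfnt_recS[OF this dfnt_var, of 0]
  define x where "x = recS H"
  have x: "x (num n) \<in> elts S - (\<lambda>m. x (num m)) ` {..<n}" for n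
  proof -
    let ?g = "replS (num n) x"
    have g: "elts ?g = (\<lambda>m. x (num m)) ` {..<n}" by (auto simp: elts_num)
    have gM: "?g \<in> M"
      unfolding x_def by (intro replS_in_M num_in_M dfn_x)
    have "sepS S (\<lambda>y. \<not> y \<in> elts ?g) \<in> M"
      by (intro sepS_in_M assms dfn_intros dfnt_const gM)
    moreover have "infinite (elts S - elts ?g)" using assms(2) g by simp
    then have "elts S - elts ?g \<noteq> {}" by (rule infinite_imp_nonempty)
    then have "elts (sepS S (\<lambda>y. \<not> y \<in> elts ?g)) \<noteq> {}"
      unfolding elts_sepS by blast
    ultimately have "ch (sepS S (\<lambda>y. \<not> y \<in> elts ?g)) \<in> elts (sepS S (\<lambda>y. \<not> y \<in> elts ?g))"
      by (intro ch) auto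
    moreover have "x (num n) = ch (sepS S (\<lambda>y. \<not> y \<in> elts ?g))"
      unfolding x_def by (subst recS_unfold) (simp add: H_def)
    ultimately show ?thesis using g by simp
  qed
  have "inj (\<lambda>n. x (num n))"
  proof (rule linorder_injI)
    show "x (num m) \<noteq> x (num n)" if "m < n" for m n
    proof
      assume "x (num m) = x (num n)"
      then have "x (num n) \<in> (\<lambda>m. x (num m)) ` {..<n}"
        using that by (intro image_eqI[of _ _ m]) auto
      then show False using x[of n] by blast
    qed
  qed
  then show thesis using that dfn_x x unfolding x_def by blast
qed


section \<open>Ultrafilters in the model\<close>

text \<open>Nonemptiness is included because the empty union is not a proper filter; it is spelled
  as a bounded quantifier to match \<open>dfn_bex\<close>.\<close>

definition chain_set :: "'v \<Rightarrow> bool" where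
  "chain_set C \<longleftrightarrow> (\<exists>x\<in>elts C. x = x) \<and>
     (\<forall>x\<in>elts C. \<forall>y\<in>elts C. elts x \<subseteq> elts y \<or> elts y \<subseteq> elts x)"

context
  fixes X b :: 'v and s :: "'v \<Rightarrow> 'v"
  assumes X: "X \<in> M" and b: "b \<in> elts X" and dfn_s: "dfnt (\<lambda>\<rho>. s (\<rho> 0))"
    and s: "\<And>x. x \<in> elts X \<Longrightarrow> s x \<in> elts X \<and> elts x \<subseteq> elts (s x)"
    and sup: "\<And>C. C \<in> M \<Longrightarrow> elts C \<subseteq> elts X \<Longrightarrow> chain_set C \<Longrightarrow> UnS C \<in> elts X"
begin

text \<open>
  The Bourbaki-Witt theorem inside the model: the least tower over \<open>b\<close> is a chain, so its
  union is a fixed point of \<open>s\<close>.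
\<close>

definition tower :: "'v \<Rightarrow> bool" where
  "tower T \<longleftrightarrow> b \<in> elts T \<and> (\<forall>x\<in>elts T. s x \<in> elts T) \<and>
     (\<forall>C\<in>M. elts C \<subseteq> elts T \<and> chain_set C \<longrightarrow> UnS C \<in> elts T)"

definition least_tower :: 'v where
  "least_tower = sepS X (\<lambda>x. \<forall>T\<in>M. tower T \<longrightarrow> x \<in> elts T)"

text \<open>The usual auxiliary notion for Bourbaki-Witt: \<open>extreme_cases\<close> compares an
  extreme element with the whole tower, and \<open>least_tower_extreme\<close> shows that all
  elements are extreme, which makes the tower a chain.\<close>

definition extreme :: "'v \<Rightarrow> bool" where
  "extreme c \<longleftrightarrow>
     (\<forall>x\<in>elts least_tower. elts x \<subseteq> elts c \<and> x \<noteq> c \<longrightarrow> elts (s x) \<subseteq> elts c)"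

lemma b_in_M: "b \<in> M"
  using M_trans[OF X b] .

lemma least_tower_in_M: "least_tower \<in> M"
  unfolding least_tower_def tower_def chain_set_def
  by (intro sepS_in_M X dfn_intros dfnt_comp1[OF dfn_s] dfnt_const b_in_M)

lemma tower_least_tower: "tower least_tower"
  unfolding tower_def
proof (intro conjI ballI impI)
  show "b \<in> elts least_tower"
    using b by (simp add: least_tower_def tower_def)
  show "s x \<in> elts least_tower" if "x \<in> elts least_tower" for x
    using that s by (simp add: least_tower_def tower_def)
  show "UnS C \<in> elts least_tower" if "C \<in> M" "elts C \<subseteq> elts least_tower \<and> chain_set C" for C
  proof -
    have "elts C \<subseteq> elts X" "\<And>T. T \<in> M \<Longrightarrow> tower T \<Longrightarrow> elts C \<subseteq> elts T"
      using that(2) by (auto simp: least_tower_def)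
    then show ?thesis using sup that unfolding least_tower_def tower_def by simp
  qed
qed

text \<open>Induction is limited to definable \<open>Q\<close>: the tower elements satisfying
  \<open>Q\<close> must form a set of \<open>M\<close> in order to compete with the least
  tower.\<close>

lemma least_tower_induct [consumes 1, case_names dfn base step sup]:
  assumes "x \<in> elts least_tower" "dfn (\<lambda>\<rho>. Q (\<rho> 0))" "Q b"
    and "\<And>x. x \<in> elts least_tower \<Longrightarrow> Q x \<Longrightarrow> Q (s x)"
    and "\<And>C. C \<in> M \<Longrightarrow> elts C \<subseteq> elts least_tower \<Longrightarrow> chain_set C \<Longrightarrow> \<forall>x\<in>elts C. Q x \<Longrightarrow> Q (UnS C)"
  shows "Q x"
proof -
  let ?T = "sepS least_tower Q"
  have "?T \<in> M" by (intro sepS_in_M least_tower_in_M assms)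
  moreover have "tower ?T"
    unfolding tower_def
  proof (intro conjI ballI impI)
    show "b \<in> elts ?T" using tower_least_tower assms(3) by (simp add: tower_def)
    show "s x \<in> elts ?T" if "x \<in> elts ?T" for x
      using tower_least_tower assms(4) that by (simp add: tower_def)
    show "UnS C \<in> elts ?T" if "C \<in> M" "elts C \<subseteq> elts ?T \<and> chain_set C" for C
    proof -
      have "elts C \<subseteq> elts least_tower" "\<forall>x\<in>elts C. Q x" using that(2) by auto
      then show ?thesis using tower_least_tower assms(5)[of C] that by (simp add: tower_def)
    qed
  qed
  moreover have "\<forall>T\<in>M. tower T \<longrightarrow> x \<in> elts T"
    using assms(1) by (simp add: least_tower_def)
  ultimately have "x \<in> elts ?T" by blast
  then show ?thesis by simp
qed

lemma least_tower_s: "x \<in> elts least_tower \<Longrightarrow> s x \<in> elts least_tower \<and> elts x \<subseteq> elts (s x)"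
  using tower_least_tower s by (simp add: tower_def least_tower_def)

lemma least_tower_base: "x \<in> elts least_tower \<Longrightarrow> elts b \<subseteq> elts x"
proof (induction rule: least_tower_induct)
  case dfn
  then show ?case by (intro dfn_intros dfnt_const b_in_M)
next
  case (step x)
  then show ?case using least_tower_s by blast
next
  case (sup C)
  then show ?case unfolding chain_set_def elts_UnS by blast
qed simp

lemma extreme_cases:
  assumes "c \<in> elts least_tower" "extreme c"
  shows "x \<in> elts least_tower \<Longrightarrow> elts x \<subseteq> elts c \<or> elts (s c) \<subseteq> elts x"
proof (induction rule: least_tower_induct)
  case dfn
  have "c \<in> M" using M_trans[OF least_tower_in_M assms(1)] .
  then show ?case by (intro dfn_intros dfnt_comp1[OF dfn_s] dfnt_const)
next
  case base
  then show ?case using least_tower_base assms(1) by blast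
next
  case (step x)
  then show ?case
    using assms(2) least_tower_s[OF step(1)] unfolding extreme_def by blast
next
  case (sup C)
  then show ?case unfolding elts_UnS by blast
qed

lemma least_tower_extreme: "c \<in> elts least_tower \<Longrightarrow> extreme c"
proof (induction rule: least_tower_induct)
  case dfn
  then show ?case
    unfolding extreme_def by (intro dfn_intros dfnt_comp1[OF dfn_s] dfnt_const least_tower_in_M)
next
  case base
  then show ?case unfolding extreme_def using least_tower_base elts_inject by blast
next
  case (step c)
  show ?case unfolding extreme_def
  proof (intro ballI impI)
    fix x assume x: "x \<in> elts least_tower" "elts x \<subseteq> elts (s c) \<and> x \<noteq> s c"
    \<comment> \<open>By \<open>extreme_cases\<close> no tower element lies strictly between
      \<open>c\<close> and \<open>s c\<close>.\<close>
    then have "elts x \<subseteq> elts c" using extreme_cases[OF step x(1)] elts_inject by blast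
    then show "elts (s x) \<subseteq> elts (s c)"
      using step x(1) least_tower_s[OF step(1)] unfolding extreme_def by blast
  qed
next
  case (sup C)
  show ?case unfolding extreme_def
  proof (intro ballI impI)
    fix x assume x: "x \<in> elts least_tower" "elts x \<subseteq> elts (UnS C) \<and> x \<noteq> UnS C"
    have C: "c \<in> elts least_tower" "extreme c" "elts c \<subseteq> elts (UnS C)" if "c \<in> elts C" for c
      using sup that by auto
    have "\<not> elts (UnS C) \<subseteq> elts x" using x(2) elts_inject by blast
    \<comment> \<open>The union is not contained in \<open>x\<close>, so some member of the chain is
      not either; comparability then places \<open>x\<close> strictly below that member.\<close>
    then obtain c where c: "c \<in> elts C" "\<not> elts c \<subseteq> elts x" by auto
    then have "elts x \<subseteq> elts c"
      using extreme_cases[OF C(1,2) x(1)] least_tower_s[OF C(1)] by blast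
    moreover have "x \<noteq> c" using c(2) by blast
    ultimately have "elts (s x) \<subseteq> elts c" using C(2)[OF c(1)] x(1) unfolding extreme_def by blast
    then show "elts (s x) \<subseteq> elts (UnS C)" using C(3)[OF c(1)] by blast
  qed
qed

lemma fixed_point_exists: "\<exists>x\<in>elts X. elts b \<subseteq> elts x \<and> s x = x"
proof -
  have "chain_set least_tower"
    unfolding chain_set_def
  proof (intro conjI ballI)
    show "\<exists>x\<in>elts least_tower. x = x" using tower_least_tower by (auto simp: tower_def)
    show "elts x \<subseteq> elts y \<or> elts y \<subseteq> elts x"
      if "x \<in> elts least_tower" "y \<in> elts least_tower" for x y
      using extreme_cases[OF that(2) least_tower_extreme[OF that(2)] that(1)] least_tower_s[OF that(2)]
      by blast
  qed
  then have L: "UnS least_tower \<in> elts least_tower" (is "?L \<in> _")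
    using tower_least_tower least_tower_in_M by (simp add: tower_def)
  then have "elts (s ?L) \<subseteq> elts ?L" using least_tower_s by auto
  then have "s ?L = ?L" using least_tower_s[OF L] elts_inject by blast
  moreover have "?L \<in> elts X" using L by (simp add: least_tower_def)
  ultimately show ?thesis using least_tower_base[OF L] by blast
qed

end

end

section \<open>Boolean algebras in the model\<close>

locale model_algebra = transitive_model M for M :: "'v::set_universe set" +
  fixes A :: "'v bool_alg"
  assumes alg_in_M: "bool_alg_in A M" and boolean: "is_boolean_algebra A"
begin

text \<open>
  The operations of the algebra as total functions that are definable over the model
  (\<open>app\<close> is unspecified outside the domain); they agree with the given ones on the carrier.
\<close>

definition mt :: "'v \<Rightarrow> 'v \<Rightarrow> 'v" where
  "mt x y = UnS (sepS (univ A) (\<lambda>z. opair (opair x y) z \<in> elts (meet A)))"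

definition cp :: "'v \<Rightarrow> 'v" where
  "cp x = UnS (sepS (univ A) (\<lambda>z. opair x z \<in> elts (compl A)))"

abbreviation "B \<equiv> elts (univ A)"

lemma consts_in_M: "univ A \<in> M" "meet A \<in> M" "compl A \<in> M" "bottom A \<in> M" "top_elt A \<in> M"
  using alg_in_M by (auto simp: bool_alg_in_def)

lemmas dfnt_alg_consts = consts_in_M[THEN dfnt_const]

lemma dfnt_mt: "dfnt f \<Longrightarrow> dfnt g \<Longrightarrow> dfnt (\<lambda>\<rho>. mt (f \<rho>) (g \<rho>))"
  unfolding mt_def by (intro dfn_intros dfnt_alg_consts dfnt_weaken)

lemma dfnt_cp: "dfnt f \<Longrightarrow> dfnt (\<lambda>\<rho>. cp (f \<rho>))"
  unfolding cp_def by (intro dfn_intros dfnt_alg_consts dfnt_weaken)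

lemma app_eq_UnS:
  assumes "function_on f D (elts C)" "x \<in> D"
  shows "UnS (sepS C (\<lambda>z. opair x z \<in> elts f)) = app f x \<and> app f x \<in> elts C"
proof -
  have ex: "\<exists>!y. opair x y \<in> elts f" and sub: "\<And>y. opair x y \<in> elts f \<Longrightarrow> y \<in> elts C"
    using assms unfolding function_on_def mem_iff by fastforce+
  have y: "opair x (app f x) \<in> elts f"
    unfolding app_def mem_iff by (rule theI'[OF ex])
  then have "elts (sepS C (\<lambda>z. opair x z \<in> elts f)) = {app f x}"
    using ex sub by auto
  from UnS_singleton[OF this] show ?thesis using y sub by blast
qed

lemma algebra:
  defines "BB \<equiv> {opair a b | a b. a \<in> B \<and> b \<in> B}"
  shows op_functions: "function_on (join A) BB B" "function_on (meet A) BB B"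
      "function_on (compl A) B B" "bottom A \<in> B" "top_elt A \<in> B"
    and laws: "\<And>x y z. x \<in> B \<Longrightarrow> y \<in> B \<Longrightarrow> z \<in> B \<Longrightarrow>
      join_op A x (join_op A y z) = join_op A (join_op A x y) z \<and>
      meet_op A x (meet_op A y z) = meet_op A (meet_op A x y) z \<and>
      join_op A x y = join_op A y x \<and> meet_op A x y = meet_op A y x \<and>
      join_op A x (meet_op A x y) = x \<and> meet_op A x (join_op A x y) = x \<and>
      meet_op A x (join_op A y z) = join_op A (meet_op A x y) (meet_op A x z) \<and>
      join_op A x (meet_op A y z) = meet_op A (join_op A x y) (join_op A x z) \<and>
      join_op A x (compl_op A x) = top_elt A \<and> meet_op A x (compl_op A x) = bottom A"
  using boolean unfolding is_boolean_algebra_def Let_def BB_def by blast+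

lemma mt_eq: "x \<in> B \<Longrightarrow> y \<in> B \<Longrightarrow> meet_op A x y = mt x y"
  using app_eq_UnS[OF op_functions(2)] unfolding mt_def meet_op_def by auto

lemma cp_eq: "x \<in> B \<Longrightarrow> compl_op A x = cp x"
  using app_eq_UnS[OF op_functions(3)] unfolding cp_def compl_op_def by auto

lemma mt_closed [simp]: "x \<in> B \<Longrightarrow> y \<in> B \<Longrightarrow> mt x y \<in> B"
  using app_eq_UnS[OF op_functions(2)] unfolding mt_def by auto

lemma cp_closed [simp]: "x \<in> B \<Longrightarrow> cp x \<in> B"
  using app_eq_UnS[OF op_functions(3)] unfolding cp_def by auto

lemma join_closed: "x \<in> B \<Longrightarrow> y \<in> B \<Longrightarrow> join_op A x y \<in> B"
  using app_eq_UnS[OF op_functions(1)] unfolding join_op_def by auto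

lemma bot_top_closed [simp]: "bottom A \<in> B" "top_elt A \<in> B"
  using op_functions(4,5) .

lemma mt_assoc: "x \<in> B \<Longrightarrow> y \<in> B \<Longrightarrow> z \<in> B \<Longrightarrow> mt (mt x y) z = mt x (mt y z)"
  using laws[of x y z] by (simp add: mt_eq)

lemma mt_comm: "x \<in> B \<Longrightarrow> y \<in> B \<Longrightarrow> mt x y = mt y x"
  using laws[of x y y] by (simp add: mt_eq)

lemma join_comm: "x \<in> B \<Longrightarrow> y \<in> B \<Longrightarrow> join_op A x y = join_op A y x"
  using laws[of x y y] by blast

lemma mt_join: "x \<in> B \<Longrightarrow> y \<in> B \<Longrightarrow> mt x (join_op A x y) = x"
  using laws[of x y y] mt_eq[of x "join_op A x y"] join_closed[of x y] by metis

lemma join_mt: "x \<in> B \<Longrightarrow> y \<in> B \<Longrightarrow> join_op A x (mt x y) = x"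
  using laws[of x y y] mt_eq[of x y] by metis

lemma mt_distrib: "x \<in> B \<Longrightarrow> y \<in> B \<Longrightarrow> z \<in> B \<Longrightarrow> mt x (join_op A y z) = join_op A (mt x y) (mt x z)"
  using laws[of x y z] mt_eq[of x "join_op A y z"] mt_eq[of x y] mt_eq[of x z] join_closed[of y z]
  by metis

lemma mt_cp: "x \<in> B \<Longrightarrow> mt x (cp x) = bottom A"
  using laws[of x x x] mt_eq[of x "cp x"] cp_eq[of x] cp_closed[of x] by metis

lemma join_cp: "x \<in> B \<Longrightarrow> join_op A x (cp x) = top_elt A"
  using laws[of x x x] cp_eq[of x] by metis

lemma mt_top: "x \<in> B \<Longrightarrow> mt x (top_elt A) = x"
  using mt_join[of x "cp x"] by (simp add: join_cp)

lemma mt_idem: "x \<in> B \<Longrightarrow> mt x x = x"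
  using mt_join[of x "mt x x"] by (simp add: join_mt)

lemma mt_bot: "x \<in> B \<Longrightarrow> mt x (bottom A) = bottom A"
  using mt_assoc[of x x "cp x"] by (simp add: mt_cp mt_idem)

lemma mt_split: "x \<in> B \<Longrightarrow> y \<in> B \<Longrightarrow> x = join_op A (mt x y) (mt x (cp y))"
  using mt_distrib[of x y "cp y"] by (simp add: join_cp mt_top)

lemma join_bot: "x \<in> B \<Longrightarrow> join_op A x (bottom A) = x \<and> join_op A (bottom A) x = x"
  using join_mt[of x "cp x"] join_comm[of x "bottom A"] by (simp add: mt_cp)

lemma mt_cp_eq_bot: "x \<in> B \<Longrightarrow> y \<in> B \<Longrightarrow> mt x (cp y) = bottom A \<Longrightarrow> mt x y = x"
  using mt_split[of x y] join_bot[of "mt x y"] by simp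

lemma mt_eq_bot: "x \<in> B \<Longrightarrow> y \<in> B \<Longrightarrow> mt x y = bottom A \<Longrightarrow> mt x (cp y) = x"
  using mt_split[of x y] join_bot[of "mt x (cp y)"] by simp

text \<open>The order of the algebra gets no symbol of its own; it is the equation
  \<open>mt x y = x\<close>, the form in which the definition of ultrafilters uses it.\<close>

lemma le_trans: "x \<in> B \<Longrightarrow> y \<in> B \<Longrightarrow> z \<in> B \<Longrightarrow> mt x y = x \<Longrightarrow> mt y z = y \<Longrightarrow> mt x z = x"
  by (metis mt_assoc)

lemma mt_le1: "x \<in> B \<Longrightarrow> y \<in> B \<Longrightarrow> mt (mt x y) x = mt x y"
  by (metis mt_assoc mt_comm mt_idem)

lemma mt_le2: "x \<in> B \<Longrightarrow> y \<in> B \<Longrightarrow> mt (mt x y) y = mt x y"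
  by (metis mt_assoc mt_idem)

lemma mt_greatest:
  "x \<in> B \<Longrightarrow> y \<in> B \<Longrightarrow> z \<in> B \<Longrightarrow> mt x y = x \<Longrightarrow> mt x z = x \<Longrightarrow> mt x (mt y z) = x"
  by (metis mt_assoc)

section \<open>Proper filters and the ultrafilter theorem in the model\<close>

definition proper_filter :: "'v \<Rightarrow> bool" where
  "proper_filter F \<longleftrightarrow> elts F \<subseteq> B \<and> top_elt A \<in> elts F \<and> bottom A \<notin> elts F \<and>
     (\<forall>x\<in>elts F. \<forall>y\<in>elts F. mt x y \<in> elts F) \<and>
     (\<forall>x\<in>elts F. \<forall>y\<in>B. mt x y = x \<longrightarrow> y \<in> elts F)"

definition ultra :: "'v \<Rightarrow> bool" where
  "ultra F \<longleftrightarrow> proper_filter F \<and> (\<forall>x\<in>B. x \<in> elts F \<or> cp x \<in> elts F)"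

text \<open>\<open>mt\<close> and \<open>cp\<close> are known to agree with the given operations on
  the carrier, hence the case distinction; outside it both sides fail. Neither side mentions a
  model, which is why ultrafilters from \<open>M\<close> remain ultrafilters in the
  extension.\<close>

lemma is_ultrafilter_iff: "is_ultrafilter A u \<longleftrightarrow> ultra u"
proof (cases "elts u \<subseteq> B")
  case True
  have m: "meet_op A x y = mt x y" if "x \<in> elts u" "y \<in> B" for x y
    using True that mt_eq by blast
  have "(\<forall>a b. a \<in> elts u \<and> b \<in> elts u \<longrightarrow> meet_op A a b \<in> elts u) \<longleftrightarrow>
      (\<forall>x\<in>elts u. \<forall>y\<in>elts u. mt x y \<in> elts u)"
    using True m by (metis subsetD)
  moreover have "(\<forall>a b. a \<in> elts u \<and> b \<in> B \<and> meet_op A a b = a \<longrightarrow> b \<in> elts u) \<longleftrightarrow>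
      (\<forall>x\<in>elts u. \<forall>y\<in>B. mt x y = x \<longrightarrow> y \<in> elts u)"
  proof (intro iffI ballI allI impI)
    fix x y assume *: "\<forall>a b. a \<in> elts u \<and> b \<in> B \<and> meet_op A a b = a \<longrightarrow> b \<in> elts u"
      "x \<in> elts u" "y \<in> B" "mt x y = x"
    then have "meet_op A x y = x" using m[of x y] by metis
    then show "y \<in> elts u" using * by blast
  next
    fix x y assume *: "\<forall>x\<in>elts u. \<forall>y\<in>B. mt x y = x \<longrightarrow> y \<in> elts u"
      "x \<in> elts u \<and> y \<in> B \<and> meet_op A x y = x"
    then have "mt x y = x" using m[of x y] by metis
    then show "y \<in> elts u" using * by blast
  qed
  moreover have "(\<forall>a. a \<in> B \<longrightarrow> a \<in> elts u \<or> compl_op A a \<in> elts u) \<longleftrightarrow>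
      (\<forall>x\<in>B. x \<in> elts u \<or> cp x \<in> elts u)"
    unfolding Ball_def by (simp add: cp_eq)
  ultimately show ?thesis
    unfolding is_ultrafilter_def ultra_def proper_filter_def mem_iff by argo
next
  case False
  then show ?thesis
    unfolding is_ultrafilter_def ultra_def proper_filter_def by blast
qed

lemma dfn_proper_filter: "dfn (\<lambda>\<rho>. proper_filter (\<rho> n))"
  unfolding proper_filter_def by (intro dfn_intros dfnt_alg_consts dfnt_mt)

lemma dfn_ultra: "dfn (\<lambda>\<rho>. ultra (\<rho> n))"
  unfolding ultra_def by (intro dfn_intros dfn_proper_filter dfnt_alg_consts dfnt_cp)

text \<open>The filter generated by \<open>F\<close> and the further element
  \<open>b\<close>.\<close>

definition gen :: "'v \<Rightarrow> 'v \<Rightarrow> 'v" where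
  "gen F b = sepS (univ A) (\<lambda>a. \<exists>f\<in>elts F. mt (mt f b) a = mt f b)"

text \<open>Properness is the point: if some \<open>f\<close> in \<open>F\<close> met
  \<open>b\<close> in the bottom element, then \<open>f\<close> would lie below \<open>cp b\<close>
  and put \<open>cp b\<close> into \<open>F\<close>.\<close>

lemma proper_filter_gen:
  assumes F: "proper_filter F" and b: "b \<in> B" and nb: "cp b \<notin> elts F"
  shows "proper_filter (gen F b) \<and> elts F \<subseteq> elts (gen F b) \<and> b \<in> elts (gen F b)"
proof -
  have FB: "f \<in> B" if "f \<in> elts F" for f using F that by (auto simp: proper_filter_def)
  have top: "top_elt A \<in> elts F" using F by (simp add: proper_filter_def)
  have 1: "elts F \<subseteq> elts (gen F b)"
    using FB mt_le1 b by (auto simp: gen_def)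
  have 2: "b \<in> elts (gen F b)"
    using top mt_le2 b by (auto simp: gen_def intro!: bexI[of _ "top_elt A"])
  have 3: "bottom A \<notin> elts (gen F b)"
  proof
    assume "bottom A \<in> elts (gen F b)"
    then obtain f where f: "f \<in> elts F" "mt (mt f b) (bottom A) = mt f b" by (auto simp: gen_def)
    then have "mt f b = bottom A" using FB b by (simp add: mt_bot)
    then have "mt f (cp b) = f" using FB[OF f(1)] b mt_eq_bot by blast
    then show False using F f(1) nb b by (auto simp: proper_filter_def)
  qed
  have 4: "mt x y \<in> elts (gen F b)" if xy: "x \<in> elts (gen F b)" "y \<in> elts (gen F b)" for x y
  proof -
    obtain f g where fg: "f \<in> elts F" "mt (mt f b) x = mt f b" "g \<in> elts F" "mt (mt g b) y = mt g b"
      and B: "x \<in> B" "y \<in> B" using xy by (auto simp: gen_def)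
    let ?h = "mt f g"
    have fgB: "f \<in> B" "g \<in> B" using fg FB by auto
    have h: "?h \<in> elts F" using F fg by (auto simp: proper_filter_def)
    have b1: "mt (mt ?h b) f = mt ?h b" "mt (mt ?h b) g = mt ?h b" "mt (mt ?h b) b = mt ?h b"
      using fgB b mt_le1[of ?h b] mt_le1[of f g] mt_le2[of f g] mt_le2[of ?h b]
        le_trans[of "mt ?h b" ?h f] le_trans[of "mt ?h b" ?h g] by auto
    have "mt (mt ?h b) (mt f b) = mt ?h b" "mt (mt ?h b) (mt g b) = mt ?h b"
      using b1 fgB b mt_greatest[of "mt ?h b" f b] mt_greatest[of "mt ?h b" g b] by auto
    then have "mt (mt ?h b) x = mt ?h b" "mt (mt ?h b) y = mt ?h b"
      using fg fgB b B le_trans[of "mt ?h b" "mt f b" x] le_trans[of "mt ?h b" "mt g b" y] by auto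
    then have "mt (mt ?h b) (mt x y) = mt ?h b"
      using fgB b B mt_greatest[of "mt ?h b" x y] by auto
    then show ?thesis using h B by (auto simp: gen_def)
  qed
  have 5: "y \<in> elts (gen F b)" if xy: "x \<in> elts (gen F b)" "y \<in> B" "mt x y = x" for x y
  proof -
    obtain f where f: "f \<in> elts F" "mt (mt f b) x = mt f b" "x \<in> B" using xy by (auto simp: gen_def)
    then have "mt (mt f b) y = mt f b" using le_trans[of "mt f b" x y] FB b xy by auto
    then show ?thesis using f xy by (auto simp: gen_def)
  qed
  show ?thesis
    unfolding proper_filter_def using 1 2 3 4 5 top by (auto simp: gen_def)
qed

lemma proper_filter_Union:
  assumes "chain_set C" "\<And>F. F \<in> elts C \<Longrightarrow> proper_filter F"
  shows "proper_filter (UnS C)"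
proof -
  have "mt x y \<in> elts (UnS C)" if xy: "x \<in> elts (UnS C)" "y \<in> elts (UnS C)" for x y
  proof -
    obtain F G where "F \<in> elts C" "G \<in> elts C" "x \<in> elts F" "y \<in> elts G" using xy by auto
    then obtain K where K: "K \<in> elts C" "x \<in> elts K" "y \<in> elts K"
      using assms(1) unfolding chain_set_def by blast
    then have "mt x y \<in> elts K" using assms(2)[OF K(1)] by (auto simp: proper_filter_def)
    then show ?thesis using K(1) by auto
  qed
  moreover have "y \<in> elts (UnS C)" if xy: "x \<in> elts (UnS C)" "y \<in> B" "mt x y = x" for x y
  proof -
    obtain F where F: "F \<in> elts C" "x \<in> elts F" using xy(1) by auto
    then have "y \<in> elts F" using assms(2)[OF F(1)] xy(2,3) by (simp add: proper_filter_def)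
    then show ?thesis using F(1) by auto
  qed
  moreover obtain F where "F \<in> elts C" using assms(1) by (auto simp: chain_set_def)
  then have "top_elt A \<in> elts (UnS C)" using assms(2) by (auto simp: proper_filter_def)
  moreover have "elts F \<subseteq> B \<and> bottom A \<notin> elts F" if "F \<in> elts C" for F
    using assms(2)[OF that] by (simp add: proper_filter_def)
  then have "elts (UnS C) \<subseteq> B" "bottom A \<notin> elts (UnS C)" unfolding elts_UnS by blast+
  ultimately show ?thesis unfolding proper_filter_def by simp
qed

text \<open>In place of Zorn's lemma, \<open>fixed_point_exists\<close> is applied to the proper
  filters of \<open>M\<close> under inclusion. The map \<open>ext\<close> adds a chosen undecided
  element, so among these filters its fixed points are exactly the ultrafilters.\<close>

lemma ultra_exists:
  assumes "a \<in> B" "a \<noteq> bottom A"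
  shows "\<exists>u\<in>M. ultra u \<and> a \<in> elts u"
proof -
  obtain ch where ch: "dfnt (\<lambda>\<rho>. ch (\<rho> 0))"
    "\<And>s. s \<in> M \<Longrightarrow> elts s \<subseteq> B \<Longrightarrow> elts s \<noteq> {} \<Longrightarrow> ch s \<in> elts s"
    by (rule choice_function[OF consts_in_M(1)]) blast
  define und where "und F = sepS (univ A) (\<lambda>b. b \<notin> elts F \<and> cp b \<notin> elts F)" for F
  define ext where "ext F = (if \<exists>b\<in>elts (und F). b = b then gen F (ch (und F)) else F)" for F
  define Fil where "Fil = sepS (powM (univ A)) proper_filter"
  \<comment> \<open>The principal filter of \<open>a\<close>, proper since \<open>a\<close> is not
    the bottom element; starting there puts \<open>a\<close> into the ultrafilter.\<close>
  define b where "b = sepS (univ A) (\<lambda>x. mt a x = a)"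
  note cs = dfnt_const[OF M_trans[OF consts_in_M(1) assms(1)]] dfnt_alg_consts
  have und: "und F \<in> M" if "F \<in> M" for F
    unfolding und_def by (intro sepS_in_M consts_in_M dfn_intros dfnt_cp dfnt_const that)
  have dfn_ext: "dfnt (\<lambda>\<rho>. ext (\<rho> 0))"
    unfolding ext_def und_def gen_def
    by (intro dfn_intros dfnt_mt dfnt_cp dfnt_comp1[OF ch(1)] dfnt_alg_consts)
  have FilM: "Fil \<in> M"
    unfolding Fil_def by (intro sepS_in_M powM consts_in_M dfn_proper_filter)
  have Fil: "F \<in> elts Fil \<longleftrightarrow> F \<in> M \<and> proper_filter F" for F
    by (auto simp: Fil_def powM consts_in_M proper_filter_def)
  have ext: "proper_filter (ext F) \<and> elts F \<subseteq> elts (ext F) \<and> (ext F = F \<longrightarrow> ultra F)"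
    if F: "F \<in> M" "proper_filter F" for F
  proof (cases "elts (und F) = {}")
    case True
    then have "ext F = F" "ultra F" using F by (auto simp: ext_def ultra_def und_def)
    then show ?thesis using F by simp
  next
    case False
    then have "ch (und F) \<in> elts (und F)"
      using und[OF F(1)] by (intro ch) (auto simp: und_def)
    then have c: "ch (und F) \<in> B" "ch (und F) \<notin> elts F" "cp (ch (und F)) \<notin> elts F"
      by (auto simp: und_def)
    have "ext F = gen F (ch (und F))" using False by (auto simp: ext_def)
    then show ?thesis using proper_filter_gen[OF F(2) c(1,3)] c(2) by auto
  qed
  have "b \<in> M"
    unfolding b_def by (intro sepS_in_M consts_in_M dfn_intros dfnt_mt cs)
  moreover have "proper_filter b"
    unfolding proper_filter_def
  proof (intro conjI ballI impI)
    show "elts b \<subseteq> B" by (auto simp: b_def)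
    show "top_elt A \<in> elts b" "bottom A \<notin> elts b"
      using assms mt_top[of a] mt_bot[of a] by (auto simp: b_def)
    show "mt x y \<in> elts b" if "x \<in> elts b" "y \<in> elts b" for x y
      using that assms(1) mt_greatest[of a x y] by (simp add: b_def)
    show "y \<in> elts b" if "x \<in> elts b" "y \<in> B" "mt x y = x" for x y
      using that assms(1) le_trans[of a x y] by (simp add: b_def)
  qed
  ultimately have "b \<in> elts Fil" using Fil by blast
  moreover have "ext F \<in> elts Fil \<and> elts F \<subseteq> elts (ext F)" if "F \<in> elts Fil" for F
  proof -
    have "ext F \<in> M" using dfnt_const_in_M[OF dfnt_comp1[OF dfn_ext dfnt_const]] that Fil by blast
    then show ?thesis using ext that Fil by blast
  qed
  moreover have "UnS C \<in> elts Fil" if "C \<in> M" "elts C \<subseteq> elts Fil" "chain_set C" for C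
    using that Fil proper_filter_Union UnS_in_M by blast
  ultimately obtain u where "u \<in> elts Fil" "elts b \<subseteq> elts u" "ext u = u"
    using fixed_point_exists[OF FilM _ dfn_ext] by blast
  moreover have "a \<in> elts b" using assms mt_idem by (simp add: b_def)
  ultimately show ?thesis using Fil ext by blast
qed

text \<open>Sending an element to the set of ultrafilters of \<open>M\<close> containing it is
  injective, because \<open>ultra_exists\<close> separates elements. Finitely many ultrafilters
  would thus leave only finitely many elements.\<close>

lemma ultrafilter_sequence:
  assumes "infinite B"
  obtains x where "dfnt (\<lambda>\<rho>. x (\<rho> 0))" "inj (\<lambda>n. x (num n))" "\<And>n. x (num n) \<in> M \<and> ultra (x (num n))"
proof -
  define S where "S = sepS (powM (univ A)) ultra"
  have SM: "S \<in> M" unfolding S_def by (intro sepS_in_M powM consts_in_M dfn_ultra)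
  have S: "u \<in> elts S \<longleftrightarrow> u \<in> M \<and> ultra u" for u
    by (auto simp: S_def powM consts_in_M ultra_def proper_filter_def)
  have sep: "\<exists>u\<in>elts S. x \<in> elts u \<and> y \<notin> elts u" if xy: "x \<in> B" "y \<in> B" "mt x y \<noteq> x" for x y
  proof -
    have "mt x (cp y) \<noteq> bottom A" using xy mt_cp_eq_bot by blast
    then obtain u where u: "u \<in> M" "ultra u" "mt x (cp y) \<in> elts u"
      using ultra_exists[of "mt x (cp y)"] xy by auto
    then have up: "\<And>p q. p \<in> elts u \<Longrightarrow> q \<in> B \<Longrightarrow> mt p q = p \<Longrightarrow> q \<in> elts u"
      and m: "\<And>p q. p \<in> elts u \<Longrightarrow> q \<in> elts u \<Longrightarrow> mt p q \<in> elts u" and "bottom A \<notin> elts u"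
      by (auto simp: ultra_def proper_filter_def)
    have "x \<in> elts u" "cp y \<in> elts u"
      using up[OF u(3)] mt_le1[of x "cp y"] mt_le2[of x "cp y"] xy by auto
    moreover have "y \<notin> elts u" using m[of y "cp y"] calculation mt_cp xy \<open>bottom A \<notin> elts u\<close> by auto
    ultimately show ?thesis using u S by blast
  qed
  have "inj_on (\<lambda>x. {u \<in> elts S. x \<in> elts u}) B"
  proof (rule inj_onI)
    fix x y assume xy: "x \<in> B" "y \<in> B" "{u \<in> elts S. x \<in> elts u} = {u \<in> elts S. y \<in> elts u}"
    then have "mt x y = x" "mt y x = y" using sep[of x y] sep[of y x] by blast+
    then show "x = y" using mt_comm[of x y] xy by simp
  qed
  then have "infinite ((\<lambda>x. {u \<in> elts S. x \<in> elts u}) ` B)" using assms finite_imageD by blast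
  then have "infinite (elts S)"
    using finite_subset[of "(\<lambda>x. {u \<in> elts S. x \<in> elts u}) ` B" "Pow (elts S)"] by auto
  then obtain x where "dfnt (\<lambda>\<rho>. x (\<rho> 0))" "inj (\<lambda>n. x (num n))" "\<And>n. x (num n) \<in> elts S"
    by (rule infinite_set_sequence[OF SM]) blast
  then show thesis using that S by blast
qed

end


section \<open>Forcing over the ground model structure\<close>

locale generic_model = transitive_model M for M :: "'v::set_universe set" +
  fixes P leq :: 'v and G :: "'v set"
  assumes P_in_M: "P \<in> M" and leq_in_M: "leq \<in> M"
    and forcing: "forcing_notion P leq" and generic: "generic_filter M P leq G"
begin

lemma leq_refl: "p \<in> elts P \<Longrightarrow> opair p p \<in> elts leq"
  using forcing by (auto simp: forcing_notion_def preorder_on_def refl_on_def mem_iff)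

lemma leq_trans: "opair p q \<in> elts leq \<Longrightarrow> opair q r \<in> elts leq \<Longrightarrow> opair p r \<in> elts leq"
  using forcing unfolding forcing_notion_def preorder_on_def trans_def mem_iff by blast

lemma G_subset: "p \<in> G \<Longrightarrow> p \<in> elts P"
  using generic unfolding generic_filter_def filter_on_def by blast

lemma G_nonempty: "\<exists>p. p \<in> G"
  using generic unfolding generic_filter_def filter_on_def by blast

lemma G_upward: "p \<in> G \<Longrightarrow> q \<in> elts P \<Longrightarrow> opair p q \<in> elts leq \<Longrightarrow> q \<in> G"
  using generic unfolding generic_filter_def filter_on_def mem_iff by blast

lemma G_directed: "p \<in> G \<Longrightarrow> q \<in> G \<Longrightarrow> \<exists>r\<in>G. opair r p \<in> elts leq \<and> opair r q \<in> elts leq"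
  using generic unfolding generic_filter_def filter_on_def mem_iff by blast

lemma G_meets_dense: "D \<in> M \<Longrightarrow> dense_in P leq (elts D) \<Longrightarrow> \<exists>p\<in>G. p \<in> elts D"
  using generic unfolding generic_filter_def by blast

lemma G_in_M: "p \<in> G \<Longrightarrow> p \<in> M"
  using G_subset M_trans[OF P_in_M] by blast

text \<open>
  Predicates first-order definable over the structure \<open>(M, \<epsilon>, G)\<close>, with \<open>\<Phi>\<close> playing the role
  of the forcing relation.  As the quantifiers range over \<open>M\<close> only, the truth lemma needs no
  recursion on names, and \<open>fdfn\<close> is closed under all first-order operations.
\<close>

definition fdfn :: "((nat \<Rightarrow> 'v) \<Rightarrow> bool) \<Rightarrow> bool" where
  "fdfn Q \<longleftrightarrow> (\<exists>\<Phi>. dfn (\<lambda>\<rho>. \<Phi> (\<rho> 0) (\<lambda>i. \<rho> (Suc i))) \<and>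
     (\<forall>\<rho>. env \<rho> \<longrightarrow> (Q \<rho> \<longleftrightarrow> (\<exists>p\<in>G. \<Phi> p \<rho>))))"

lemma fdfn_cong: "(\<And>\<rho>. env \<rho> \<Longrightarrow> Q \<rho> \<longleftrightarrow> Q' \<rho>) \<Longrightarrow> fdfn Q \<Longrightarrow> fdfn Q'"
  unfolding fdfn_def by simp

text \<open>The predicate provided by \<open>fdfn\<close> may fail to be hereditary. Letting it hold
  at \<open>p\<close> whenever it holds at some condition above \<open>p\<close> repairs this, and
  truth along \<open>G\<close> is unchanged because \<open>G\<close> is upward closed.\<close>

lemma fdfnE:
  assumes "fdfn Q"
  obtains \<Phi> where "dfn (\<lambda>\<rho>. \<Phi> (\<rho> 0) (\<lambda>i. \<rho> (Suc i)))"
    "\<And>\<rho>. env \<rho> \<Longrightarrow> Q \<rho> \<longleftrightarrow> (\<exists>p\<in>G. \<Phi> p \<rho>)"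
    "\<And>p q \<rho>. \<Phi> q \<rho> \<Longrightarrow> p \<in> elts P \<Longrightarrow> opair p q \<in> elts leq \<Longrightarrow> \<Phi> p \<rho>"
proof -
  obtain \<Phi> where \<Phi>: "dfn (\<lambda>\<rho>. \<Phi> (\<rho> 0) (\<lambda>i. \<rho> (Suc i)))"
    "\<And>\<rho>. env \<rho> \<Longrightarrow> Q \<rho> \<longleftrightarrow> (\<exists>p\<in>G. \<Phi> p \<rho>)"
    using assms unfolding fdfn_def by blast
  define \<Psi> where "\<Psi> p \<rho> \<longleftrightarrow> (\<exists>q\<in>elts P. opair p q \<in> elts leq \<and> \<Phi> q \<rho>)" for p \<rho>
  have "dfn (\<lambda>\<rho>. \<Phi> (\<rho> 0) (\<lambda>i. \<rho> (Suc (Suc i))))"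
    using dfn_rename[OF \<Phi>(1), of "case_nat 0 (\<lambda>i. Suc (Suc i))"] by simp
  then have "dfn (\<lambda>\<rho>. \<Psi> (\<rho> 0) (\<lambda>i. \<rho> (Suc i)))"
    unfolding \<Psi>_def by (intro dfn_intros dfnt_const P_in_M leq_in_M)
  moreover have "Q \<rho> \<longleftrightarrow> (\<exists>p\<in>G. \<Psi> p \<rho>)" if "env \<rho>" for \<rho>
    unfolding \<Psi>_def using \<Phi>(2)[OF that] G_subset G_upward leq_refl by meson
  moreover have "\<Psi> p \<rho>" if "\<Psi> q \<rho>" "p \<in> elts P" "opair p q \<in> elts leq" for p q \<rho>
    using that leq_trans unfolding \<Psi>_def by blast
  ultimately show thesis by (rule that)
qed

lemma fdfn_of_dfn:
  assumes "dfn Q"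
  shows "fdfn Q"
  unfolding fdfn_def
proof (intro exI conjI)
  show "dfn (\<lambda>\<rho>. Q (\<lambda>i. \<rho> (Suc i)))" using dfn_weaken[OF assms] .
qed (use G_nonempty in blast)

text \<open>A condition for the negation has no extension satisfying \<open>\<Phi>\<close>. The
  conditions that settle the matter either way are dense and, \<open>\<Phi>\<close> being definable,
  form a set of \<open>M\<close>, so \<open>G\<close> meets them; directedness of \<open>G\<close>
  excludes both answers at once.\<close>

lemma fdfn_neg:
  assumes "fdfn Q"
  shows "fdfn (\<lambda>\<rho>. \<not> Q \<rho>)"
proof -
  obtain \<Phi> where \<Phi>: "dfn (\<lambda>\<rho>. \<Phi> (\<rho> 0) (\<lambda>i. \<rho> (Suc i)))"
    "\<And>\<rho>. env \<rho> \<Longrightarrow> Q \<rho> \<longleftrightarrow> (\<exists>p\<in>G. \<Phi> p \<rho>)"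
    "\<And>p q \<rho>. \<Phi> q \<rho> \<Longrightarrow> p \<in> elts P \<Longrightarrow> opair p q \<in> elts leq \<Longrightarrow> \<Phi> p \<rho>"
    using fdfnE[OF assms] by blast
  define \<Psi> where "\<Psi> p \<rho> \<longleftrightarrow> (\<forall>q\<in>elts P. opair q p \<in> elts leq \<longrightarrow> \<not> \<Phi> q \<rho>)" for p \<rho>
  have "dfn (\<lambda>\<rho>. \<Phi> (\<rho> 0) (\<lambda>i. \<rho> (Suc (Suc i))))"
    using dfn_rename[OF \<Phi>(1), of "case_nat 0 (\<lambda>i. Suc (Suc i))"] by simp
  then have dfn_\<Psi>: "dfn (\<lambda>\<rho>. \<Psi> (\<rho> 0) (\<lambda>i. \<rho> (Suc i)))"
    unfolding \<Psi>_def by (intro dfn_intros dfnt_const P_in_M leq_in_M)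
  have "\<not> Q \<rho> \<longleftrightarrow> (\<exists>p\<in>G. \<Psi> p \<rho>)" if \<rho>: "env \<rho>" for \<rho>
  proof
    assume "\<not> Q \<rho>"
    let ?D = "sepS P (\<lambda>p. \<Phi> p \<rho> \<or> \<Psi> p \<rho>)"
    have "?D \<in> M"
      by (rule sepS_in_M_env[OF _ \<rho> P_in_M]) (intro dfn_disj \<Phi>(1) dfn_\<Psi>)
    moreover have "dense_in P leq (elts ?D)"
      unfolding dense_in_def
    proof (intro conjI ballI)
      fix p assume p: "p \<in> elts P"
      show "\<exists>d\<in>elts ?D. opair d p \<epsilon> leq"
      proof (cases "\<Psi> p \<rho>")
        case True
        then show ?thesis using p leq_refl[OF p] by (intro bexI[of _ p]) (auto simp: mem_iff)
      next
        case False
        then obtain q where "q \<in> elts P" "opair q p \<in> elts leq" "\<Phi> q \<rho>"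
          unfolding \<Psi>_def by blast
        then show ?thesis by (intro bexI[of _ q]) (auto simp: mem_iff)
      qed
    qed auto
    ultimately obtain p where "p \<in> G" "\<Phi> p \<rho> \<or> \<Psi> p \<rho>" using G_meets_dense by fastforce
    then show "\<exists>p\<in>G. \<Psi> p \<rho>" using \<Phi>(2)[OF \<rho>] \<open>\<not> Q \<rho>\<close> by blast
  next
    assume "\<exists>p\<in>G. \<Psi> p \<rho>"
    then obtain p where p: "p \<in> G" "\<Psi> p \<rho>" by blast
    show "\<not> Q \<rho>"
    proof
      assume "Q \<rho>"
      then obtain q where q: "q \<in> G" "\<Phi> q \<rho>" using \<Phi>(2)[OF \<rho>] by blast
      obtain r where "r \<in> G" "opair r p \<in> elts leq" "opair r q \<in> elts leq"
        using G_directed[OF p(1) q(1)] by blast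
      then show False using p(2) \<Phi>(3)[OF q(2)] G_subset unfolding \<Psi>_def by blast
    qed
  qed
  then show ?thesis unfolding fdfn_def using dfn_\<Psi> by blast
qed

lemma fdfn_conj:
  assumes "fdfn Q" "fdfn R"
  shows "fdfn (\<lambda>\<rho>. Q \<rho> \<and> R \<rho>)"
proof -
  obtain \<Phi> where \<Phi>: "dfn (\<lambda>\<rho>. \<Phi> (\<rho> 0) (\<lambda>i. \<rho> (Suc i)))"
    "\<And>\<rho>. env \<rho> \<Longrightarrow> Q \<rho> \<longleftrightarrow> (\<exists>p\<in>G. \<Phi> p \<rho>)"
    "\<And>p q \<rho>. \<Phi> q \<rho> \<Longrightarrow> p \<in> elts P \<Longrightarrow> opair p q \<in> elts leq \<Longrightarrow> \<Phi> p \<rho>"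
    using fdfnE[OF assms(1)] by blast
  obtain \<Psi> where \<Psi>: "dfn (\<lambda>\<rho>. \<Psi> (\<rho> 0) (\<lambda>i. \<rho> (Suc i)))"
    "\<And>\<rho>. env \<rho> \<Longrightarrow> R \<rho> \<longleftrightarrow> (\<exists>p\<in>G. \<Psi> p \<rho>)"
    "\<And>p q \<rho>. \<Psi> q \<rho> \<Longrightarrow> p \<in> elts P \<Longrightarrow> opair p q \<in> elts leq \<Longrightarrow> \<Psi> p \<rho>"
    using fdfnE[OF assms(2)] by blast
  have "Q \<rho> \<and> R \<rho> \<longleftrightarrow> (\<exists>p\<in>G. \<Phi> p \<rho> \<and> \<Psi> p \<rho>)" if \<rho>: "env \<rho>" for \<rho>
  proof
    assume "Q \<rho> \<and> R \<rho>"
    then obtain p q where pq: "p \<in> G" "\<Phi> p \<rho>" "q \<in> G" "\<Psi> q \<rho>"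
      using \<Phi>(2)[OF \<rho>] \<Psi>(2)[OF \<rho>] by blast
    obtain r where "r \<in> G" "opair r p \<in> elts leq" "opair r q \<in> elts leq"
      using G_directed[OF pq(1,3)] by blast
    then show "\<exists>p\<in>G. \<Phi> p \<rho> \<and> \<Psi> p \<rho>" using \<Phi>(3)[OF pq(2)] \<Psi>(3)[OF pq(4)] G_subset by blast
  qed (use \<Phi>(2)[OF \<rho>] \<Psi>(2)[OF \<rho>] in blast)
  then show ?thesis unfolding fdfn_def
    by (intro exI[of _ "\<lambda>p \<rho>. \<Phi> p \<rho> \<and> \<Psi> p \<rho>"] conjI dfn_conj \<Phi>(1) \<Psi>(1)) blast
qed

lemma fdfn_exM:
  assumes "fdfn (\<lambda>\<rho>. Q (\<rho> 0) (\<lambda>i. \<rho> (Suc i)))"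
  shows "fdfn (\<lambda>\<rho>. \<exists>x\<in>M. Q x \<rho>)"
proof -
  obtain \<Phi> where \<Phi>: "dfn (\<lambda>\<rho>. \<Phi> (\<rho> 0) (\<lambda>i. \<rho> (Suc i)))"
    "\<And>\<rho>. env \<rho> \<Longrightarrow> Q (\<rho> 0) (\<lambda>i. \<rho> (Suc i)) \<longleftrightarrow> (\<exists>p\<in>G. \<Phi> p \<rho>)"
    using assms unfolding fdfn_def by blast
  \<comment> \<open>\<open>dfn_exM\<close> expects the quantified element at index 0, where the
    forcing predicate has its condition; \<open>?f\<close> exchanges the two.\<close>
  let ?f = "case_nat (Suc 0) (case_nat 0 (\<lambda>i. Suc (Suc i)))"
  have "(\<lambda>i. \<sigma> (?f (Suc i))) = case_nat (\<sigma> 0) (\<lambda>i. \<sigma> (Suc (Suc i)))" for \<sigma> :: "nat \<Rightarrow> 'v"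
    by (rule ext) (simp split: nat.split)
  then have "dfn (\<lambda>\<rho>. \<Phi> (\<rho> (Suc 0)) (case_nat (\<rho> 0) (\<lambda>i. \<rho> (Suc (Suc i)))))"
    using dfn_rename[OF \<Phi>(1), of ?f] by simp
  then have "dfn (\<lambda>\<rho>. \<exists>x\<in>M. \<Phi> (\<rho> 0) (case_nat x (\<lambda>i. \<rho> (Suc i))))"
    by (rule dfn_exM)
  moreover have "(\<exists>x\<in>M. Q x \<rho>) \<longleftrightarrow> (\<exists>p\<in>G. \<exists>x\<in>M. \<Phi> p (case_nat x \<rho>))" if "env \<rho>" for \<rho>
  proof -
    have "Q x \<rho> \<longleftrightarrow> (\<exists>p\<in>G. \<Phi> p (case_nat x \<rho>))" if "x \<in> M" for x
      using \<Phi>(2)[OF env_case_nat[OF that \<open>env \<rho>\<close>]] by simp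
    then show ?thesis by blast
  qed
  ultimately show ?thesis
    unfolding fdfn_def by (intro exI[of _ "\<lambda>p \<rho>. \<exists>x\<in>M. \<Phi> p (case_nat x \<rho>)"]) simp
qed

text \<open>As \<open>G\<close> is upward closed, membership is witnessed by any condition of
  \<open>G\<close> below \<open>f \<rho>\<close>.\<close>

lemma fdfn_in_G:
  assumes "dfnt f"
  shows "fdfn (\<lambda>\<rho>. f \<rho> \<in> G)"
  unfolding fdfn_def
proof (intro exI conjI allI impI)
  show "dfn (\<lambda>\<rho>. f (\<lambda>i. \<rho> (Suc i)) \<in> elts P \<and> opair (\<rho> 0) (f (\<lambda>i. \<rho> (Suc i))) \<in> elts leq)"
    by (intro dfn_intros dfnt_weaken[OF assms] dfnt_const P_in_M leq_in_M)
  show "f \<rho> \<in> G \<longleftrightarrow> (\<exists>p\<in>G. f \<rho> \<in> elts P \<and> opair p (f \<rho>) \<in> elts leq)" for \<rho>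
    using G_subset G_upward leq_refl by blast
qed

lemma fdfn_disj: "fdfn Q \<Longrightarrow> fdfn R \<Longrightarrow> fdfn (\<lambda>\<rho>. Q \<rho> \<or> R \<rho>)"
  using fdfn_neg[OF fdfn_conj[OF fdfn_neg fdfn_neg], of Q R] by simp

lemma fdfn_imp: "fdfn Q \<Longrightarrow> fdfn R \<Longrightarrow> fdfn (\<lambda>\<rho>. Q \<rho> \<longrightarrow> R \<rho>)"
  unfolding imp_conv_disj by (intro fdfn_disj fdfn_neg)

lemma fdfn_eq: "dfnt f \<Longrightarrow> dfnt g \<Longrightarrow> fdfn (\<lambda>\<rho>. f \<rho> = g \<rho>)"
  by (rule fdfn_of_dfn) (rule dfn_eq)

lemma fdfn_mem: "dfnt f \<Longrightarrow> dfnt g \<Longrightarrow> fdfn (\<lambda>\<rho>. f \<rho> \<in> elts (g \<rho>))"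
  by (rule fdfn_of_dfn) (rule dfn_mem)

lemma fdfn_bex:
  assumes "dfnt X" "fdfn (\<lambda>\<rho>. Q (\<rho> 0) (\<lambda>i. \<rho> (Suc i)))"
  shows "fdfn (\<lambda>\<rho>. \<exists>x\<in>elts (X \<rho>). Q x \<rho>)"
proof (rule fdfn_cong)
  show "fdfn (\<lambda>\<rho>. \<exists>x\<in>M. x \<in> elts (X \<rho>) \<and> Q x \<rho>)"
    by (intro fdfn_exM fdfn_conj fdfn_mem dfnt_var dfnt_weaken assms)
qed (use assms(1) M_trans in \<open>auto simp: dfnt_def\<close>)

lemma fdfn_ball:
  assumes "dfnt X" "fdfn (\<lambda>\<rho>. Q (\<rho> 0) (\<lambda>i. \<rho> (Suc i)))"
  shows "fdfn (\<lambda>\<rho>. \<forall>x\<in>elts (X \<rho>). Q x \<rho>)"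
  using fdfn_neg[OF fdfn_bex[OF assms(1) fdfn_neg[OF assms(2)]]] by simp

lemma fdfn_bexG:
  assumes "fdfn (\<lambda>\<rho>. Q (\<rho> 0) (\<lambda>i. \<rho> (Suc i)))"
  shows "fdfn (\<lambda>\<rho>. \<exists>p\<in>G. Q p \<rho>)"
proof (rule fdfn_cong)
  show "fdfn (\<lambda>\<rho>. \<exists>x\<in>M. x \<in> G \<and> Q x \<rho>)"
    by (intro fdfn_exM fdfn_conj fdfn_in_G dfnt_var assms)
qed (use G_in_M in blast)

lemma fdfn_ballG:
  assumes "fdfn (\<lambda>\<rho>. Q (\<rho> 0) (\<lambda>i. \<rho> (Suc i)))"
  shows "fdfn (\<lambda>\<rho>. \<forall>p\<in>G. Q p \<rho>)"
  using fdfn_neg[OF fdfn_bexG[OF fdfn_neg[OF assms]]] by simp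

lemma fdfn_comp1:
  assumes "fdfn (\<lambda>\<rho>. R (\<rho> 0))" "dfnt f"
  shows "fdfn (\<lambda>\<rho>. R (f \<rho>))"
proof (rule fdfn_cong)
  show "fdfn (\<lambda>\<rho>. \<exists>x\<in>M. x = f \<rho> \<and> R x)"
    by (intro fdfn_exM fdfn_conj fdfn_eq dfnt_var dfnt_weaken assms)
qed (use assms(2) in \<open>auto simp: dfnt_def\<close>)

lemmas fdfn_intros = fdfn_neg fdfn_conj fdfn_disj fdfn_imp fdfn_exM fdfn_in_G fdfn_eq fdfn_mem
  fdfn_bex fdfn_ball fdfn_bexG fdfn_ballG dfnt_opair dfnt_var

text \<open>Filling the whole assignment with \<open>x\<close> turns the forcing predicate into a
  relation between a condition and a set, definable at any two positions. This is the shape used to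
  build names with \<open>sepS\<close> and \<open>replS\<close>.\<close>

lemma fdfn_unary:
  assumes "fdfn (\<lambda>\<rho>. Q (\<rho> 0))"
  obtains \<Phi> where "\<And>m n. dfn (\<lambda>\<rho>. \<Phi> (\<rho> m) (\<rho> n))"
    "\<And>x. x \<in> M \<Longrightarrow> Q x \<longleftrightarrow> (\<exists>p\<in>G. \<Phi> p x)"
proof -
  obtain \<Phi> where \<Phi>: "dfn (\<lambda>\<rho>. \<Phi> (\<rho> 0) (\<lambda>i. \<rho> (Suc i)))"
    "\<And>\<rho>. env \<rho> \<Longrightarrow> Q (\<rho> 0) \<longleftrightarrow> (\<exists>p\<in>G. \<Phi> p \<rho>)"
    using assms unfolding fdfn_def by blast
  show thesis
  proof (rule that[of "\<lambda>p x. \<Phi> p (\<lambda>_. x)"])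
    show "dfn (\<lambda>\<rho>. \<Phi> (\<rho> m) (\<lambda>_. \<rho> n))" for m n
      using dfn_rename[OF \<Phi>(1), of "case_nat m (\<lambda>_. n)"] by simp
    show "Q x \<longleftrightarrow> (\<exists>p\<in>G. \<Phi> p (\<lambda>_. x))" if "x \<in> M" for x
      using \<Phi>(2)[of "\<lambda>_. x"] that by (simp add: env_def)
  qed
qed

lemma fdfn_binary:
  assumes "fdfn (\<lambda>\<rho>. Q (\<rho> 0) (\<rho> (Suc 0)))"
  obtains \<Phi> where "\<And>l m n. dfn (\<lambda>\<rho>. \<Phi> (\<rho> l) (\<rho> m) (\<rho> n))"
    "\<And>x y. x \<in> M \<Longrightarrow> y \<in> M \<Longrightarrow> Q x y \<longleftrightarrow> (\<exists>p\<in>G. \<Phi> p x y)"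
proof -
  obtain \<Phi> where \<Phi>: "dfn (\<lambda>\<rho>. \<Phi> (\<rho> 0) (\<lambda>i. \<rho> (Suc i)))"
    "\<And>\<rho>. env \<rho> \<Longrightarrow> Q (\<rho> 0) (\<rho> (Suc 0)) \<longleftrightarrow> (\<exists>p\<in>G. \<Phi> p \<rho>)"
    using assms unfolding fdfn_def by blast
  show thesis
  proof (rule that[of "\<lambda>p x y. \<Phi> p (case_nat x (\<lambda>_. y))"])
    have "(\<lambda>i. \<rho> (case_nat m (\<lambda>_. n) i)) = case_nat (\<rho> m) (\<lambda>_. \<rho> n)" for \<rho> :: "nat \<Rightarrow> 'v" and m n
      by (rule ext) (simp split: nat.split)
    then show "dfn (\<lambda>\<rho>. \<Phi> (\<rho> l) (case_nat (\<rho> m) (\<lambda>_. \<rho> n)))" for l m n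
      using dfn_rename[OF \<Phi>(1), of "case_nat l (case_nat m (\<lambda>_. n))"] by simp
    show "Q x y \<longleftrightarrow> (\<exists>p\<in>G. \<Phi> p (case_nat x (\<lambda>_. y)))" if "x \<in> M" "y \<in> M" for x y
      using \<Phi>(2)[of "case_nat x (\<lambda>_. y)"] that by (simp add: env_def split: nat.split)
  qed
qed


section \<open>Names\<close>

abbreviation "N \<equiv> generic_extension M P G"

lemma mem_val: "y \<in> elts (val G \<tau>) \<longleftrightarrow> (\<exists>r. \<exists>q\<in>G. opair r q \<in> elts \<tau> \<and> val G r = y)"
  unfolding elts_val mem_iff by auto

lemma val_in_N: "\<tau> \<in> M \<Longrightarrow> is_name P \<tau> \<Longrightarrow> val G \<tau> \<in> N"
  unfolding generic_extension_def by blast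

text \<open>The canonical name of a set of \<open>M\<close>. As there may be no greatest condition,
  each element is paired with every condition, and \<open>G\<close> contains at least one.\<close>

definition check :: "'v \<Rightarrow> 'v" where
  "check = recS (\<lambda>x g. prodS g P)"

lemma elts_check: "elts (check x) = {opair (check y) p | y p. y \<in> elts x \<and> p \<in> elts P}"
  unfolding check_def by (subst recS_unfold) auto

lemma dfnt_check: "dfnt f \<Longrightarrow> dfnt (\<lambda>\<rho>. check (f \<rho>))"
  unfolding check_def by (intro dfnt_recS dfnt_prodS dfnt_var dfnt_const P_in_M)

lemma is_name_check: "is_name P (check x)"
proof (induction x rule: mem_induct)
  case (step x)
  show ?case
    by (rule is_name.intros) (use step in \<open>auto simp: mem_iff elts_check\<close>)
qed

lemma val_check: "val G (check x) = x"
proof (induction x rule: mem_induct)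
  case (step x)
  have "elts (val G (check x)) = {val G (check y) | y. y \<in> elts x}"
    unfolding elts_val mem_iff elts_check using G_nonempty G_subset by auto
  also have "\<dots> = elts x" using step by force
  finally show ?case by (rule elts_inject)
qed

lemma M_subset_N: "x \<in> M \<Longrightarrow> x \<in> N"
  using val_in_N[OF _ is_name_check, of x] dfnt_const_in_M[OF dfnt_check[OF dfnt_const]] val_check
  by simp

text \<open>The name pairs \<open>g x\<close> with the conditions at which the forcing predicate for
  \<open>Q x\<close> holds; definability of that predicate puts the name into
  \<open>M\<close>.\<close>

lemma family_in_N:
  assumes "X \<in> M" "fdfn (\<lambda>\<rho>. Q (\<rho> 0))" "dfnt (\<lambda>\<rho>. g (\<rho> 0))"
    and name: "\<And>x. x \<in> elts X \<Longrightarrow> is_name P (g x)"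
  shows "\<exists>s\<in>N. elts s = {val G (g x) | x. x \<in> elts X \<and> Q x}"
proof -
  obtain \<Phi> where \<Phi>: "\<And>m n. dfn (\<lambda>\<rho>. \<Phi> (\<rho> m) (\<rho> n))"
    "\<And>x. x \<in> M \<Longrightarrow> Q x \<longleftrightarrow> (\<exists>p\<in>G. \<Phi> p x)"
    using fdfn_unary[OF assms(2)] by blast
  define \<tau> where "\<tau> = UnS (replS X (\<lambda>x. replS (sepS P (\<lambda>p. \<Phi> p x)) (\<lambda>p. opair (g x) p)))"
  have \<tau>: "elts \<tau> = {opair (g x) p | x p. x \<in> elts X \<and> p \<in> elts P \<and> \<Phi> p x}"
    unfolding \<tau>_def by auto
  have "dfnt (\<lambda>\<rho>. \<tau>)"
    unfolding \<tau>_def by (intro dfn_intros dfnt_const assms(1) P_in_M \<Phi>(1) dfnt_comp1[OF assms(3)])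
  then have "\<tau> \<in> M" by (rule dfnt_const_in_M)
  moreover have "is_name P \<tau>"
    by (rule is_name.intros) (use name in \<open>auto simp: mem_iff \<tau>\<close>)
  moreover have "elts (val G \<tau>) = {val G (g x) | x. x \<in> elts X \<and> Q x}"
  proof -
    have 1: "opair \<sigma> p \<in> elts \<tau> \<longleftrightarrow> (\<exists>x\<in>elts X. \<sigma> = g x \<and> \<Phi> p x)" if "p \<in> G" for \<sigma> p
      unfolding \<tau> using G_subset[OF that] by auto
    have 2: "Q x \<longleftrightarrow> (\<exists>p\<in>G. \<Phi> p x)" if "x \<in> elts X" for x
      using \<Phi>(2)[OF M_trans[OF assms(1) that]] .
    have "(\<exists>p\<in>G. opair \<sigma> p \<in> elts \<tau>) \<longleftrightarrow> (\<exists>x. x \<in> elts X \<and> Q x \<and> \<sigma> = g x)" for \<sigma>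
      by (simp add: 1 cong: bex_cong) (use 2 in blast)
    then show ?thesis unfolding elts_val mem_iff by auto
  qed
  ultimately show ?thesis using val_in_N by blast
qed

lemma subset_in_N:
  assumes "X \<in> M" "fdfn (\<lambda>\<rho>. Q (\<rho> 0))"
  shows "\<exists>s\<in>N. elts s = {x \<in> elts X. Q x}"
  using family_in_N[OF assms dfnt_check[OF dfnt_var] is_name_check] by (simp add: val_check)

section \<open>Membership in the value of a name\<close>

definition tc :: "'v \<Rightarrow> 'v" where
  "tc = recS (\<lambda>x g. UnS (set_of {x, UnS g}))"

lemma elts_tc: "elts (tc x) = elts x \<union> (\<Union>y\<in>elts x. elts (tc y))"
  unfolding tc_def by (subst recS_unfold) auto

lemma dfnt_tc: "dfnt f \<Longrightarrow> dfnt (\<lambda>\<rho>. tc (f \<rho>))"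
  unfolding tc_def by (intro dfnt_recS dfn_intros)

lemma tc_transitive: "y \<in> elts (tc x) \<Longrightarrow> elts y \<subseteq> elts (tc x)"
proof (induction x rule: mem_induct)
  case (step x)
  then consider "y \<in> elts x" | z where "z \<in> elts x" "y \<in> elts (tc z)"
    unfolding elts_tc[of x] by blast
  then show ?case
  proof cases
    case 1
    then show ?thesis using elts_tc[of x] elts_tc[of y] by blast
  next
    case 2
    then show ?thesis using step.IH elts_tc[of x] by blast
  qed
qed

lemma opair_tc:
  assumes "opair r q \<in> elts \<sigma>" "elts \<sigma> \<subseteq> elts (tc \<tau>)"
  shows "r \<in> elts (tc \<tau>)"
proof -
  have "set_of {r} \<in> elts (opair r q)" by (simp add: opair_def)
  then have "set_of {r} \<in> elts (tc \<tau>)" using assms tc_transitive by blast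
  from tc_transitive[OF this] show ?thesis by simp
qed

text \<open>For \<open>x\<close> in \<open>M\<close>, the set \<open>T x\<close> in \<open>M\<close>
  consists of pairs of a name and a condition; by \<open>key\<close>, a name occurs there with a
  condition of \<open>G\<close> exactly if its value is \<open>x\<close>. Recursion on
  \<open>x\<close> works because \<open>val G \<sigma> = x\<close> reduces to equalities of values
  with elements of \<open>x\<close>.\<close>

lemma fdfn_mem_val:
  assumes \<tau>: "\<tau> \<in> M" and f: "dfnt f"
  shows "fdfn (\<lambda>\<rho>. f \<rho> \<in> elts (val G \<tau>))"
proof (rule fdfn_comp1[OF _ f])
  \<comment> \<open>All names occurring inside \<open>\<tau>\<close> lie in this one transitive set
    of \<open>M\<close>, which bounds the quantifiers over names and makes each \<open>T x\<close> a
    set.\<close>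
  define D where "D = tc \<tau>"
  have DM: "D \<in> M" unfolding D_def by (rule dfnt_const_in_M) (intro dfnt_tc dfnt_const \<tau>)
  \<comment> \<open>\<open>g\<close> stands for the set of all \<open>T y\<close> with
    \<open>y\<close> in \<open>x\<close>. Each \<open>y\<close> is represented by
    \<open>T y\<close>: that \<open>r\<close> occurs in it with a condition of \<open>G\<close>
    means \<open>val G r = y\<close>.\<close>
  define Q where "Q \<sigma> g \<longleftrightarrow>
    (\<forall>r\<in>elts D. \<forall>q\<in>G. opair r q \<in> elts \<sigma> \<longrightarrow> (\<exists>t\<in>elts g. \<exists>p\<in>G. opair r p \<in> elts t)) \<and>
    (\<forall>t\<in>elts g. \<exists>r\<in>elts D. \<exists>q\<in>G. opair r q \<in> elts \<sigma> \<and> (\<exists>p\<in>G. opair r p \<in> elts t))" for \<sigma> g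
  have "fdfn (\<lambda>\<rho>. Q (\<rho> 0) (\<rho> (Suc 0)))"
    unfolding Q_def by (intro fdfn_intros dfnt_const DM)
  then obtain \<Phi> where \<Phi>: "\<And>l m n. dfn (\<lambda>\<rho>. \<Phi> (\<rho> l) (\<rho> m) (\<rho> n))"
    "\<And>x y. x \<in> M \<Longrightarrow> y \<in> M \<Longrightarrow> Q x y \<longleftrightarrow> (\<exists>p\<in>G. \<Phi> p x y)"
    by (rule fdfn_binary) blast
  define H where "H = (\<lambda>(x::'v) g.
    UnS (replS D (\<lambda>\<sigma>. replS (sepS P (\<lambda>p. \<Phi> p \<sigma> g)) (\<lambda>p. opair \<sigma> p))))"
  have "dfnt (\<lambda>\<rho>. H (\<rho> 0) (\<rho> (Suc 0)))"
    unfolding H_def by (intro dfn_intros dfnt_const DM P_in_M \<Phi>(1))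
  note dfn_T = dfnt_recS[OF this]
  define T where "T = recS H"
  have T: "opair \<sigma> p \<in> elts (T x) \<longleftrightarrow> \<sigma> \<in> elts D \<and> p \<in> elts P \<and> \<Phi> p \<sigma> (replS x T)" for \<sigma> p x
    unfolding T_def by (subst recS_unfold) (auto simp: H_def)
  have key: "(\<exists>p\<in>G. opair \<sigma> p \<in> elts (T x)) \<longleftrightarrow> val G \<sigma> = x" if "x \<in> M" "\<sigma> \<in> elts D" for x \<sigma>
    using that
  proof (induction x arbitrary: \<sigma> rule: mem_induct)
    case (step x)
    have IH: "(\<exists>p\<in>G. opair r p \<in> elts (T y)) \<longleftrightarrow> val G r = y" if "y \<in> elts x" "r \<in> elts D" for y r
      using step.IH[OF that(1)] M_trans[OF step.prems(1) that(1)] that(2) by blast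
    have gM: "replS x T \<in> M"
      unfolding T_def by (intro replS_in_M step.prems dfn_T dfnt_var)
    have \<sigma>M: "\<sigma> \<in> M" using M_trans[OF DM step.prems(2)] .
    have D: "r \<in> elts D" if "opair r q \<in> elts \<sigma>" for r q
      using opair_tc[OF that] tc_transitive step.prems(2) unfolding D_def by blast
    have "(\<exists>p\<in>G. opair \<sigma> p \<in> elts (T x)) \<longleftrightarrow> (\<exists>p\<in>G. \<Phi> p \<sigma> (replS x T))"
      using T step.prems(2) G_subset by blast
    also have "\<dots> \<longleftrightarrow> Q \<sigma> (replS x T)" using \<Phi>(2)[OF \<sigma>M gM] by simp
    also have "\<dots> \<longleftrightarrow>
        (\<forall>r\<in>elts D. \<forall>q\<in>G. opair r q \<in> elts \<sigma> \<longrightarrow> (\<exists>y\<in>elts x. val G r = y)) \<and>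
        (\<forall>y\<in>elts x. \<exists>r\<in>elts D. \<exists>q\<in>G. opair r q \<in> elts \<sigma> \<and> val G r = y)"
      unfolding Q_def elts_replS ball_simps bex_simps using IH by (simp cong: ball_cong bex_cong)
    also have "\<dots> \<longleftrightarrow> elts (val G \<sigma>) = elts x"
      unfolding set_eq_iff mem_val using D by blast
    also have "\<dots> \<longleftrightarrow> val G \<sigma> = x" using elts_inject by blast
    finally show ?case .
  qed
  show "fdfn (\<lambda>\<rho>. \<rho> 0 \<in> elts (val G \<tau>))"
  proof (rule fdfn_cong)
    show "fdfn (\<lambda>\<rho>. \<exists>\<sigma>\<in>elts D. \<exists>q\<in>G. opair \<sigma> q \<in> elts \<tau> \<and> (\<exists>p\<in>G. opair \<sigma> p \<in> elts (T (\<rho> 0))))"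
      unfolding T_def by (intro fdfn_intros dfn_T dfnt_const DM \<tau>)
    fix \<rho> assume "env \<rho>"
    then have "\<rho> 0 \<in> M" by (rule env_in_M)
    then have "(\<exists>\<sigma>\<in>elts D. \<exists>q\<in>G. opair \<sigma> q \<in> elts \<tau> \<and> (\<exists>p\<in>G. opair \<sigma> p \<in> elts (T (\<rho> 0)))) \<longleftrightarrow>
        (\<exists>\<sigma>\<in>elts D. \<exists>q\<in>G. opair \<sigma> q \<in> elts \<tau> \<and> val G \<sigma> = \<rho> 0)"
      using key by (simp cong: bex_cong)
    also have "\<dots> \<longleftrightarrow> \<rho> 0 \<in> elts (val G \<tau>)"
      unfolding mem_val D_def using opair_tc[of _ _ \<tau> \<tau>] elts_tc[of \<tau>] by blast
    finally show "(\<exists>\<sigma>\<in>elts D. \<exists>q\<in>G. opair \<sigma> q \<in> elts \<tau> \<and> (\<exists>p\<in>G. opair \<sigma> p \<in> elts (T (\<rho> 0)))) \<longleftrightarrow>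
        \<rho> 0 \<in> elts (val G \<tau>)" .
  qed
qed

end


section \<open>The Stone space in the extension\<close>

text \<open>
  Characterises the increasing enumeration of \<open>K\<close> by its finite approximations, which lie in
  the ground model, so that the enumeration is definable over \<open>(M, \<epsilon>, G)\<close>.
\<close>

lemma enumerate_approx:
  fixes K :: "nat set"
  assumes "infinite K"
    and F: "\<And>j m. F j m \<Longrightarrow> m \<in> K \<and> (\<forall>i<j. \<exists>m'<m. F i m') \<and> (\<forall>m'<m. m' \<in> K \<longrightarrow> (\<exists>i<j. F i m'))"
    and "F j m"
  shows "m = enumerate K j"
  using assms(3)
proof (induction j arbitrary: m rule: less_induct)
  case (less j)
  note Fm = F[OF less.prems]
  obtain j' where j': "m = enumerate K j'"
    using Fm enumerate_Ex[OF assms(1)] by metis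
  consider "j' < j" | "j' = j" | "j < j'" by linarith
  then show ?case
  proof cases
    case 1
    then obtain m' where "m' < m" "F j' m'" using Fm by blast
    then show ?thesis using less.IH[OF 1] j' by simp
  next
    case 3
    then have "enumerate K j < m" using assms(1) j' by (simp add: enumerate_mono)
    then obtain i where "i < j" "F i (enumerate K j)"
      using Fm enumerate_in_set[OF assms(1)] by blast
    then have "enumerate K j = enumerate K i" using less.IH by blast
    then show ?thesis using enumerate_mono[OF \<open>i < j\<close> assms(1)] by simp
  qed (simp add: j')
qed

lemma (in model_algebra) ultra_simps:
  assumes "ultra u"
  shows ultra_subset: "a \<in> elts u \<Longrightarrow> a \<in> B"
    and ultra_mt: "a \<in> elts u \<Longrightarrow> b \<in> elts u \<Longrightarrow> mt a b \<in> elts u"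
    and ultra_up: "a \<in> elts u \<Longrightarrow> b \<in> B \<Longrightarrow> mt a b = a \<Longrightarrow> b \<in> elts u"
    and ultra_top: "top_elt A \<in> elts u" and ultra_bot: "bottom A \<notin> elts u"
    and ultra_cp: "a \<in> B \<Longrightarrow> cp a \<in> elts u \<longleftrightarrow> a \<notin> elts u"
proof -
  show *: "a \<in> elts u \<Longrightarrow> b \<in> elts u \<Longrightarrow> mt a b \<in> elts u" "bottom A \<notin> elts u" for a b
    using assms by (simp_all add: ultra_def proper_filter_def)
  show "a \<in> B \<Longrightarrow> cp a \<in> elts u \<longleftrightarrow> a \<notin> elts u"
    using *(1)[of a "cp a"] *(2) mt_cp[of a] assms by (auto simp: ultra_def)
qed (use assms in \<open>auto simp: ultra_def proper_filter_def\<close>)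

text \<open>Written as a condition on \<open>R\<close>, the property is accessible to
  \<open>fdfn_intros\<close> when \<open>R\<close> mentions \<open>G\<close>, even though the set
  itself may lie outside \<open>M\<close>.\<close>

lemma (in model_algebra) ultra_sepS:
  "ultra (sepS (univ A) R) \<longleftrightarrow> R (top_elt A) \<and> \<not> R (bottom A) \<and>
     (\<forall>x\<in>B. \<forall>y\<in>B. R x \<and> R y \<longrightarrow> R (mt x y)) \<and>
     (\<forall>x\<in>B. \<forall>y\<in>B. R x \<and> mt x y = x \<longrightarrow> R y) \<and> (\<forall>x\<in>B. R x \<or> R (cp x))"
proof -
  have "(\<forall>x\<in>{z \<in> B. R z}. \<forall>y\<in>{z \<in> B. R z}. mt x y \<in> {z \<in> B. R z}) \<longleftrightarrow>
      (\<forall>x\<in>B. \<forall>y\<in>B. R x \<and> R y \<longrightarrow> R (mt x y))"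
    using mt_closed by blast
  moreover have "(\<forall>x\<in>{z \<in> B. R z}. \<forall>y\<in>B. mt x y = x \<longrightarrow> y \<in> {z \<in> B. R z}) \<longleftrightarrow>
      (\<forall>x\<in>B. \<forall>y\<in>B. R x \<and> mt x y = x \<longrightarrow> R y)"
    by blast
  moreover have "(\<forall>x\<in>B. x \<in> {z \<in> B. R z} \<or> cp x \<in> {z \<in> B. R z}) \<longleftrightarrow> (\<forall>x\<in>B. R x \<or> R (cp x))"
    using cp_closed by blast
  moreover have "{z \<in> B. R z} \<subseteq> B" "top_elt A \<in> {z \<in> B. R z} \<longleftrightarrow> R (top_elt A)"
    "bottom A \<in> {z \<in> B. R z} \<longleftrightarrow> R (bottom A)"
    by auto
  ultimately show ?thesis unfolding ultra_def proper_filter_def elts_sepS by argo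
qed

lemma (in model_algebra) ultra_eqI:
  assumes "ultra u" "ultra v" "elts u \<subseteq> elts v"
  shows "u = v"
proof (rule elts_inject, rule subset_antisym[OF assms(3)], rule subsetI)
  fix a assume "a \<in> elts v"
  then show "a \<in> elts u"
    using ultra_cp[OF assms(1), of a] ultra_cp[OF assms(2), of a] ultra_subset[OF assms(2), of a]
      assms(3) by blast
qed

section \<open>Nice names and basic open sets\<close>

locale generic_algebra = generic_model M P leq G + model_algebra M A
  for M :: "'v::set_universe set" and P leq G A
begin

text \<open>For \<open>T\<close> a subset of \<open>univ A\<close> times \<open>P\<close>, this is
  the value of a nice name in which elements of the algebra stand for their check names;
  \<open>nice_name\<close> supplies the actual name. Quantifying over such \<open>T\<close> is
  quantifying over a power set of \<open>M\<close>.\<close>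

definition interp :: "'v \<Rightarrow> 'v" where
  "interp T = sepS (univ A) (\<lambda>b. \<exists>p\<in>G. opair b p \<in> elts T)"

definition nice_name :: "'v \<Rightarrow> 'v" where
  "nice_name T = UnS (replS (univ A)
     (\<lambda>b. replS (sepS P (\<lambda>p. opair b p \<in> elts T)) (\<lambda>p. opair (check b) p)))"

lemma elts_nice_name:
  "elts (nice_name T) = {opair (check b) p | b p. b \<in> B \<and> p \<in> elts P \<and> opair b p \<in> elts T}"
  unfolding nice_name_def by auto

lemma is_name_nice_name: "is_name P (nice_name T)"
  by (rule is_name.intros) (use is_name_check in \<open>auto simp: mem_iff elts_nice_name\<close>)

lemma val_nice_name: "val G (nice_name T) = interp T"
proof (rule elts_inject, rule set_eqI)
  fix y
  have "y \<in> elts (val G (nice_name T)) \<longleftrightarrow>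
      (\<exists>q\<in>G. \<exists>b. b \<in> B \<and> q \<in> elts P \<and> opair b q \<in> elts T \<and> val G (check b) = y)"
    unfolding mem_val elts_nice_name by auto
  also have "\<dots> \<longleftrightarrow> y \<in> elts (interp T)"
    using G_subset by (auto simp: interp_def val_check)
  finally show "y \<in> elts (val G (nice_name T)) \<longleftrightarrow> y \<in> elts (interp T)" .
qed

lemma dfnt_nice_name: "dfnt f \<Longrightarrow> dfnt (\<lambda>\<rho>. nice_name (f \<rho>))"
  unfolding nice_name_def
  by (intro dfn_intros dfnt_check dfnt_alg_consts dfnt_const P_in_M dfnt_weaken)

lemma fdfn_ultra_interp: "fdfn (\<lambda>\<rho>. ultra (interp (\<rho> n)))"
  unfolding interp_def ultra_sepS by (intro fdfn_intros dfnt_alg_consts dfnt_mt dfnt_cp)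

text \<open>Convergence is tested with open sets of the extension, so separating two limits rests on
  this. Every ultrafilter of the extension is \<open>interp T\<close> for some \<open>T\<close> in
  the ground model's power set of \<open>prodS (univ A) P\<close>, and that \<open>interp T\<close>
  is an ultrafilter containing \<open>a\<close> is definable from \<open>T\<close> and
  \<open>G\<close>.\<close>

lemma stone_basic_in_N:
  assumes "a \<in> B"
  shows "\<exists>W\<in>N. elts W = stone_basic N A a"
proof -
  have "fdfn (\<lambda>\<rho>. ultra (interp (\<rho> 0)) \<and> (\<exists>p\<in>G. opair a p \<in> elts (\<rho> 0)))"
    by (intro fdfn_intros fdfn_ultra_interp dfnt_const M_trans[OF consts_in_M(1) assms])
  from family_in_N[OF powM(1)[OF prodS_in_M[OF consts_in_M(1) P_in_M]] this
      dfnt_nice_name[OF dfnt_var] is_name_nice_name]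
  obtain W where W: "W \<in> N" "elts W = {interp T | T. T \<in> elts (powM (prodS (univ A) P)) \<and>
      ultra (interp T) \<and> (\<exists>p\<in>G. opair a p \<in> elts T)}"
    unfolding val_nice_name by blast
  have "elts W = stone_basic N A a"
  proof (intro subset_antisym subsetI)
    fix u assume "u \<in> elts W"
    then obtain T where T: "T \<in> M" "u = interp T" "ultra (interp T)" "\<exists>p\<in>G. opair a p \<in> elts T"
      unfolding W(2) using powM(2)[OF prodS_in_M[OF consts_in_M(1) P_in_M]] by auto
    have "nice_name T \<in> M" using dfnt_const_in_M[OF dfnt_nice_name[OF dfnt_const[OF T(1)]]] .
    then have "u \<in> N" using val_in_N[OF _ is_name_nice_name] val_nice_name T(2) by metis
    moreover have "a \<in> elts u" using T(2,4) assms by (simp add: interp_def)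
    ultimately show "u \<in> stone_basic N A a"
      using T by (simp add: stone_basic_def stone_space_def is_ultrafilter_iff mem_iff)
  next
    fix u assume "u \<in> stone_basic N A a"
    then have u: "u \<in> N" "ultra u" "a \<in> elts u"
      by (auto simp: stone_basic_def stone_space_def is_ultrafilter_iff mem_iff)
    obtain \<tau> where \<tau>: "\<tau> \<in> M" "u = val G \<tau>"
      using u(1) unfolding generic_extension_def by blast
    obtain \<Phi> where \<Phi>: "\<And>m n. dfn (\<lambda>\<rho>. \<Phi> (\<rho> m) (\<rho> n))"
      "\<And>x. x \<in> M \<Longrightarrow> x \<in> elts (val G \<tau>) \<longleftrightarrow> (\<exists>p\<in>G. \<Phi> p x)"
      using fdfn_unary[OF fdfn_mem_val[OF \<tau>(1) dfnt_var]] by blast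
    \<comment> \<open>\<open>T\<close> keeps the pairs \<open>opair b p\<close> at which the forcing
      predicate for membership of \<open>b\<close> in the value of \<open>\<tau>\<close> holds, so
      that \<open>G\<close> interprets it as \<open>u\<close>.\<close>
    define T where "T = UnS (replS (univ A)
      (\<lambda>b. replS (sepS P (\<lambda>p. \<Phi> p b)) (\<lambda>p. opair b p)))"
    have "dfnt (\<lambda>\<rho>. T)"
      unfolding T_def by (intro dfn_intros \<Phi>(1) dfnt_alg_consts dfnt_const P_in_M)
    then have TM: "T \<in> M" by (rule dfnt_const_in_M)
    have T: "opair b p \<in> elts T \<longleftrightarrow> b \<in> B \<and> p \<in> elts P \<and> \<Phi> p b" for b p
      unfolding T_def by auto
    have "b \<in> elts (interp T) \<longleftrightarrow> b \<in> elts u" for b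
    proof -
      have "b \<in> elts (interp T) \<longleftrightarrow> b \<in> B \<and> (\<exists>p\<in>G. \<Phi> p b)"
        unfolding interp_def using T G_subset by auto
      also have "\<dots> \<longleftrightarrow> b \<in> B \<and> b \<in> elts u"
        using \<Phi>(2) M_trans[OF consts_in_M(1)] \<tau>(2) by blast
      finally show ?thesis using ultra_subset[OF u(2)] by blast
    qed
    then have uT: "u = interp T" using elts_inject by blast
    have "elts T \<subseteq> elts (prodS (univ A) P)" unfolding T_def by auto
    then have "T \<in> elts (powM (prodS (univ A) P))"
      using TM powM(2)[OF prodS_in_M[OF consts_in_M(1) P_in_M]] by blast
    moreover have "\<exists>p\<in>G. opair a p \<in> elts T" using u(3) uT by (simp add: interp_def)
    ultimately show "u \<in> elts W" unfolding W(2) using u(2) uT by blast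
  qed
  then show ?thesis using W(1) by blast
qed

section \<open>The limit and the sequence converging to it\<close>

theorem nontrivial_convergent_sequence:
  assumes inf: "infinite B" and U: "U \<in> N" "unsplit_over M U"
  shows "\<exists>y. stone_sequence N A y \<and> nontrivial_sequence N A y \<and> (\<exists>l. stone_converges N A y l)"
proof -
  obtain x where dfn_x: "dfnt (\<lambda>\<rho>. x (\<rho> 0))" and inj_x: "inj (\<lambda>n. x (num n))"
    and x: "\<And>n. x (num n) \<in> M \<and> ultra (x (num n))"
    by (rule ultrafilter_sequence[OF inf]) blast
  obtain \<tau> where \<tau>: "\<tau> \<in> M" "U = val G \<tau>"
    using U(1) unfolding generic_extension_def by blast
  note fdfn_U = fdfn_mem_val[OF \<tau>(1), folded \<tau>(2)]
  define V where "V = {n. num n \<in> elts U}"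
  have UV: "elts U = num ` V"
    using U(2) unfolding unsplit_over_def V_def by blast
  then have infV: "infinite V"
    using U(2) unfolding unsplit_over_def by auto
  define in_l where "in_l a \<longleftrightarrow> (\<exists>m. \<forall>n>m. n \<in> V \<longrightarrow> a \<in> elts (x (num n)))" for a
  \<comment> \<open>The order of the indices is membership of numerals, so \<open>in_l\<close> can
    be expressed by quantifiers bounded by \<open>omega\<close>.\<close>
  have "fdfn (\<lambda>\<rho>. \<exists>m\<in>elts omega. \<forall>n\<in>elts omega. m \<in> elts n \<longrightarrow> n \<in> elts U \<longrightarrow> \<rho> 0 \<in> elts (x n))"
    by (intro fdfn_intros fdfn_U dfnt_comp1[OF dfn_x] dfnt_const omega_in_M)
  then have "fdfn (\<lambda>\<rho>. in_l (\<rho> 0))"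
    by (rule fdfn_cong[rotated]) (auto simp: in_l_def V_def)
  then obtain l where l: "l \<in> N" "elts l = {a \<in> B. in_l a}"
    using subset_in_N[OF consts_in_M(1)] by blast
  have in_l_V: "\<exists>n\<in>V. a \<in> elts (x (num n)) \<and> b \<in> elts (x (num n)) \<and> m < n"
    if ab: "in_l a" "in_l b" for a b m
  proof -
    obtain i j where ij: "\<forall>n>i. n \<in> V \<longrightarrow> a \<in> elts (x (num n))"
      "\<forall>n>j. n \<in> V \<longrightarrow> b \<in> elts (x (num n))"
      using ab unfolding in_l_def by blast
    obtain n where n: "n \<in> V" "n > max m (max i j)"
      using infV unfolding infinite_nat_iff_unbounded by blast
    then show ?thesis using ij by (intro bexI[of _ n]) auto
  qed
  have in_l_mt: "in_l (mt a b)" if ab: "in_l a" "in_l b" for a b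
  proof -
    obtain i j where ij: "\<forall>n>i. n \<in> V \<longrightarrow> a \<in> elts (x (num n))"
      "\<forall>n>j. n \<in> V \<longrightarrow> b \<in> elts (x (num n))"
      using ab unfolding in_l_def by blast
    have "\<forall>n>max i j. n \<in> V \<longrightarrow> mt a b \<in> elts (x (num n))"
      using ij x ultra_mt by simp
    then show ?thesis unfolding in_l_def by blast
  qed
  have in_l_cp: "in_l a \<or> in_l (cp a)" if a: "a \<in> B" for a
  proof -
    \<comment> \<open>The set to which unsplitness is applied; definability of \<open>x\<close>
      places it in \<open>M\<close>.\<close>
    let ?N = "sepS omega (\<lambda>n. a \<in> elts (x n))"
    have "?N \<in> M"
      by (intro sepS_in_M omega_in_M dfn_intros dfnt_comp1[OF dfn_x] dfnt_const
          M_trans[OF consts_in_M(1) a])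
    then have "finite (elts U \<inter> elts ?N) \<or> finite (elts U - elts ?N)"
      using U(2) unfolding unsplit_over_def by auto
    moreover have eqs: "elts U \<inter> elts ?N = num ` {n \<in> V. a \<in> elts (x (num n))}"
      "elts U - elts ?N = num ` {n \<in> V. a \<notin> elts (x (num n))}"
      unfolding UV by auto
    ultimately have "finite {n \<in> V. a \<in> elts (x (num n))} \<or> finite {n \<in> V. a \<notin> elts (x (num n))}"
      unfolding eqs finite_image_iff[OF inj_on_subset[OF inj_num subset_UNIV]] by blast
    then obtain m where "(\<forall>n\<in>{n \<in> V. a \<in> elts (x (num n))}. n \<le> m) \<or>
        (\<forall>n\<in>{n \<in> V. a \<notin> elts (x (num n))}. n \<le> m)"
      unfolding finite_nat_set_iff_bounded_le by blast
    then have "(\<forall>n>m. n \<in> V \<longrightarrow> a \<notin> elts (x (num n))) \<or> (\<forall>n>m. n \<in> V \<longrightarrow> a \<in> elts (x (num n)))"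
      by force
    moreover have "cp a \<in> elts (x (num n)) \<longleftrightarrow> a \<notin> elts (x (num n))" for n
      using x ultra_cp a by blast
    ultimately show ?thesis unfolding in_l_def by blast
  qed
  have ultra_l: "ultra l"
    unfolding ultra_def proper_filter_def
  proof (intro conjI ballI impI)
    show "elts l \<subseteq> B" using l(2) by blast
    have "in_l (top_elt A)" unfolding in_l_def using x ultra_top by blast
    then show "top_elt A \<in> elts l" using l(2) by simp
    have "\<not> in_l (bottom A)" using in_l_V[of "bottom A" "bottom A"] x ultra_bot by blast
    then show "bottom A \<notin> elts l" using l(2) by simp
    show "mt a b \<in> elts l" if "a \<in> elts l" "b \<in> elts l" for a b
      using that in_l_mt l(2) by simp
    show "b \<in> elts l" if "a \<in> elts l" "b \<in> B" "mt a b = a" for a b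
    proof -
      have "a \<in> elts (x (num n)) \<Longrightarrow> b \<in> elts (x (num n))" for n
        using x ultra_up that(2,3) by blast
      then show ?thesis using that(1,2) l(2) unfolding in_l_def by blast
    qed
    show "a \<in> elts l \<or> cp a \<in> elts l" if "a \<in> B" for a
      using in_l_cp that l(2) by simp
  qed
  \<comment> \<open>Injectivity leaves at most one index with term \<open>l\<close>; if there is
    none, \<open>c\<close> is an arbitrary numeral. An index can serve as a parameter, whereas
    \<open>l\<close> may lie outside \<open>M\<close>.\<close>
  obtain c where cM: "c \<in> M" and c: "\<And>n. x (num n) = l \<Longrightarrow> num n = c"
  proof (cases "\<exists>n. x (num n) = l")
    case True
    then obtain n where "x (num n) = l" by blast
    then show thesis using that[of "num n"] num_in_M inj_x by (metis injD)
  next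
    case False
    then show thesis using that[OF num_in_M] by blast
  qed
  define K where "K = {n \<in> V. num n \<noteq> c}"
  have "finite {n. num n = c}"
    by (rule finite_subset[of _ "{THE n. num n = c}"]) (auto simp: the_equality)
  moreover have "V \<subseteq> K \<union> {n. num n = c}" by (auto simp: K_def)
  ultimately have infK: "infinite K" using infV by (meson finite_UnI finite_subset)
  define e where "e = enumerate K"
  have eK: "e k \<in> K" for k unfolding e_def by (rule enumerate_in_set[OF infK])
  have e_mono: "i < j \<Longrightarrow> e i < e j" for i j unfolding e_def by (rule enumerate_mono[OF _ infK])
  have e_ge: "k \<le> e k" for k
    unfolding e_def by (rule le_enumerate[OF infK])
  define y where "y k = x (num (e k))" for k
  have y_N: "y k \<in> N" "ultra (y k)" for k
    unfolding y_def using x M_subset_N by auto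
  have y_space: "y k \<in> stone_space N A" for k
    using y_N by (simp add: stone_space_def is_ultrafilter_iff)
  have y_l: "y k \<noteq> l" for k
    unfolding y_def using c[of "e k"] eK[of k] by (auto simp: K_def)
  have inj_e: "inj e" by (rule linorder_injI) (use e_mono in \<open>metis less_irrefl\<close>)
  have inj_y: "inj y"
    unfolding y_def using inj_x inj_e by (simp add: inj_def)
  have eventually_y: "\<exists>k. \<forall>n\<ge>k. a \<in> elts (y n)" if a: "a \<in> elts l" for a
  proof -
    obtain m where m: "\<forall>n>m. n \<in> V \<longrightarrow> a \<in> elts (x (num n))"
      using a l(2) unfolding in_l_def by blast
    \<comment> \<open>\<open>Suc m\<close> accounts for the strict bound in \<open>in_l\<close>,
      which \<open>e_ge\<close> carries over to the index \<open>e n\<close>.\<close>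
    have "a \<in> elts (y n)" if "n \<ge> Suc m" for n
      unfolding y_def using m e_ge[of n] eK[of n] that by (simp add: K_def)
    then show ?thesis by blast
  qed
  have conv: "stone_converges N A y l"
    unfolding stone_converges_def
  proof (intro conjI allI impI)
    show "l \<in> stone_space N A" using l(1) ultra_l by (simp add: stone_space_def is_ultrafilter_iff)
    fix W assume W: "stone_open N A W \<and> l \<epsilon> W"
    then have "l \<in> elts W" by (simp add: mem_iff)
    then obtain a where a: "l \<in> stone_basic N A a" "stone_basic N A a \<subseteq> elts W"
      using W unfolding stone_open_def by blast
    then have "a \<in> elts l" by (simp add: stone_basic_def mem_iff)
    then obtain k where "\<forall>n\<ge>k. a \<in> elts (y n)" using eventually_y by blast
    then have "\<forall>n\<ge>k. y n \<in> stone_basic N A a"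
      using y_space by (simp add: stone_basic_def mem_iff)
    then show "\<exists>k. \<forall>n\<ge>k. y n \<epsilon> W" using a(2) unfolding mem_iff by blast
  qed
  \<comment> \<open>\<open>nontrivial_sequence\<close> constrains every limit, so \<open>y_l\<close>
    must be carried from \<open>l\<close> to all of them.\<close>
  have unique: "l' = l" if l': "stone_converges N A y l'" for l'
  proof (rule ccontr)
    assume "l' \<noteq> l"
    have l'_space: "l' \<in> stone_space N A" using l' unfolding stone_converges_def by blast
    then have ul': "ultra l'" by (simp add: stone_space_def is_ultrafilter_iff)
    then obtain a where a: "a \<in> elts l'" "a \<notin> elts l"
      using ultra_eqI[OF ul' ultra_l] \<open>l' \<noteq> l\<close> by blast
    have aB: "a \<in> B" using ultra_subset[OF ul' a(1)] .
    obtain W where W: "W \<in> N" "elts W = stone_basic N A a" using stone_basic_in_N[OF aB] by blast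
    have "stone_open N A W"
      unfolding stone_open_def using W aB by (auto simp: stone_basic_def)
    moreover have "l' \<epsilon> W" using W(2) l'_space a(1) by (simp add: mem_iff stone_basic_def)
    ultimately obtain k where k: "\<forall>n\<ge>k. y n \<in> elts W"
      using l' unfolding stone_converges_def mem_iff by blast
    have "cp a \<in> elts l" using ultra_cp[OF ultra_l aB] a(2) by blast
    then obtain k' where k': "\<forall>n\<ge>k'. cp a \<in> elts (y n)" using eventually_y by blast
    have "a \<in> elts (y (max k k'))" using k W(2) by (simp add: stone_basic_def mem_iff)
    moreover have "cp a \<in> elts (y (max k k'))" using k' by simp
    ultimately show False using ultra_cp[OF y_N(2) aB] by blast
  qed
  have "nontrivial_sequence N A y"
    unfolding nontrivial_sequence_def using inj_y unique y_l by blast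
  moreover have "stone_sequence N A y"
    unfolding stone_sequence_def
  proof (intro conjI)
    show "range y \<subseteq> stone_space N A" using y_space by blast
    \<comment> \<open>The condition of \<open>enumerate_approx\<close>, restated with numerals and
      membership so that it is definable over \<open>M\<close> and \<open>G\<close>.\<close>
    define approx_e where "approx_e f \<longleftrightarrow>
      (\<forall>j\<in>elts omega. \<forall>m\<in>elts omega. opair j m \<in> elts f \<longrightarrow>
        (m \<in> elts U \<and> \<not> m = c) \<and>
        (\<forall>i\<in>elts j. \<exists>m'\<in>elts m. opair i m' \<in> elts f) \<and>
        (\<forall>m'\<in>elts m. m' \<in> elts U \<and> \<not> m' = c \<longrightarrow> (\<exists>i\<in>elts j. opair i m' \<in> elts f)))" for f
    have approx_e_iff: "approx_e f \<longleftrightarrow> (\<forall>j m. opair (num j) (num m) \<in> elts f \<longrightarrow>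
        m \<in> K \<and> (\<forall>i<j. \<exists>m'<m. opair (num i) (num m') \<in> elts f) \<and>
        (\<forall>m'<m. m' \<in> K \<longrightarrow> (\<exists>i<j. opair (num i) (num m') \<in> elts f)))" for f
    proof -
      have num: "(\<forall>i\<in>elts (num j). R i) \<longleftrightarrow> (\<forall>i<j. R (num i))"
        "(\<exists>i\<in>elts (num j). R i) \<longleftrightarrow> (\<exists>i<j. R (num i))" for j and R :: "'v \<Rightarrow> bool"
        by (auto simp: elts_num)
      show ?thesis
        unfolding approx_e_def elts_omega by (simp add: num K_def V_def)
    qed
    have graph: "(\<exists>f\<in>M. approx_e f \<and> opair (num k) (num n) \<in> elts f) \<longleftrightarrow> n = e k" for k n
    proof
      assume "\<exists>f\<in>M. approx_e f \<and> opair (num k) (num n) \<in> elts f"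
      then obtain f where f: "approx_e f" "opair (num k) (num n) \<in> elts f" by blast
      show "n = e k"
        unfolding e_def
        by (rule enumerate_approx[OF infK, of "\<lambda>j m. opair (num j) (num m) \<in> elts f"])
          (use f in \<open>simp_all add: approx_e_iff\<close>)
    next
      assume n: "n = e k"
      \<comment> \<open>The graph of \<open>e\<close> up to and including \<open>k\<close> is the
        witness: its domain is an initial segment, so it records every predecessor that
        \<open>approx_e\<close> asks for.\<close>
      have "(\<lambda>i. opair (num i) (num (e i))) ` {..k} \<subseteq> M" using num_in_M by auto
      then obtain f where f: "f \<in> M" "elts f = (\<lambda>i. opair (num i) (num (e i))) ` {..k}"
        using finite_set_in_M[of "(\<lambda>i. opair (num i) (num (e i))) ` {..k}"] by blast
      have mem_f: "opair (num j) (num m) \<in> elts f \<longleftrightarrow> j \<le> k \<and> m = e j" for j m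
        unfolding f(2) by auto
      have below: "\<exists>i<j. m' = e i" if m': "m' < e j" "m' \<in> K" for j m'
      proof -
        obtain i where i: "m' = e i" using enumerate_Ex[OF infK m'(2)] unfolding e_def by blast
        then have "i < j" using m'(1) e_mono[of j i] by (metis less_asym linorder_neqE_nat)
        then show ?thesis using i by blast
      qed
      have "approx_e f"
        unfolding approx_e_iff mem_f
      proof (intro allI impI conjI)
        fix j m assume jm: "j \<le> k \<and> m = e j"
        show "m \<in> K" using jm eK by simp
        show "\<exists>m'<m. i \<le> k \<and> m' = e i" if "i < j" for i
          using jm that e_mono[OF that] by auto
        show "\<exists>i<j. i \<le> k \<and> m' = e i" if "m' < m" "m' \<in> K" for m'
        proof -
          obtain i where "i < j" "m' = e i" using below[of m' j] jm \<open>m' < m\<close> \<open>m' \<in> K\<close> by blast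
          then show ?thesis using jm by (intro exI[of _ i]) simp
        qed
      qed
      then show "\<exists>f\<in>M. approx_e f \<and> opair (num k) (num n) \<in> elts f"
        using f(1) mem_f n by blast
    qed
    define Q where "Q z \<longleftrightarrow> (\<exists>k\<in>elts omega. \<exists>n\<in>elts omega. z = opair k (x n) \<and>
      (\<exists>f\<in>M. approx_e f \<and> opair k n \<in> elts f))" for z
    have "fdfn (\<lambda>\<rho>. Q (\<rho> 0))"
      unfolding Q_def approx_e_def
      by (intro fdfn_intros fdfn_U dfnt_comp1[OF dfn_x] dfnt_const omega_in_M cM)
    \<comment> \<open>A set of \<open>M\<close> that bounds the graph: each \<open>y k\<close> is
      one of the \<open>x (num n)\<close>, and separation by \<open>Q\<close> picks the pairs that
      occur.\<close>
    moreover have "prodS omega (replS omega x) \<in> M"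
      by (intro prodS_in_M replS_in_M omega_in_M dfn_x)
    ultimately obtain s where s: "s \<in> N" "elts s = {z \<in> elts (prodS omega (replS omega x)). Q z}"
      using subset_in_N by blast
    have Q: "Q z \<longleftrightarrow> (\<exists>k. z = opair (num k) (y k))" for z
      unfolding Q_def y_def using graph by auto
    have "elts s = range (\<lambda>n. opair (num n) (y n))"
      unfolding s(2) Q by (auto simp: y_def)
    then show "\<exists>s\<in>N. elts s = range (\<lambda>n. opair (num n) (y n))" using s(1) by blast
  qed
  ultimately show ?thesis using conv by blast
qed

end

theorem theorem3p4:
  fixes M :: "'v::set_universe set" and P leq :: 'v and A :: "'v bool_alg"
  assumes "ground_model M"
    and "P \<in> M" and "leq \<in> M" and "forcing_notion P leq"
    and "adds_unsplit_real M P leq"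
    and "bool_alg_in A M" and "is_boolean_algebra A" and "infinite (elts (univ A))"
  shows "\<forall>G. generic_filter M P leq G \<longrightarrow>
    (\<exists>x. stone_sequence (generic_extension M P G) A x \<and>
         nontrivial_sequence (generic_extension M P G) A x \<and>
         (\<exists>l. stone_converges (generic_extension M P G) A x l))"
proof (intro allI impI)
  fix G assume G: "generic_filter M P leq G"
  obtain U where U: "U \<in> generic_extension M P G" "unsplit_over M U"
    using assms(5) G unfolding adds_unsplit_real_def by blast
  interpret ZFC_model M using assms(1) by (simp add: ground_model_def)
  interpret generic_algebra M P leq G A
    by unfold_locales (use assms G in \<open>simp_all add: ground_model_def\<close>)
  show "\<exists>x. stone_sequence (generic_extension M P G) A x \<and>
      nontrivial_sequence (generic_extension M P G) A x \<and>
      (\<exists>l. stone_converges (generic_extension M P G) A x l)"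
    using nontrivial_convergent_sequence[OF assms(8) U] .
qed

end
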